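(* There is a constant $k_0$ such that, for every $\varepsilon>0$ and all integers $n$ and $k$ with $n\geq k\geq \max\{\varepsilon^{-121},k_0\}$, all $(1/2+\varepsilon)$-subgraphs of $C_n^k$ are Hamiltonian.
   Context: $C_n^k$ is the $k$th power of the cycle $C_n$ on $n$ vertices: its vertex set is that of $C_n$ (identified with $\mathbb{Z}/n\mathbb{Z}$), and two distinct vertices are adjacent if and only if their distance in $C_n$ is at most $k$. For a real number $\beta$, a subgraph $H$ of a graph $G$ is a $\beta$-subgraph of $G$ if $d_H(v)\geq \beta\, d_G(v)$ for all $v\in V(G)$ (in particular $H$ is spanning). A graph is Hamiltonian if it contains a Hamilton cycle. *)

theory Defs
  imports Complex_Main "Graph_Theory.Graph_Theory"
begin

text \<open>
  Simple graphs are modelled as in the Graph_Theory entry: a simple graph is a finite, loopless,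
  symmetric digraph without parallel arcs (locale \<^locale>\<open>pair_graph\<close>), an undirected edge
  being the pair of arcs (u,v), (v,u). Hence the degree of a vertex is its \<^const>\<open>out_degree\<close>.
\<close>

text \<open>The condition u \<noteq> v only matters for n = 1, where it removes the loop.\<close>

definition cycle_graph :: "nat \<Rightarrow> nat pair_pre_digraph" where
  "cycle_graph n =
    \<lparr> pverts = {0..<n},
      parcs = {(u, v). u < n \<and> v < n \<and> u \<noteq> v \<and> (v = (u + 1) mod n \<or> u = (v + 1) mod n)} \<rparr>"

text \<open>
  The length of a shortest walk (infinity if there is none): the shortest path distance
  of the library with all arc weights equal to 1.
\<close>

definition graph_dist :: "'a pair_pre_digraph \<Rightarrow> 'a \<Rightarrow> 'a \<Rightarrow> ereal" where
  "graph_dist G u v = wf_digraph.\<mu> (with_proj G) (\<lambda>_. 1) u v"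

definition graph_power :: "'a pair_pre_digraph \<Rightarrow> nat \<Rightarrow> 'a pair_pre_digraph" where
  "graph_power G k =
    \<lparr> pverts = pverts G,
      parcs = {(u, v). u \<in> pverts G \<and> v \<in> pverts G \<and> u \<noteq> v \<and> graph_dist G u v \<le> ereal (real k)} \<rparr>"

definition beta_subgraph :: "real \<Rightarrow> 'a pair_pre_digraph \<Rightarrow> 'a pair_pre_digraph \<Rightarrow> bool" where
  "beta_subgraph \<beta> H G \<longleftrightarrow>
    pair_graph H \<and> spanning (with_proj H) (with_proj G) \<and>
    (\<forall>v \<in> pverts G. real (out_degree (with_proj H) v) \<ge> \<beta> * real (out_degree (with_proj G) v))"

text \<open>
  In a symmetric digraph the closed walk u, v, u is a \<^const>\<open>pre_digraph.cycle\<close>; it is not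
  a cycle of the undirected graph, whence the length condition. The vertices of a cycle are the
  tails of its arcs.
\<close>

definition hamilton_cycle :: "'a pair_pre_digraph \<Rightarrow> ('a \<times> 'a) list \<Rightarrow> bool" where
  "hamilton_cycle G p \<longleftrightarrow>
    pre_digraph.cycle (with_proj G) p \<and> length p \<ge> 3 \<and> fst ` set p = pverts G"

definition hamiltonian :: "'a pair_pre_digraph \<Rightarrow> bool" where
  "hamiltonian G \<longleftrightarrow> (\<exists>p. hamilton_cycle G p)"

lemma pair_graph_cycle_graph: "pair_graph (cycle_graph n)"
proof -
  have "finite (parcs (cycle_graph n))"
    by (rule finite_subset[of _ "{0..<n} \<times> {0..<n}"]) (auto simp: cycle_graph_def)
  then show ?thesis
    by unfold_locales (auto simp: cycle_graph_def symmetric_def sym_def)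
qed

lemma graph_dist_cycle_graph:
  "graph_dist (cycle_graph n) u v =
    (INF p \<in> {p. pre_digraph.awalk (with_proj (cycle_graph n)) u p v}. ereal (real (length p)))"
proof -
  interpret pair_graph "cycle_graph n" by (rule pair_graph_cycle_graph)
  show ?thesis
    by (simp add: graph_dist_def \<mu>_def awalk_cost_def sum_list_triv)
qed

end

theory Submission
  imports Defs "HOL-Combinatorics.Orbits" "HOL-Library.Infinite_Set"
begin

text \<open>
  Let \<open>A\<close>, \<open>B\<close> be sets of equal size, spread evenly around the cycle, such that every vertex of one has more
  than half of the vertices of the other within distance \<open>k\<close> as neighbours. Then \<open>A\<close>, \<open>B\<close> have a
  perfect matching. Indeed, if \<open>S \<subseteq> A\<close> and \<open>R \<subseteq> B\<close> span no edge, let two tokens walk around the cycle at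
  distance \<open>k\<close>, the rear one counting \<open>S\<close> and the front one \<open>R\<close>. While the front token meets no element of \<open>R\<close>,
  both advance; otherwise the rear token jumps over the whole window around that element, which contains few
  elements of \<open>S\<close>, and becomes the front one. Relative to the size of \<open>A\<close> the count never grows, so
  \<open>|S| + |R| \<le> |A|\<close>, which is Hall's condition.

  Reserve \<open>N\<close> disjoint short paths, the \<open>j\<close>-th located near \<open>j n / N\<close>, whose initial and whose final vertices are
  evenly spread. Two consecutive paths carry arcs \<open>x \<rightarrow> m\<close> and \<open>x' \<rightarrow> m'\<close> where both \<open>m\<close> and \<open>m'\<close> are
  adjacent to both \<open>x\<close> and \<open>x'\<close>. Split the other vertices into layers of size \<open>N\<close> which every neighbourhood
  meets in the expected proportion. Matching the final vertices to the first layer, each layer to the next one, and the last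
  layer to the initial vertices gives a permutation along edges each of whose cycles uses a
  reserved path. Exchanging the images of \<open>x\<close> and \<open>x'\<close> joins the cycles of consecutive paths, so
  one obtains a single cycle.
\<close>

section \<open>Matchings between evenly spread sets\<close>

text \<open>The cycle length \<open>n\<close> is not bounded in terms of \<open>k\<close>, so an
  error term growing with \<open>n\<close>, even \<open>ln n\<close>, would be fatal: every
  averaging or greedy choice has to be controlled by what happens within distance O(k). Matchings
  alone give no hold on the number of cycles of the permutation; forcing every cycle through one of
  \<open>N\<close> ordered paths turns connecting them into a local question, because consecutive
  paths are close enough to share a gadget. Quantitatively, there are \<open>D = M + 11\<close>
  vertices for each path: 11 reserved ones and one for each of the \<open>M\<close> layers; fewer
  than \<open>D\<close> vertices are left over and are absorbed by the closing matching. A vertex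
  misses about (1 - \<epsilon>) k / D vertices of a layer, while the matching tolerates almost k /
  D. The reserved vertices are placed without control at scale \<open>k\<close>, which costs a
  discrepancy of order k / M, and the balancing of the layers costs a logarithm of \<open>k\<close>.
  So \<open>M\<close> has to be a large multiple of 1 / \<epsilon>, and \<open>k\<close> at least a
  power of 1 / \<epsilon>.\<close>

theorem hall_matching:
  fixes E :: "'a \<Rightarrow> 'b set"
  assumes "finite A" "\<And>a. a \<in> A \<Longrightarrow> finite (E a)"
    and "\<And>S. S \<subseteq> A \<Longrightarrow> card S \<le> card (\<Union>a\<in>S. E a)"
  shows "\<exists>f. inj_on f A \<and> (\<forall>a\<in>A. f a \<in> E a)"
  using assms
proof (induction "card A" arbitrary: A E rule: less_induct)
  case less
  note fin = less.prems(1) and finE = less.prems(2) and hall = less.prems(3)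
  show ?case
  proof (cases "A = {}")
    case False
    show ?thesis
    \<comment> \<open>A proper tight set and its complement can be matched separately. Without one,
      every other nonempty set has a spare neighbour, so that an arbitrary pair may be
      removed.\<close>
    proof (cases "\<exists>S. S \<subseteq> A \<and> S \<noteq> {} \<and> S \<noteq> A \<and> card (\<Union>a\<in>S. E a) = card S")
      case True
      then obtain S where S: "S \<subseteq> A" "S \<noteq> {}" "S \<noteq> A" and tight: "card (\<Union>a\<in>S. E a) = card S"
        by blast
      define K where "K = (\<Union>a\<in>S. E a)"
      have finS: "finite S" using S(1) fin finite_subset by blast
      have finK: "finite K" unfolding K_def using finS S(1) finE by blast
      have "card S < card A" using S fin by (simp add: psubsetI psubset_card_mono)
      then obtain f where f: "inj_on f S" "\<forall>a\<in>S. f a \<in> E a"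
        using less.hyps[of S E] finS finE hall S(1) by (metis order_trans subsetD)
      have "card (A - S) < card A"
        using S fin by (intro psubset_card_mono) auto
      moreover have "card T \<le> card (\<Union>a\<in>T. E a - K)" if T: "T \<subseteq> A - S" for T
      proof -
        have finT: "finite T" using T fin finite_subset by blast
        have "card T + card S = card (T \<union> S)"
          using T finT finS by (subst card_Un_disjoint) auto
        also have "\<dots> \<le> card (\<Union>a\<in>T \<union> S. E a)" using hall[of "T \<union> S"] T S(1) by blast
        also have "(\<Union>a\<in>T \<union> S. E a) = (\<Union>a\<in>T. E a - K) \<union> K" unfolding K_def by blast
        also have "card \<dots> \<le> card (\<Union>a\<in>T. E a - K) + card K" by (rule card_Un_le)
        finally show ?thesis using tight unfolding K_def by simp
      qed
      ultimately have "\<exists>g. inj_on g (A - S) \<and> (\<forall>a\<in>A - S. g a \<in> E a - K)"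
        using fin finE by (intro less.hyps) auto
      then obtain g where g: "inj_on g (A - S)" "\<forall>a\<in>A - S. g a \<in> E a - K" by blast
      define h where "h a = (if a \<in> S then f a else g a)" for a
      have "inj_on h A"
      proof -
        have "inj_on h S" "inj_on h (A - S)"
          using f(1) g(1) by (auto simp: h_def inj_on_def)
        moreover have "h ` S \<subseteq> K" "h ` (A - S) \<inter> K = {}"
          using f(2) g(2) by (auto simp: h_def K_def)
        moreover have "A = S \<union> (A - S)" using S(1) by blast
        ultimately have "inj_on h (S \<union> (A - S))" unfolding inj_on_Un by blast
        then show ?thesis using \<open>A = S \<union> (A - S)\<close> by simp
      qed
      moreover have "\<forall>a\<in>A. h a \<in> E a" using f g unfolding h_def by auto
      ultimately show ?thesis by blast
    next
      case no_tight: False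
      obtain a where a: "a \<in> A" using False by blast
      have "card {a} \<le> card (E a)" using hall[of "{a}"] a by simp
      then obtain b where b: "b \<in> E a" by fastforce
      have "card (A - {a}) < card A" using a fin by (intro psubset_card_mono) auto
      moreover have "card T \<le> card (\<Union>x\<in>T. E x - {b})" if T: "T \<subseteq> A - {a}" for T
      proof (cases "T = {}")
        case False
        have finT: "finite T" using T fin finite_subset by blast
        have "T \<subseteq> A" "T \<noteq> A" using T a by auto
        then have "card T \<noteq> card (\<Union>x\<in>T. E x)"
          using no_tight[unfolded not_ex, THEN spec, of T] False by metis
        moreover have "card T \<le> card (\<Union>x\<in>T. E x)" using hall[of T] T by blast
        moreover have "(\<Union>x\<in>T. E x - {b}) = (\<Union>x\<in>T. E x) - {b}" by blast
        ultimately show ?thesis by (auto simp: card_Diff_singleton_if)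
      qed simp
      ultimately have "\<exists>g. inj_on g (A - {a}) \<and> (\<forall>x\<in>A - {a}. g x \<in> E x - {b})"
        using fin finE by (intro less.hyps) auto
      then obtain g where g: "inj_on g (A - {a})" "\<forall>x\<in>A - {a}. g x \<in> E x - {b}" by blast
      have "inj_on (g(a := b)) A"
      proof -
        have "inj_on (g(a := b)) (A - {a})" by (rule inj_on_cong[THEN iffD1, OF _ g(1)]) auto
        moreover have "(g(a := b)) a \<notin> (g(a := b)) ` (A - {a} - {a})" using g(2) by auto
        ultimately have "inj_on (g(a := b)) (insert a (A - {a}))" by (simp only: inj_on_insert simp_thms)
        then show ?thesis using a by (simp only: insert_Diff)
      qed
      moreover have "\<forall>x\<in>A. (g(a := b)) x \<in> E x" using g b by auto
      ultimately show ?thesis by blast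
    qed
  qed auto
qed

text \<open>An earlier choice can be in the way only if its set meets the current one. Counting just
  those sets keeps the hypothesis free of \<open>K\<close>, which is \<open>5 * N\<close> when the
  paths are built.\<close>

lemma greedy_distinct_choice:
  fixes X :: "nat \<Rightarrow> 'a set"
  assumes "finite F" "\<And>i. i < K \<Longrightarrow> finite (X i)"
    and "\<And>i. i < K \<Longrightarrow> card (F \<inter> X i) + card {i'. i' < K \<and> X i' \<inter> X i \<noteq> {}} < card (X i)"
  shows "\<exists>f. inj_on f {..<K} \<and> (\<forall>i<K. f i \<in> X i - F)"
proof -
  have "\<exists>f. inj_on f {..<m} \<and> (\<forall>i<m. f i \<in> X i - F)" if "m \<le> K" for m
    using that
  proof (induction m)
    case (Suc m)
    then obtain f where f: "inj_on f {..<m}" "\<forall>i<m. f i \<in> X i - F" by auto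
    let ?I = "{i. i < m \<and> f i \<in> X m}"
    have "card (F \<inter> X m \<union> f ` ?I) \<le> card (F \<inter> X m) + card (f ` ?I)" by (rule card_Un_le)
    also have "card (f ` ?I) \<le> card ?I" by (rule card_image_le) simp
    also have "card ?I \<le> card {i'. i' < K \<and> X i' \<inter> X m \<noteq> {}}"
      using Suc.prems f(2) by (intro card_mono) auto
    finally have "card (F \<inter> X m \<union> f ` ?I) < card (X m)"
      using assms(3)[of m] Suc.prems by simp
    moreover have "finite (F \<inter> X m \<union> f ` ?I)" using assms(1) by simp
    ultimately have "\<not> X m \<subseteq> F \<inter> X m \<union> f ` ?I" by (meson card_mono linorder_not_less)
    then obtain x where x: "x \<in> X m" "x \<notin> F \<inter> X m \<union> f ` ?I" by blast
    have "inj_on (f(m := x)) {..<Suc m}"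
      using f x by (auto simp: inj_on_def less_Suc_eq)
    moreover have "\<forall>i<Suc m. (f(m := x)) i \<in> X i - F" using f x by (auto simp: less_Suc_eq)
    ultimately show ?case by (intro exI conjI)
  qed simp
  then show ?thesis by blast
qed

text \<open>Prefix counts on the cycle unrolled to the natural numbers: a token may go around any
  number of times, and no interval has to be split where it passes \<open>0\<close>.\<close>

definition cnt :: "nat \<Rightarrow> nat set \<Rightarrow> nat \<Rightarrow> nat" where
  "cnt n A x = card {y. y < x \<and> y mod n \<in> A}"

lemma cnt_add: "cnt n A (x + d) = cnt n A x + card {y. x \<le> y \<and> y < x + d \<and> y mod n \<in> A}"
proof -
  have "{y. y < x + d \<and> y mod n \<in> A}
      = {y. y < x \<and> y mod n \<in> A} \<union> {y. x \<le> y \<and> y < x + d \<and> y mod n \<in> A}" by auto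
  moreover have "finite {y. x \<le> y \<and> y < x + d \<and> y mod n \<in> A}"
    by (rule finite_subset[of _ "{..<x + d}"]) auto
  moreover have "{y. y < x \<and> y mod n \<in> A} \<inter> {y. x \<le> y \<and> y < x + d \<and> y mod n \<in> A} = {}" by auto
  ultimately show ?thesis unfolding cnt_def by (simp add: card_Un_disjoint)
qed

lemma cnt_Suc: "cnt n A (Suc x) = cnt n A x + (if x mod n \<in> A then 1 else 0)"
proof -
  have "{y. x \<le> y \<and> y < x + 1 \<and> y mod n \<in> A} = (if x mod n \<in> A then {x} else {})"
    by (auto simp: le_antisym le_less_Suc_eq)
  then show ?thesis using cnt_add[of n A x 1] by simp
qed

lemma cnt_mono: "x \<le> y \<Longrightarrow> cnt n A x \<le> cnt n A y"
  using cnt_add[of n A x "y - x"] by simp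

lemma inj_on_mod_interval: "inj_on (\<lambda>y. y mod n) {x..<x + n}" for n x :: nat
proof (rule inj_onI)
  have eq: "a = b" if "a \<le> b" "x \<le> a" "b < x + n" "a mod n = b mod n" for a b
  proof -
    have "n dvd b - a" using that mod_eq_dvd_iff_nat[of a b n] by simp
    moreover have "b - a < n" using that by linarith
    ultimately have "b - a = 0" using nat_dvd_not_less by blast
    then show ?thesis using that by simp
  qed
  fix a b assume "a \<in> {x..<x + n}" "b \<in> {x..<x + n}" "a mod n = b mod n"
  then show "a = b" using eq[of a b] eq[of b a] by fastforce
qed

lemma cnt_period:
  assumes "A \<subseteq> {..<n}"
  shows "cnt n A (x + n) = cnt n A x + card A"
proof (cases "n = 0")
  case False
  have "bij_betw (\<lambda>y. y mod n) {y. x \<le> y \<and> y < x + n \<and> y mod n \<in> A} A"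
  proof (rule bij_betw_imageI)
    show "inj_on (\<lambda>y. y mod n) {y. x \<le> y \<and> y < x + n \<and> y mod n \<in> A}"
      by (rule inj_on_subset[OF inj_on_mod_interval[of n x]]) auto
    have onto: "\<exists>y. x \<le> y \<and> y < x + n \<and> y mod n = a" if "a < n" for a
    proof (intro exI conjI)
      let ?y = "x + (a + n - x mod n) mod n"
      show "x \<le> ?y" "?y < x + n" using False by auto
      have "?y mod n = (x mod n + (a + n - x mod n)) mod n" by (simp add: mod_simps)
      also have "x mod n + (a + n - x mod n) = a + n"
        using False by (metis add.commute le_add2 le_add_diff_inverse mod_less_divisor not_gr_zero order_less_imp_le order_trans)
      finally show "?y mod n = a" using that by simp
    qed
    show "(\<lambda>y. y mod n) ` {y. x \<le> y \<and> y < x + n \<and> y mod n \<in> A} = A"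
    proof (intro equalityI subsetI)
      fix a assume "a \<in> A"
      then obtain y where "x \<le> y" "y < x + n" "y mod n = a" using onto assms by blast
      then show "a \<in> (\<lambda>y. y mod n) ` {y. x \<le> y \<and> y < x + n \<and> y mod n \<in> A}"
        using \<open>a \<in> A\<close> by blast
    qed auto
  qed
  then show ?thesis using cnt_add[of n A x n] by (simp add: bij_betw_same_card)
qed (use assms in \<open>auto simp: cnt_def\<close>)

lemma cnt_period_mult: "A \<subseteq> {..<n} \<Longrightarrow> cnt n A (x + q * n) = cnt n A x + q * card A"
proof (induction q)
  case (Suc q)
  then show ?case using cnt_period[of A n "x + q * n"] by (simp add: algebra_simps)
qed simp

lemma cnt_upto:
  assumes "A \<subseteq> {..<n}" "x \<le> n"
  shows "cnt n A x = card (A \<inter> {..<x})"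
proof -
  have "{y. y < x \<and> y mod n \<in> A} = A \<inter> {..<x}" using assms by auto
  then show ?thesis unfolding cnt_def by simp
qed

text \<open>The two disjuncts are the two roles: which token is in the rear, and hence which of
  \<open>A\<close> and \<open>B\<close> measures the progress. The term \<open>cnt n R k\<close> is
  the head start of the front token. The arbitrary \<open>t\<close> records that the walk never
  stops.\<close>

lemma two_token_walk:
  fixes A B R S :: "nat set" and n k h :: nat
  assumes AB: "\<And>x. cnt n A x + h + 1 \<le> cnt n B (x + k + 1)"
    and BA: "\<And>x. cnt n B x + h + 1 \<le> cnt n A (x + k + 1)"
    and RB: "R \<subseteq> B" and SA: "S \<subseteq> A"
    and S: "\<And>x. (x + k) mod n \<in> R \<Longrightarrow> card {y. x \<le> y \<and> y < x + (2*k+1) \<and> y mod n \<in> S} \<le> h"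
    and R: "\<And>x. (x + k) mod n \<in> S \<Longrightarrow> card {y. x \<le> y \<and> y < x + (2*k+1) \<and> y mod n \<in> R} \<le> h"
  shows "\<exists>x\<ge>t. cnt n S x + cnt n R (x + k) \<le> cnt n A x + cnt n R k
              \<or> cnt n R x + cnt n S (x + k) \<le> cnt n B x + cnt n R k"
proof (induction t)
  case 0
  show ?case by (rule exI[of _ 0]) (simp add: cnt_def)
next
  case (Suc t)
  \<comment> \<open>One move, with the sets generalised so that it serves both roles.\<close>
  have step: "\<exists>x\<ge>Suc x0. cnt n S x + cnt n R (x + k) \<le> cnt n A x + C
              \<or> cnt n R x + cnt n S (x + k) \<le> cnt n B x + C"
    if AB: "\<And>x. cnt n A x + h + 1 \<le> cnt n B (x + k + 1)"
    and S: "\<And>x. (x + k) mod n \<in> R \<Longrightarrow> card {y. x \<le> y \<and> y < x + (2*k+1) \<and> y mod n \<in> S} \<le> h"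
    and SA: "S \<subseteq> A" and x: "cnt n S x0 + cnt n R (x0 + k) \<le> cnt n A x0 + C"
    for A B R S :: "nat set" and x0 C
  proof (cases "(x0 + k) mod n \<in> R")
    case False
    then have "cnt n S (Suc x0) + cnt n R (Suc x0 + k) \<le> cnt n A (Suc x0) + C"
      using x SA by (auto simp: cnt_Suc)
    then show ?thesis by (intro exI[of _ "Suc x0"]) simp
  next
    case True
    \<comment> \<open>The front token passes the element of \<open>R\<close> by one step while the
      rear one passes the whole window: at most \<open>h + 1\<close> new elements together, which
      \<open>AB\<close> makes up for by comparing with \<open>B\<close> at the new rear
      position.\<close>
    have "cnt n S (x0 + (2*k+1)) \<le> cnt n S x0 + h"
      using S[OF True] cnt_add[of n S x0 "2*k+1"] by simp
    moreover have "cnt n R (x0 + k + 1) = cnt n R (x0 + k) + 1"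
      using True by (simp add: cnt_Suc)
    moreover have "cnt n S (x0 + k + 1 + k) = cnt n S (x0 + (2*k+1))" by (rule arg_cong[where f = "cnt n S"]) simp
    ultimately have "cnt n R (x0 + k + 1) + cnt n S (x0 + k + 1 + k) \<le> cnt n B (x0 + k + 1) + C"
      using AB[of x0] x by linarith
    then show ?thesis by (intro exI[of _ "x0 + k + 1"]) simp
  qed
  obtain x where "x \<ge> t" and x: "cnt n S x + cnt n R (x + k) \<le> cnt n A x + cnt n R k
              \<or> cnt n R x + cnt n S (x + k) \<le> cnt n B x + cnt n R k"
    using Suc.IH by blast
  moreover have "\<exists>x'\<ge>Suc x. cnt n S x' + cnt n R (x' + k) \<le> cnt n A x' + cnt n R k
              \<or> cnt n R x' + cnt n S (x' + k) \<le> cnt n B x' + cnt n R k"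
    using x
  proof
    assume "cnt n S x + cnt n R (x + k) \<le> cnt n A x + cnt n R k"
    then show ?thesis using step[OF AB S SA] by blast
  next
    assume "cnt n R x + cnt n S (x + k) \<le> cnt n B x + cnt n R k"
    then show ?thesis using step[OF BA R RB] by blast
  qed
  ultimately show ?case by (meson Suc_le_mono order_trans)
qed

text \<open>The walk bounds the counts of \<open>S\<close> and \<open>R\<close> together by that of
  \<open>A\<close> up to a constant. A surplus of one would grow by one with every turn, so
  \<open>card A + C + 1\<close> turns are too many; here \<open>card A\<close> allows for the
  incomplete last turn.\<close>

lemma card_add_le_of_no_edges:
  fixes A B R S :: "nat set" and n k h :: nat
  assumes n: "n > 0" and "A \<subseteq> {..<n}" "B \<subseteq> {..<n}" and card: "card A = card B"
    and AB: "\<And>x. cnt n A x + h + 1 \<le> cnt n B (x + k + 1)"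
    and BA: "\<And>x. cnt n B x + h + 1 \<le> cnt n A (x + k + 1)"
    and RB: "R \<subseteq> B" and SA: "S \<subseteq> A"
    and S: "\<And>x. (x + k) mod n \<in> R \<Longrightarrow> card {y. x \<le> y \<and> y < x + (2*k+1) \<and> y mod n \<in> S} \<le> h"
    and R: "\<And>x. (x + k) mod n \<in> S \<Longrightarrow> card {y. x \<le> y \<and> y < x + (2*k+1) \<and> y mod n \<in> R} \<le> h"
  shows "card S + card R \<le> card A"
proof (rule ccontr)
  assume neg: "\<not> card S + card R \<le> card A"
  define C where "C = cnt n R k"
  obtain x where x: "x \<ge> n * (card A + C + 1)"
    and walk: "cnt n S x + cnt n R (x + k) \<le> cnt n A x + C
              \<or> cnt n R x + cnt n S (x + k) \<le> cnt n B x + C"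
    using two_token_walk[OF AB BA RB SA S R] unfolding C_def by blast
  define q where "q = x div n"
  have xq: "x = x mod n + q * n" unfolding q_def by simp
  have q: "q \<ge> card A + C + 1"
    unfolding q_def using x n by (metis div_le_mono div_mult_self1_is_m mult.commute)
  have lower: "q * card T \<le> cnt n T x" if "T \<subseteq> {..<n}" for T
    using cnt_period_mult[OF that, of "x mod n" q] xq by simp
  have upper: "cnt n T x \<le> (q + 1) * card T" if "T \<subseteq> {..<n}" for T
  proof -
    have "cnt n T x \<le> cnt n T (0 + (q + 1) * n)"
      using n by (intro cnt_mono) (simp add: q_def dividend_less_div_times less_imp_le)
    also have "\<dots> = (q + 1) * card T" unfolding cnt_period_mult[OF that] by (simp add: cnt_def)
    finally show ?thesis .
  qed
  have "q * (card S + card R) \<le> (q + 1) * card A + C"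
  proof -
    have Rn: "R \<subseteq> {..<n}" "S \<subseteq> {..<n}" using assms by auto
    show ?thesis
      using walk
    proof
      assume "cnt n S x + cnt n R (x + k) \<le> cnt n A x + C"
      then show ?thesis
        using lower[OF Rn(1)] lower[OF Rn(2)] upper[OF assms(2)] cnt_mono[of x "x + k" n R]
        by (simp add: distrib_left)
    next
      assume "cnt n R x + cnt n S (x + k) \<le> cnt n B x + C"
      then show ?thesis
        using lower[OF Rn(1)] lower[OF Rn(2)] upper[OF assms(3)] cnt_mono[of x "x + k" n S] card
        by (simp add: distrib_left)
    qed
  qed
  moreover have "q * (card A + 1) \<le> q * (card S + card R)"
    using neg by (intro mult_le_mono2) simp
  ultimately show False using q by (simp add: algebra_simps)
qed

section \<open>Distance and windows on the cycle\<close>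

text \<open>Distance at most \<open>k\<close> on the cycle of length \<open>n\<close>; \<open>z\<close> is the signed displacement.\<close>

definition near :: "nat \<Rightarrow> nat \<Rightarrow> nat \<Rightarrow> nat \<Rightarrow> bool" where
  "near n k u v \<longleftrightarrow> (\<exists>z::int. \<bar>z\<bar> \<le> int k \<and> int n dvd int v - int u - z)"

lemma near_refl [simp]: "near n k u u"
  unfolding near_def by (intro exI[of _ 0]) simp

lemma near_sym: "near n k u v \<longleftrightarrow> near n k v u"
proof -
  have "near n k v u" if "near n k u v" for u v
  proof -
    obtain z where z: "\<bar>z\<bar> \<le> int k" "int n dvd int v - int u - z" using \<open>near n k u v\<close> near_def by blast
    have "int u - int v - (- z) = - (int v - int u - z)" by simp
    then have "int n dvd int u - int v - (- z)" using z(2) dvd_minus_iff by metis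
    then show ?thesis unfolding near_def using z(1) by (intro exI[of _ "- z"]) simp
  qed
  then show ?thesis by blast
qed

lemma near_trans:
  assumes "near n k u v" "near n l v w"
  shows "near n (k + l) u w"
proof -
  obtain z where z: "\<bar>z\<bar> \<le> int k" "int n dvd int v - int u - z" using assms(1) near_def by blast
  obtain z' where z': "\<bar>z'\<bar> \<le> int l" "int n dvd int w - int v - z'" using assms(2) near_def by blast
  have "int w - int u - (z + z') = (int v - int u - z) + (int w - int v - z')" by simp
  then have "int n dvd int w - int u - (z + z')" using z(2) z'(2) dvd_add by metis
  then show ?thesis unfolding near_def using z(1) z'(1) by (intro exI[of _ "z + z'"]) simp
qed

lemma near_mono: "near n k u v \<Longrightarrow> k \<le> l \<Longrightarrow> near n l u v"
  unfolding near_def by (meson of_nat_mono order_trans)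

lemma near_of_abs_diff: "\<bar>int v - int u\<bar> \<le> int k \<Longrightarrow> near n k u v"
  unfolding near_def by (intro exI[of _ "int v - int u"]) simp

lemma near_mod_right [simp]: "near n k u (v mod n) \<longleftrightarrow> near n k u v"
proof -
  have "int n dvd int (v mod n) - int u - z \<longleftrightarrow> int n dvd int v - int u - z" for z
  proof -
    have "int v - int u - z = (int (v mod n) - int u - z) + int n * int (v div n)"
      by (simp add: zmod_int zdiv_int)
    then show ?thesis by (metis dvd_add_left_iff dvd_triv_left)
  qed
  then show ?thesis unfolding near_def by simp
qed

lemma near_mod_left [simp]: "near n k (u mod n) v \<longleftrightarrow> near n k u v"
  using near_sym near_mod_right by metis

text \<open>The congruence leaves a multiple \<open>n * t\<close> with \<open>t\<close> in {-1, 0,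
  1}, so nearness splits into three linear cases. This is the origin of the factor 3 in the counts
  of blocks and of multiples near a vertex.\<close>

lemma near_cases:
  assumes "near n k u v" "u < n" "v < n" "k \<le> n"
  shows "\<bar>int v - int u\<bar> \<le> int k \<or> \<bar>int v - int u - int n\<bar> \<le> int k \<or> \<bar>int v - int u + int n\<bar> \<le> int k"
proof -
  obtain z where z: "\<bar>z\<bar> \<le> int k" "int n dvd int v - int u - z" using assms(1) near_def by blast
  then obtain t where t: "int v - int u - z = int n * t" by (elim dvdE)
  have "int u < int n" "int v < int n" "int k \<le> int n" using assms(2-4) by simp_all
  then have "int n * t < int n * 2" "int n * (-2) < int n * t" using t z(1) by linarith+
  then have "t < 2" "-2 < t" using assms(2) by (simp_all only: mult_less_cancel_left_pos of_nat_0_less_iff)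
  then have "t = -1 \<or> t = 0 \<or> t = 1" by auto
  then show ?thesis using t z(1) by auto
qed

text \<open>Two windows whose centres are at distance at most \<open>d\<close> lie in one interval
  of \<open>2 * k + 1 + d\<close> elements; \<open>lo\<close> is its left end relative to
  \<open>u\<close>.\<close>

lemma card_near_union_le:
  assumes "near n d u u'"
  shows "card {v. v < n \<and> (near n k u v \<or> near n k u' v)} \<le> 2 * k + 1 + d"
proof -
  obtain z0 where z0: "\<bar>z0\<bar> \<le> int d" "int n dvd int u' - int u - z0"
    using assms near_def by blast
  define lo where "lo = min 0 z0 - int k"
  have "{v. v < n \<and> (near n k u v \<or> near n k u' v)} \<subseteq> (\<lambda>z. nat ((int u + z) mod int n)) ` {lo..lo + 2 * int k + int d}"
  proof clarify
    fix v assume v: "v < n" "near n k u v \<or> near n k u' v"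
    have "\<exists>z\<in>{lo..lo + 2 * int k + int d}. int n dvd int v - int u - z" using v(2)
    proof
      assume "near n k u v"
      then obtain z where "\<bar>z\<bar> \<le> int k" "int n dvd int v - int u - z" using near_def by blast
      then show ?thesis using z0(1) unfolding lo_def by (intro bexI[of _ z]) auto
    next
      assume "near n k u' v"
      then obtain z where z: "\<bar>z\<bar> \<le> int k" "int n dvd int v - int u' - z" using near_def by blast
      have "int v - int u - (z0 + z) = (int u' - int u - z0) + (int v - int u' - z)" by simp
      then have "int n dvd int v - int u - (z0 + z)" using z(2) z0(2) dvd_add by metis
      then show ?thesis using z0(1) z(1) unfolding lo_def by (intro bexI[of _ "z0 + z"]) auto
    qed
    then obtain z where z: "z \<in> {lo..lo + 2 * int k + int d}" "int n dvd int v - int u - z" by blast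
    have "int v - int u - z = int v - (int u + z)" by simp
    then have "int v mod int n = (int u + z) mod int n" using z(2) mod_eq_dvd_iff by metis
    then have "v = nat ((int u + z) mod int n)" using v(1) by (metis mod_less nat_int zmod_int)
    then show "v \<in> (\<lambda>z. nat ((int u + z) mod int n)) ` {lo..lo + 2 * int k + int d}" using z(1) by blast
  qed
  then have "card {v. v < n \<and> (near n k u v \<or> near n k u' v)} \<le> card {lo..lo + 2 * int k + int d}"
    by (meson finite_atLeastAtMost_int surj_card_le)
  then show ?thesis by simp
qed

lemma card_near_le: "n > 0 \<Longrightarrow> card {v. v < n \<and> near n k u v} \<le> 2 * k + 1"
  using card_near_union_le[of n 0 u u k] by simp

lemma card_near_interval_le:
  assumes "n > 0" "\<And>u. u \<in> Z \<Longrightarrow> a \<le> u \<and> u \<le> a + d"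
  shows "card {v. v < n \<and> (\<exists>u\<in>Z. near n k u v)} \<le> 2 * k + 1 + d"
proof -
  have "{v. v < n \<and> (\<exists>u\<in>Z. near n k u v)}
      \<subseteq> (\<lambda>z. nat ((int a + z) mod int n)) ` {- int k..int k + int d}"
  proof clarify
    fix v u assume v: "v < n" "u \<in> Z" "near n k u v"
    then obtain z where z: "\<bar>z\<bar> \<le> int k" "int n dvd int v - int u - z" using near_def by blast
    define z' where "z' = z + (int u - int a)"
    have "int v - int u - z = int v - (int a + z')" unfolding z'_def by simp
    then have "int v mod int n = (int a + z') mod int n" using z(2) mod_eq_dvd_iff by metis
    then have "v = nat ((int a + z') mod int n)" using v(1) by (metis mod_less nat_int zmod_int)
    moreover have "z' \<in> {- int k..int k + int d}" using z(1) assms(2)[OF v(2)] unfolding z'_def by auto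
    ultimately show "v \<in> (\<lambda>z. nat ((int a + z) mod int n)) ` {- int k..int k + int d}" by blast
  qed
  then have "card {v. v < n \<and> (\<exists>u\<in>Z. near n k u v)} \<le> card {- int k..int k + int d}"
    by (meson finite_atLeastAtMost_int surj_card_le)
  then show ?thesis by simp
qed

text \<open>A window not longer than the cycle does not overlap itself, so reduction modulo
  \<open>n\<close> is injective on it.\<close>

lemma card_window_le:
  assumes "2 * k + 1 \<le> n"
  shows "card {y. x \<le> y \<and> y < x + (2*k+1) \<and> y mod n \<in> S} \<le> card {v \<in> S. v < n \<and> near n k ((x + k) mod n) v}"
proof (rule card_inj_on_le)
  show "inj_on (\<lambda>y. y mod n) {y. x \<le> y \<and> y < x + (2*k+1) \<and> y mod n \<in> S}"
    using assms by (intro inj_on_subset[OF inj_on_mod_interval[of n x]]) auto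
  show "(\<lambda>y. y mod n) ` {y. x \<le> y \<and> y < x + (2*k+1) \<and> y mod n \<in> S} \<subseteq> {v \<in> S. v < n \<and> near n k ((x + k) mod n) v}"
  proof (intro image_subsetI)
    fix y assume y: "y \<in> {y. x \<le> y \<and> y < x + (2*k+1) \<and> y mod n \<in> S}"
    then have "near n k (x + k) y" by (intro near_of_abs_diff) auto
    then show "y mod n \<in> {v \<in> S. v < n \<and> near n k ((x + k) mod n) v}" using y assms by simp
  qed
qed simp

text \<open>With \<open>R\<close> the part of \<open>B\<close> that \<open>S\<close> does not reach,
  all members of \<open>S\<close> in the window of a member of \<open>R\<close> are its
  nonneighbours, so \<open>h\<close> bounds their number; the same holds with the roles
  exchanged.\<close>

theorem layer_matching:
  fixes adj :: "nat \<Rightarrow> nat \<Rightarrow> bool"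
  assumes n: "2 * k + 1 \<le> n" and A: "A \<subseteq> {..<n}" and B: "B \<subseteq> {..<n}" and card: "card A = card B"
    and AB: "\<And>x. cnt n A x + h + 1 \<le> cnt n B (x + k + 1)"
    and BA: "\<And>x. cnt n B x + h + 1 \<le> cnt n A (x + k + 1)"
    and nA: "\<And>v. v \<in> B \<Longrightarrow> card {u \<in> A. near n k v u \<and> \<not> adj u v} \<le> h"
    and nB: "\<And>u. u \<in> A \<Longrightarrow> card {v \<in> B. near n k u v \<and> \<not> adj u v} \<le> h"
  shows "\<exists>f. bij_betw f A B \<and> (\<forall>u\<in>A. adj u (f u))"
proof -
  have finA: "finite A" and finB: "finite B" using A B finite_subset by blast+
  have "card S \<le> card (\<Union>u\<in>S. {v \<in> B. adj u v})" if S: "S \<subseteq> A" for S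
  proof -
    define R where "R = B - (\<Union>u\<in>S. {v \<in> B. adj u v})"
    have "card S + card R \<le> card A"
    proof (rule card_add_le_of_no_edges[OF _ A B card AB BA])
      show "R \<subseteq> B" "S \<subseteq> A" "n > 0" using S n unfolding R_def by auto
    next
      fix x assume x: "(x + k) mod n \<in> R"
      have "card {y. x \<le> y \<and> y < x + (2*k+1) \<and> y mod n \<in> S}
          \<le> card {v \<in> S. v < n \<and> near n k ((x + k) mod n) v}" by (rule card_window_le[OF n])
      also have "\<dots> \<le> card {u \<in> A. near n k ((x + k) mod n) u \<and> \<not> adj u ((x + k) mod n)}"
        using x S finA unfolding R_def by (intro card_mono) auto
      also have "\<dots> \<le> h" using x by (intro nA) (auto simp: R_def)
      finally show "card {y. x \<le> y \<and> y < x + (2*k+1) \<and> y mod n \<in> S} \<le> h" .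
    next
      fix x assume x: "(x + k) mod n \<in> S"
      have "card {y. x \<le> y \<and> y < x + (2*k+1) \<and> y mod n \<in> R}
          \<le> card {v \<in> R. v < n \<and> near n k ((x + k) mod n) v}" by (rule card_window_le[OF n])
      also have "\<dots> \<le> card {v \<in> B. near n k ((x + k) mod n) v \<and> \<not> adj ((x + k) mod n) v}"
        using x S finB unfolding R_def by (intro card_mono) auto
      also have "\<dots> \<le> h" using x S by (intro nB) auto
      finally show "card {y. x \<le> y \<and> y < x + (2*k+1) \<and> y mod n \<in> R} \<le> h" .
    qed
    moreover have "card R = card B - card (\<Union>u\<in>S. {v \<in> B. adj u v})"
      unfolding R_def using finB by (intro card_Diff_subset finite_subset[OF _ finB]) auto
    ultimately show ?thesis using card by linarith
  qed
  then obtain f where f: "inj_on f A" "\<forall>a\<in>A. f a \<in> {v \<in> B. adj a v}"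
    using hall_matching[of A "\<lambda>u. {v \<in> B. adj u v}"] finA finB by auto
  have "f ` A = B"
    using f card finB by (intro card_subset_eq) (auto simp: card_image)
  then show ?thesis using f unfolding bij_betw_def by blast
qed

text \<open>In the prefix up to \<open>r\<close> the set \<open>A\<close> can be ahead by
  \<open>e\<close>. The set \<open>B\<close> can be behind by \<open>e\<close> up to position
  \<open>n\<close> and by another \<open>e\<close> after it, if the interval wraps around. Together
  this is the term \<open>3 * e\<close>.\<close>

lemma cnt_add_le_of_equidistributed:
  fixes e D :: real
  assumes n: "2 * k + 1 \<le> n" and A: "A \<subseteq> {..<n}" and B: "B \<subseteq> {..<n}" and card: "card A = card B"
    and D: "D > 0"
    and eA: "\<And>x. x \<le> n \<Longrightarrow> \<bar>D * card (A \<inter> {..<x}) - x\<bar> \<le> e"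
    and eB: "\<And>x. x \<le> n \<Longrightarrow> \<bar>D * card (B \<inter> {..<x}) - x\<bar> \<le> e"
    and h: "D * (real h + 1) + 3 * e \<le> k + 1"
  shows "cnt n A x + h + 1 \<le> cnt n B (x + k + 1)"
proof -
  define q r where "q = x div n" and "r = x mod n"
  have x: "x = r + q * n" and r: "r < n" using n unfolding q_def r_def by auto
  have cA: "cnt n A x = cnt n A r + q * card A" unfolding x by (rule cnt_period_mult[OF A])
  have "x + k + 1 = (r + k + 1) + q * n" using x by simp
  then have cB: "cnt n B (x + k + 1) = cnt n B (r + k + 1) + q * card A"
    using cnt_period_mult[OF B, of "r + k + 1" q] card by metis
  have e: "0 \<le> e" using eA[of 0] by simp
  have "D * cnt n A r \<le> r + e" using eA[of r] r cnt_upto[OF A, of r] by simp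
  moreover have "D * cnt n B (r + k + 1) \<ge> r + k + 1 - 2 * e"
  proof (cases "r + k + 1 \<le> n")
    case True
    then show ?thesis using eB[of "r + k + 1"] cnt_upto[OF B True] e by simp
  next
    case False
    define y where "y = r + k + 1 - n"
    have y: "r + k + 1 = y + n" "y \<le> n" using False n r unfolding y_def by auto
    have "cnt n B (r + k + 1) = card (B \<inter> {..<y}) + card B"
      unfolding y(1) using cnt_period[OF B, of y] cnt_upto[OF B y(2)] by simp
    moreover have "D * card (B \<inter> {..<y}) \<ge> y - e" using eB[of y] y by simp
    moreover have "D * card B \<ge> n - e" using eB[of n] B by (simp add: Int_absorb2)
    ultimately have "D * cnt n B (r + k + 1) \<ge> (y - e) + (n - e)" by (simp add: distrib_left)
    then show ?thesis using y by simp
  qed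
  ultimately have "D * (cnt n A r + h + 1) \<le> D * cnt n B (r + k + 1)"
    using h by (simp add: distrib_left)
  then have "real (cnt n A r + h + 1) \<le> real (cnt n B (r + k + 1))" using D by simp
  then show ?thesis unfolding cA cB by linarith
qed

section \<open>Evenly spread transversals\<close>

lemma bij_betw_shift_mod: "M > 0 \<Longrightarrow> bij_betw (\<lambda>h. (i + h) mod M) {..<M} {..<(M::nat)}"
proof -
  assume M: "M > 0"
  have "inj_on ((\<lambda>y. y mod M) \<circ> (\<lambda>h. i + h)) {..<M}"
    by (rule comp_inj_on) (auto intro!: inj_on_subset[OF inj_on_mod_interval[of M i]])
  then have inj: "inj_on (\<lambda>h. (i + h) mod M) {..<M}" by (simp add: comp_def)
  moreover have "(\<lambda>h. (i + h) mod M) ` {..<M} = {..<M}"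
    using inj M by (intro card_subset_eq) (auto simp: card_image)
  ultimately show ?thesis unfolding bij_betw_def by blast
qed

lemma sum_shift_mod:
  fixes g :: "nat \<Rightarrow> 'a::comm_monoid_add"
  assumes "M > 0"
  shows "(\<Sum>h<M. g ((i + h) mod M)) = (\<Sum>h<M. g h)"
  by (rule sum.reindex_bij_betw[OF bij_betw_shift_mod[OF assms]])

text \<open>Derandomised Chernoff bound: for a uniformly random shift of a group, the factor contributed
  by the group to each summand has mean at most \<open>(1 + \<delta> \<tau> / M) exp (- \<delta> \<tau> / M) \<le> 1\<close>.\<close>

lemma cyclic_shifts_potential:
  fixes G :: "nat \<Rightarrow> nat \<Rightarrow> 'a" and T :: "'c \<Rightarrow> 'a set" and \<delta> :: real
  assumes C: "finite C" and M: "M > 0" and \<delta>: "\<delta> \<ge> 0"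
  shows "\<exists>s. (\<Sum>c\<in>C. \<Sum>i<M. (1 + \<delta>) ^ card {j. j < L \<and> G j ((i + s j) mod M) \<in> T c}
      * exp (- \<delta> * (\<Sum>j<L. real (card {i. i < M \<and> G j i \<in> T c})) / M)) \<le> card C * M"
proof (induction L)
  case 0
  show ?case by simp
next
  case (Suc L)
  let ?\<tau> = "\<lambda>c j. real (card {i. i < M \<and> G j i \<in> T c})"
  obtain s where s: "(\<Sum>c\<in>C. \<Sum>i<M. (1 + \<delta>) ^ card {j. j < L \<and> G j ((i + s j) mod M) \<in> T c}
      * exp (- \<delta> * (\<Sum>j<L. ?\<tau> c j) / M)) \<le> card C * M" using Suc.IH by blast
  define w where "w c i = (1 + \<delta>) ^ card {j. j < L \<and> G j ((i + s j) mod M) \<in> T c}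
      * exp (- \<delta> * (\<Sum>j<L. ?\<tau> c j) / M)" for c i
  define \<xi> where "\<xi> c x = (if G L x \<in> T c then 1 + \<delta> else 1)" for c x
  have w0: "w c i \<ge> 0" for c i using \<delta> unfolding w_def by simp
  have step: "(1 + \<delta>) ^ card {j. j < Suc L \<and> G j ((i + (s(L := h)) j) mod M) \<in> T c}
      * exp (- \<delta> * (\<Sum>j<Suc L. ?\<tau> c j) / M)
      = w c i * (\<xi> c ((i + h) mod M) * exp (- \<delta> * ?\<tau> c L / M))" for c i h
  proof -
    have "{j. j < Suc L \<and> G j ((i + (s(L := h)) j) mod M) \<in> T c}
        = {j. j < L \<and> G j ((i + s j) mod M) \<in> T c} \<union> (if G L ((i + h) mod M) \<in> T c then {L} else {})"
      by (auto simp: less_Suc_eq)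
    then have "(1 + \<delta>) ^ card {j. j < Suc L \<and> G j ((i + (s(L := h)) j) mod M) \<in> T c}
        = (1 + \<delta>) ^ card {j. j < L \<and> G j ((i + s j) mod M) \<in> T c} * \<xi> c ((i + h) mod M)"
      unfolding \<xi>_def by simp
    moreover have "exp (- \<delta> * (\<Sum>j<Suc L. ?\<tau> c j) / M)
        = exp (- \<delta> * (\<Sum>j<L. ?\<tau> c j) / M) * exp (- \<delta> * ?\<tau> c L / M)"
      by (simp only: exp_add[symmetric] sum.lessThan_Suc distrib_left add_divide_distrib)
    ultimately show ?thesis unfolding w_def by simp
  qed
  have mean: "(\<Sum>h<M. \<xi> c ((i + h) mod M) * exp (- \<delta> * ?\<tau> c L / M)) \<le> M" for c i
  proof -
    have "(\<Sum>h<M. \<xi> c ((i + h) mod M)) = (\<Sum>h<M. \<xi> c h)" by (rule sum_shift_mod[OF M])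
    also have "\<dots> = (\<Sum>h<M. 1 + \<delta> * (if G L h \<in> T c then 1 else 0))"
      unfolding \<xi>_def by (intro sum.cong) auto
    also have "\<dots> = M + \<delta> * (\<Sum>h<M. if G L h \<in> T c then 1 else 0)"
      by (simp add: sum.distrib sum_distrib_left)
    also have "(\<Sum>h<M. if G L h \<in> T c then 1 else (0::real)) = ?\<tau> c L"
      by (simp add: sum.If_cases Int_def lessThan_def conj_commute)
    finally have sum: "(\<Sum>h<M. \<xi> c ((i + h) mod M)) = M * (1 + \<delta> * ?\<tau> c L / M)"
      using M by (simp add: distrib_left)
    have "1 + \<delta> * ?\<tau> c L / M \<le> exp (\<delta> * ?\<tau> c L / M)" by (rule exp_ge_add_one_self)
    then have "(1 + \<delta> * ?\<tau> c L / M) * exp (- \<delta> * ?\<tau> c L / M) \<le> exp (\<delta> * ?\<tau> c L / M) * exp (- \<delta> * ?\<tau> c L / M)"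
      by (intro mult_right_mono) auto
    also have "\<dots> = 1" by (simp add: exp_add[symmetric])
    finally have "real M * ((1 + \<delta> * ?\<tau> c L / M) * exp (- \<delta> * ?\<tau> c L / M)) \<le> real M * 1"
      by (intro mult_left_mono) auto
    then show ?thesis unfolding sum_distrib_right[symmetric] sum by (simp add: mult.assoc)
  qed
  \<comment> \<open>Method of conditional expectations: averaged over the shift of group
    \<open>L\<close> the potential does not increase, so some shift does not increase it.\<close>
  have "\<exists>h<M. (\<Sum>c\<in>C. \<Sum>i<M. w c i * (\<xi> c ((i + h) mod M) * exp (- \<delta> * ?\<tau> c L / M)))
      \<le> (\<Sum>c\<in>C. \<Sum>i<M. w c i)"
  proof (rule ccontr)
    assume "\<not> ?thesis"
    then have lt: "(\<Sum>c\<in>C. \<Sum>i<M. w c i)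
        < (\<Sum>c\<in>C. \<Sum>i<M. w c i * (\<xi> c ((i + h) mod M) * exp (- \<delta> * ?\<tau> c L / M)))" if "h < M" for h
      using that not_le by blast
    have "(\<Sum>h<M. (\<Sum>c\<in>C. \<Sum>i<M. w c i))
        < (\<Sum>h<M. \<Sum>c\<in>C. \<Sum>i<M. w c i * (\<xi> c ((i + h) mod M) * exp (- \<delta> * ?\<tau> c L / M)))"
    proof (rule sum_strict_mono)
      show "{..<M} \<noteq> {}" using M by auto
    qed (use lt in simp_all)
    also have "\<dots> = (\<Sum>c\<in>C. \<Sum>h<M. \<Sum>i<M. w c i * (\<xi> c ((i + h) mod M) * exp (- \<delta> * ?\<tau> c L / M)))"
      by (rule sum.swap)
    also have "\<dots> = (\<Sum>c\<in>C. \<Sum>i<M. \<Sum>h<M. w c i * (\<xi> c ((i + h) mod M) * exp (- \<delta> * ?\<tau> c L / M)))"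
      by (intro sum.cong refl sum.swap)
    also have "\<dots> = (\<Sum>c\<in>C. \<Sum>i<M. w c i * (\<Sum>h<M. \<xi> c ((i + h) mod M) * exp (- \<delta> * ?\<tau> c L / M)))"
      by (simp only: sum_distrib_left)
    also have "\<dots> \<le> (\<Sum>c\<in>C. \<Sum>i<M. w c i * M)"
      using mean w0 by (intro sum_mono mult_left_mono) auto
    also have "\<dots> = (\<Sum>h<M. (\<Sum>c\<in>C. \<Sum>i<M. w c i))"
      by (simp add: sum_distrib_left[symmetric] sum_distrib_right[symmetric])
    finally show False by simp
  qed
  then obtain h where h: "(\<Sum>c\<in>C. \<Sum>i<M. w c i * (\<xi> c ((i + h) mod M) * exp (- \<delta> * ?\<tau> c L / M)))
      \<le> (\<Sum>c\<in>C. \<Sum>i<M. w c i)" by blast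
  have "(\<Sum>c\<in>C. \<Sum>i<M. w c i) \<le> card C * M" using s unfolding w_def .
  then show ?case using h unfolding step[symmetric] by (intro exI[of _ "s(L := h)"]) linarith
qed

text \<open>Each summand of the potential is at most \<open>card C * M\<close>, which is a union
  bound over all sets and all \<open>M\<close> transversals. After taking logarithms,
  \<open>ln (1 + \<delta>) \<ge> \<delta> - \<delta>\<^sup>2\<close> produces the factor
  \<open>1 - \<delta>\<close>, and division by \<delta> the error term.\<close>

lemma cyclic_shifts:
  fixes G :: "nat \<Rightarrow> nat \<Rightarrow> 'a" and T :: "'c \<Rightarrow> 'a set" and \<delta> :: real
  assumes C: "finite C" and M: "M > 0" and \<delta>: "0 < \<delta>" "\<delta> \<le> 1"
  shows "\<exists>s. \<forall>c\<in>C. \<forall>i<M. (1 - \<delta>) * card {j. j < L \<and> G j ((i + s j) mod M) \<in> T c}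
      \<le> (\<Sum>j<L. real (card {i. i < M \<and> G j i \<in> T c})) / M + ln (card C * M) / \<delta>"
proof -
  let ?\<tau> = "\<lambda>c. \<Sum>j<L. real (card {i. i < M \<and> G j i \<in> T c})"
  obtain s where s: "(\<Sum>c\<in>C. \<Sum>i<M. (1 + \<delta>) ^ card {j. j < L \<and> G j ((i + s j) mod M) \<in> T c}
      * exp (- \<delta> * ?\<tau> c / M)) \<le> card C * M"
    using cyclic_shifts_potential[OF C M, of \<delta> L G T] \<delta> by auto
  show ?thesis
  proof (intro exI[of _ s] ballI allI impI)
    fix c i assume c: "c \<in> C" and i: "i < M"
    define X where "X = card {j. j < L \<and> G j ((i + s j) mod M) \<in> T c}"
    have CM: "real (card C * M) > 0" using c C M by (metis card_gt_0_iff empty_iff mult_pos_pos of_nat_0_less_iff)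
    have "(1 + \<delta>) ^ X * exp (- \<delta> * ?\<tau> c / M)
        \<le> (\<Sum>i<M. (1 + \<delta>) ^ card {j. j < L \<and> G j ((i + s j) mod M) \<in> T c} * exp (- \<delta> * ?\<tau> c / M))"
      unfolding X_def using i \<delta> by (intro member_le_sum) auto
    also have "\<dots> \<le> (\<Sum>c\<in>C. \<Sum>i<M. (1 + \<delta>) ^ card {j. j < L \<and> G j ((i + s j) mod M) \<in> T c}
      * exp (- \<delta> * ?\<tau> c / M))"
      using c C \<delta> by (intro member_le_sum[of c C "\<lambda>c. \<Sum>i<M. (1 + \<delta>) ^ card {j. j < L \<and> G j ((i + s j) mod M) \<in> T c}
      * exp (- \<delta> * ?\<tau> c / M)"] sum_nonneg) auto
    also have "\<dots> \<le> card C * M" by (rule s)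
    finally have "ln ((1 + \<delta>) ^ X * exp (- \<delta> * ?\<tau> c / M)) \<le> ln (card C * M)"
      using \<delta> CM by (subst ln_le_cancel_iff) auto
    then have "X * ln (1 + \<delta>) - \<delta> * ?\<tau> c / M \<le> ln (card C * M)"
      using \<delta> by (simp add: ln_mult ln_realpow)
    moreover have "X * (\<delta> - \<delta>\<^sup>2) \<le> X * ln (1 + \<delta>)"
      using ln_one_plus_pos_lower_bound[of \<delta>] \<delta> by (intro mult_left_mono) auto
    ultimately have "X * (\<delta> - \<delta>\<^sup>2) \<le> \<delta> * ?\<tau> c / M + ln (card C * M)" by linarith
    then have div: "X * (\<delta> - \<delta>\<^sup>2) / \<delta> \<le> (\<delta> * ?\<tau> c / M + ln (card C * M)) / \<delta>"
      using \<delta> by (intro divide_right_mono) auto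
    then show "(1 - \<delta>) * X \<le> ?\<tau> c / M + ln (card C * M) / \<delta>"
    proof -
      have "X * (\<delta> - \<delta>\<^sup>2) / \<delta> = (1 - \<delta>) * X"
        using \<delta> by (simp add: power2_eq_square field_simps)
      moreover have "(\<delta> * ?\<tau> c / M + ln (card C * M)) / \<delta> = ?\<tau> c / M + ln (card C * M) / \<delta>"
        using \<delta> by (simp add: add_divide_distrib)
      ultimately show ?thesis using div by simp
    qed
  qed
qed

lemma strict_mono_diff_le:
  fixes e :: "nat \<Rightarrow> nat"
  assumes "strict_mono e" "m \<le> m'"
  shows "m' - m \<le> e m' - e m"
proof -
  have "e m + d \<le> e (m + d)" for d
  proof (induction d)
    case (Suc d)
    have "e (m + d) < e (m + Suc d)" using assms(1) by (simp add: strict_mono_def)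
    then show ?case using Suc by simp
  qed simp
  from this[of "m' - m"] show ?thesis using assms(2) by simp
qed

text \<open>Indices differ by no more than the values of a strictly increasing sequence, so the
  indices in question span less than one block length and touch at most two blocks.\<close>

lemma card_blocks_meeting_interval_le:
  fixes e :: "nat \<Rightarrow> nat"
  assumes e: "strict_mono e" and K: "d < K"
  shows "finite {m. a \<le> int (e m) \<and> int (e m) \<le> a + int d}"
    and "card ((\<lambda>m. m div K) ` {m. a \<le> int (e m) \<and> int (e m) \<le> a + int d}) \<le> 2"
proof -
  let ?Q = "{m. a \<le> int (e m) \<and> int (e m) \<le> a + int d}"
  have "m \<le> nat (a + int d)" if "m \<in> ?Q" for m
  proof -
    have "int m \<le> a + int d" using that strict_mono_imp_increasing[OF e, of m] by auto
    then show ?thesis by linarith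
  qed
  then show fin: "finite ?Q" by (meson finite_nat_set_iff_bounded_le)
  show "card ((\<lambda>m. m div K) ` ?Q) \<le> 2"
  proof (cases "?Q = {}")
    case False
    define m0 where "m0 = Min ?Q"
    have m0: "m0 \<in> ?Q" "\<And>m. m \<in> ?Q \<Longrightarrow> m0 \<le> m"
      unfolding m0_def by (rule Min_in[OF fin False], rule Min_le[OF fin])
    have "m div K \<in> {m0 div K, m0 div K + 1}" if m: "m \<in> ?Q" for m
    proof -
      have "m - m0 \<le> e m - e m0" using strict_mono_diff_le[OF e] m0 m by blast
      also have "\<dots> \<le> d" using m m0(1) by auto
      finally have "m \<le> m0 + K" using K by simp
      then have "m div K \<le> (m0 + K) div K" by (rule div_le_mono)
      moreover have "m0 div K \<le> m div K" using m0(2)[OF m] by (rule div_le_mono)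
      ultimately show ?thesis using K by auto
    qed
    then have "(\<lambda>m. m div K) ` ?Q \<subseteq> {m0 div K, m0 div K + 1}" by blast
    then have "card ((\<lambda>m. m div K) ` ?Q) \<le> card {m0 div K, m0 div K + 1}" by (intro card_mono) auto
    then show ?thesis by simp
  next
    case True
    then show ?thesis by (simp only: image_empty card.empty)
  qed
qed

text \<open>Shifts are chosen independently in consecutive blocks of \<open>k\<close> groups. Each \<open>T c\<close> meets at most six
  blocks, and each block meets few of the sets \<open>T c\<close>, so the error term does not depend on \<open>n\<close>.\<close>

theorem local_transversals:
  fixes e :: "nat \<Rightarrow> nat" and T :: "nat \<Rightarrow> nat set" and \<delta> :: real
  assumes e: "strict_mono e" and n: "2 * k + 1 \<le> n" and k: "k > 0" and M: "M \<ge> 3"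
    and \<delta>: "0 < \<delta>" "\<delta> \<le> 1"
    and T: "\<And>c. c < n \<Longrightarrow> T c \<subseteq> {v. v < n \<and> near n k c v}"
  shows "\<exists>s. \<forall>c<n. \<forall>i<M. (1 - \<delta>) * card {j. e (j * M + (i + s j) mod M) \<in> T c}
      \<le> card (T c) / M + 6 * (ln (real (k * M * (2 * k + 1) * M)) / \<delta>)"
proof -
  \<comment> \<open>A block holds \<open>k\<close> groups of \<open>M\<close> indices;
    \<open>M \<ge> 3\<close> makes it longer than the span \<open>2 * k\<close> of a window.\<close>
  define K where "K = k * M"
  have K: "2 * k < K" "K > 0" "M > 0"
    using k M unfolding K_def by (auto simp: mult.commute intro: order.strict_trans2[OF _ mult_le_mono1[OF M]])
  define C where "C b = {c. c < n \<and> (\<exists>m. m div K = b \<and> e m \<in> T c)}" for b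
  have finC: "finite (C b)" for b unfolding C_def by simp
  \<comment> \<open>Each of the \<open>K\<close> values of a block lies in the windows of at most
    \<open>2 * k + 1\<close> centres. This count stands where a global union bound would have
    \<open>n\<close>.\<close>
  have cardC: "card (C b) \<le> k * M * (2 * k + 1)" for b
  proof -
    have "C b \<subseteq> (\<Union>m\<in>{b * K..<b * K + K}. {c. c < n \<and> near n k (e m) c})"
    proof
      fix c assume "c \<in> C b"
      then obtain m where m: "c < n" "m div K = b" "e m \<in> T c" unfolding C_def by blast
      have "b * K \<le> m" "m < b * K + K"
        using m(2) K(2) by (metis div_times_less_eq_dividend, metis add.commute dividend_less_times_div mult.commute)
      moreover have "near n k (e m) c" using T[OF m(1)] m(3) near_sym by blast
      ultimately show "c \<in> (\<Union>m\<in>{b * K..<b * K + K}. {c. c < n \<and> near n k (e m) c})" using m(1) by auto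
    qed
    then have "card (C b) \<le> card (\<Union>m\<in>{b * K..<b * K + K}. {c. c < n \<and> near n k (e m) c})"
      by (intro card_mono) auto
    also have "\<dots> \<le> (\<Sum>m\<in>{b * K..<b * K + K}. card {c. c < n \<and> near n k (e m) c})"
      by (rule card_UN_le) simp
    also have "\<dots> \<le> (\<Sum>m\<in>{b * K..<b * K + K}. 2 * k + 1)"
      using n by (intro sum_mono card_near_le) simp
    finally show ?thesis by (simp add: K_def)
  qed
  define G where "G b j i = e ((b * k + j) * M + i)" for b j i
  have "\<forall>b. \<exists>s. \<forall>c\<in>C b. \<forall>i<M. (1 - \<delta>) * card {j. j < k \<and> G b j ((i + s j) mod M) \<in> T c}
      \<le> (\<Sum>j<k. real (card {i. i < M \<and> G b j i \<in> T c})) / M + ln (card (C b) * M) / \<delta>"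
    by (intro allI cyclic_shifts[OF finC K(3) \<delta>])
  from choice[OF this] obtain S where S: "\<forall>b. \<forall>c\<in>C b. \<forall>i<M.
      (1 - \<delta>) * card {j. j < k \<and> G b j ((i + S b j) mod M) \<in> T c}
      \<le> (\<Sum>j<k. real (card {i. i < M \<and> G b j i \<in> T c})) / M + ln (card (C b) * M) / \<delta>" ..
  define \<kappa> where "\<kappa> = ln (real (k * M * (2 * k + 1) * M)) / \<delta>"
  define s where "s j = S (j div k) (j mod k)" for j
  show ?thesis
  proof (intro exI[of _ s] allI impI)
    fix c i assume c: "c < n" and i: "i < M"
    define J where "J = {j. e (j * M + (i + s j) mod M) \<in> T c}"
    define Q where "Q = {m. e m \<in> T c}"
    define B where "B = (\<lambda>m. m div K) ` Q"
    let ?I = "\<lambda>a. {m. a \<le> int (e m) \<and> int (e m) \<le> a + int (2 * k)}"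
    \<comment> \<open>Three unwindings of the window of \<open>c\<close>, each touching at most two
      blocks, make six blocks.\<close>
    have "Q \<subseteq> ?I (int c - int k) \<union> ?I (int c + int n - int k) \<union> ?I (int c - int n - int k)"
    proof
      fix m assume "m \<in> Q"
      then have "e m < n" "near n k c (e m)" using T[OF c] unfolding Q_def by auto
      then show "m \<in> ?I (int c - int k) \<union> ?I (int c + int n - int k) \<union> ?I (int c - int n - int k)"
        using near_cases[of n k c "e m"] c n by auto
    qed
    note QI = this
    have finQ: "finite Q"
      by (rule finite_subset[OF QI]) (intro finite_UnI card_blocks_meeting_interval_le(1)[OF e K(1)])
    have finT: "finite (T c)" using T[OF c] by (rule finite_subset) simp
    have finB: "finite B" unfolding B_def using finQ by simp
    have "card B \<le> card ((\<lambda>m. m div K) ` (?I (int c - int k) \<union> ?I (int c + int n - int k) \<union> ?I (int c - int n - int k)))"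
      unfolding B_def using QI by (intro card_mono image_mono finite_imageI finite_UnI card_blocks_meeting_interval_le(1)[OF e K(1)])
    also have "\<dots> \<le> card ((\<lambda>m. m div K) ` ?I (int c - int k)) + card ((\<lambda>m. m div K) ` ?I (int c + int n - int k))
        + card ((\<lambda>m. m div K) ` ?I (int c - int n - int k))"
      unfolding image_Un by (meson add_le_mono1 card_Un_le order_trans)
    also have "\<dots> \<le> 2 + 2 + 2"
      by (intro add_mono card_blocks_meeting_interval_le(2)[OF e K(1)])
    finally have cardB: "card B \<le> 6" by simp
    have inJ: "j div k \<in> B" if "j \<in> J" for j
    proof -
      have "j * M + (i + s j) mod M \<in> Q" using that unfolding J_def Q_def by simp
      then have "(j * M + (i + s j) mod M) div K \<in> B" unfolding B_def by blast
      moreover have "(j * M + (i + s j) mod M) div (M * k) = j div k"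
        using K(3) by (simp add: div_mult2_eq)
      ultimately show ?thesis unfolding K_def by (simp add: mult.commute)
    qed
    have finJb: "finite {j. j div k = b}" for b
      by (rule finite_subset[of _ "{..<(b + 1) * k}"]) (use k in \<open>auto simp: dividend_less_div_times\<close>)
    have cardJb: "card {j. j div k = b \<and> j \<in> J} = card {j. j < k \<and> G b j ((i + S b j) mod M) \<in> T c}" for b
    proof -
      have "{j. j div k = b \<and> j \<in> J} = (\<lambda>j. b * k + j) ` {j. j < k \<and> G b j ((i + S b j) mod M) \<in> T c}"
      proof (intro equalityI subsetI)
        fix j assume "j \<in> {j. j div k = b \<and> j \<in> J}"
        then show "j \<in> (\<lambda>j. b * k + j) ` {j. j < k \<and> G b j ((i + S b j) mod M) \<in> T c}"
          using k by (intro image_eqI[of _ _ "j mod k"]) (auto simp: J_def G_def s_def)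
      qed (auto simp: J_def G_def s_def)
      then show ?thesis by (simp add: card_image)
    qed
    have Qb: "(\<Sum>j<k. card {i. i < M \<and> G b j i \<in> T c}) \<le> card {m \<in> Q. m div K = b}" for b
    proof -
      have "(\<Sum>j<k. card {i. i < M \<and> G b j i \<in> T c}) = card (SIGMA j:{..<k}. {i. i < M \<and> G b j i \<in> T c})"
        by simp
      also have "\<dots> \<le> card {m \<in> Q. m div K = b}"
      proof (rule card_inj_on_le)
        show "inj_on (\<lambda>(j, i). (b * k + j) * M + i) (SIGMA j:{..<k}. {i. i < M \<and> G b j i \<in> T c})"
        proof (rule inj_onI, clarify)
          fix j i j' i' assume *: "i < M" "i' < M" "(b * k + j) * M + i = (b * k + j') * M + i'"
          have "((b * k + j) * M + i) div M = b * k + j" "((b * k + j') * M + i') div M = b * k + j'"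
            using *(1,2) K(3) by simp_all
          then have "j = j'" using *(3) by (metis add_left_cancel)
          then show "j = j' \<and> i = i'" using *(3) by simp
        qed
        show "(\<lambda>(j, i). (b * k + j) * M + i) ` (SIGMA j:{..<k}. {i. i < M \<and> G b j i \<in> T c}) \<subseteq> {m \<in> Q. m div K = b}"
        proof clarify
          fix j i assume *: "j < k" "i < M" "G b j i \<in> T c"
          have "((b * k + j) * M + i) div (M * k) = b" using * K(3) by (simp add: div_mult2_eq)
          then show "(b * k + j) * M + i \<in> Q \<and> ((b * k + j) * M + i) div K = b"
            using * unfolding Q_def G_def K_def by (simp add: mult.commute)
        qed
        show "finite {m \<in> Q. m div K = b}" using finQ by simp
      qed
      finally show ?thesis .
    qed
    have "J = (\<Union>b\<in>B. {j. j div k = b \<and> j \<in> J})" using inJ by blast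
    then have Jle: "card J \<le> (\<Sum>b\<in>B. card {j. j div k = b \<and> j \<in> J})" using card_UN_le[OF finB] by metis
    have "real (card J) \<le> (\<Sum>b\<in>B. real (card {j. j div k = b \<and> j \<in> J}))"
      using of_nat_mono[OF Jle, where ?'a = real] by simp
    then have "(1 - \<delta>) * card J \<le> (1 - \<delta>) * (\<Sum>b\<in>B. real (card {j. j div k = b \<and> j \<in> J}))"
      using \<delta> by (intro mult_left_mono) auto
    also have "\<dots> = (\<Sum>b\<in>B. (1 - \<delta>) * card {j. j < k \<and> G b j ((i + S b j) mod M) \<in> T c})"
      unfolding cardJb by (rule sum_distrib_left)
    also have "\<dots> \<le> (\<Sum>b\<in>B. card {m \<in> Q. m div K = b} / M + \<kappa>)"
    proof (rule sum_mono)
      fix b assume "b \<in> B"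
      then have cb: "c \<in> C b" using c unfolding B_def Q_def C_def by blast
      then have C0: "card (C b) > 0" using finC card_gt_0_iff by blast
      have "real (card (C b) * M) \<le> real (k * M * (2 * k + 1) * M)"
        using cardC[of b] by (intro of_nat_mono mult_le_mono1)
      moreover have "0 < real (card (C b) * M)" using C0 K(3) by simp
      ultimately have "ln (card (C b) * M) / \<delta> \<le> \<kappa>"
        unfolding \<kappa>_def using \<delta> by (intro divide_right_mono ln_mono) auto
      moreover have "(\<Sum>j<k. real (card {i. i < M \<and> G b j i \<in> T c})) / M \<le> card {m \<in> Q. m div K = b} / M"
        using Qb[of b] by (intro divide_right_mono) (simp_all flip: of_nat_sum)
      ultimately show "(1 - \<delta>) * card {j. j < k \<and> G b j ((i + S b j) mod M) \<in> T c}
          \<le> card {m \<in> Q. m div K = b} / M + \<kappa>"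
        using S[rule_format, OF cb i] by linarith
    qed
    also have "\<dots> = real (\<Sum>b\<in>B. card {m \<in> Q. m div K = b}) / M + card B * \<kappa>"
      by (simp add: sum.distrib sum_divide_distrib)
    also have "\<dots> \<le> card (T c) / M + 6 * \<kappa>"
    proof (rule add_mono)
      have "(\<Sum>b\<in>B. card {m \<in> Q. m div K = b}) = card (\<Union>b\<in>B. {m \<in> Q. m div K = b})"
        using finB finQ by (intro card_UN_disjoint[symmetric]) auto
      also have "\<dots> \<le> card Q" using finQ by (intro card_mono) auto
      also have "\<dots> \<le> card (T c)"
        using finT strict_mono_imp_inj_on[OF e] unfolding Q_def
        by (intro card_inj_on_le[of e]) (auto intro: inj_on_subset)
      finally show "real (\<Sum>b\<in>B. card {m \<in> Q. m div K = b}) / M \<le> card (T c) / M"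
        by (intro divide_right_mono of_nat_mono) auto
      have "1 \<le> k * M * (2 * k + 1) * M" using k K(3) by (simp add: Suc_le_eq)
      then have "1 \<le> real (k * M * (2 * k + 1) * M)" by (metis of_nat_1 of_nat_le_iff)
      then have "0 \<le> \<kappa>" unfolding \<kappa>_def using \<delta> by (intro divide_nonneg_pos ln_ge_zero) auto
      then show "card B * \<kappa> \<le> 6 * \<kappa>" using cardB by (intro mult_right_mono) auto
    qed
    finally show "(1 - \<delta>) * card {j. e (j * M + (i + s j) mod M) \<in> T c}
      \<le> card (T c) / M + 6 * (ln (real (k * M * (2 * k + 1) * M)) / \<delta>)"
      unfolding J_def \<kappa>_def .
  qed
qed

section \<open>Joining the cycles of a permutation\<close>

lemma orbit_mono_if_step:
  assumes "\<And>u. f u \<in> orbit g u"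
  shows "orbit f u \<subseteq> orbit g u"
proof
  fix v assume "v \<in> orbit f u"
  then show "v \<in> orbit g u"
  proof induction
    case base
    show ?case by (rule assms)
  next
    case (step z)
    show ?case by (rule orbit_trans[OF assms step.IH])
  qed
qed

text \<open>From \<open>x\<close> the new map enters the old cycle of \<open>y\<close> right behind
  \<open>y\<close> and runs through it as \<open>f\<close> does, since neither \<open>x\<close> nor
  \<open>y\<close> interferes before \<open>y\<close> itself is reached.\<close>

lemma transpose_joins_orbits:
  assumes perm: "permutation f" and xy: "y \<notin> orbit f x"
  shows "orbit f u \<subseteq> orbit (f \<circ> transpose x y) u" and "y \<in> orbit (f \<circ> transpose x y) x"
proof -
  let ?g = "f \<circ> transpose x y"
  have join: "b \<in> orbit g a"
    if "b \<notin> orbit f a" and g: "g a = f b" "\<And>z. z \<noteq> a \<Longrightarrow> z \<noteq> b \<Longrightarrow> g z = f z" for a b g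
  proof (rule ccontr)
    assume nb: "b \<notin> orbit g a"
    have ab: "a \<notin> orbit f b"
      using that(1) orbit_swap[OF permutation_self_in_orbit[OF perm]] by metis
    have "z \<in> orbit g a" if "z \<in> orbit f b" for z
      using that
    proof induction
      case base
      show ?case using g(1) orbit.base[of g a] by simp
    next
      case (step z)
      then have "g z = f z" using ab nb g(2) by metis
      then show ?case using step.IH orbit.step[of z g a] by simp
    qed
    then show False using nb permutation_self_in_orbit[OF perm, of b] by blast
  qed
  have yx: "x \<notin> orbit f y" using xy orbit_swap[OF permutation_self_in_orbit[OF perm]] by metis
  show y: "y \<in> orbit ?g x" by (rule join[OF xy]) (simp_all add: transpose_def)
  have x: "x \<in> orbit ?g y" by (rule join[OF yx]) (simp_all add: transpose_def)
  show "orbit f u \<subseteq> orbit ?g u"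
  proof (rule orbit_mono_if_step)
    fix u
    show "f u \<in> orbit ?g u"
    proof (cases "u = x \<or> u = y")
      case False
      then have "f u = ?g u" by (simp add: transpose_def)
      then show ?thesis by (metis orbit.base)
    next
      case True
      then show ?thesis
      proof
        assume "u = x"
        have "f x = ?g y" by simp
        then have "f x \<in> orbit ?g y" by (metis orbit.base)
        then show ?thesis using y \<open>u = x\<close> by (simp only: orbit_trans)
      next
        assume "u = y"
        have "f y = ?g x" by simp
        then have "f y \<in> orbit ?g x" by (metis orbit.base)
        then show ?thesis using x \<open>u = y\<close> by (simp only: orbit_trans)
      qed
    qed
  qed
qed

text \<open>The swaps are made one after another, and only if the two points still lie on different
  cycles; otherwise a swap would cut a cycle in two. As all points are distinct, \<open>x l\<close>
  and \<open>y l\<close> still have their images under \<open>f\<close> when their turn comes, so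
  the adjacencies assumed for \<open>f\<close> apply.\<close>

lemma join_orbits_by_swaps:
  fixes x y :: "nat \<Rightarrow> 'a"
  assumes V: "finite V" and f: "f permutes V" and adj: "\<And>u. u \<in> V \<Longrightarrow> adj u (f u)"
    and xy: "\<And>i. i < m \<Longrightarrow> x i \<in> V \<and> y i \<in> V \<and> adj (x i) (f (y i)) \<and> adj (y i) (f (x i))"
    and inj: "inj_on x {..<m}" "inj_on y {..<m}" "\<And>i j. i < m \<Longrightarrow> j < m \<Longrightarrow> x i \<noteq> y j"
  shows "\<exists>g. g permutes V \<and> (\<forall>u\<in>V. adj u (g u)) \<and> (\<forall>u. orbit f u \<subseteq> orbit g u)
    \<and> (\<forall>i<m. y i \<in> orbit g (x i))"
proof -
  have "\<exists>g. g permutes V \<and> (\<forall>u\<in>V. adj u (g u)) \<and> (\<forall>u. orbit f u \<subseteq> orbit g u)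
    \<and> (\<forall>i<l. y i \<in> orbit g (x i)) \<and> (\<forall>u. u \<notin> x ` {..<l} \<longrightarrow> u \<notin> y ` {..<l} \<longrightarrow> g u = f u)" if "l \<le> m" for l
    using that
  proof (induction l)
    case 0
    show ?case using f adj by (intro exI[of _ f]) simp
  next
    case (Suc l)
    then obtain g where g: "g permutes V" "\<forall>u\<in>V. adj u (g u)" "\<forall>u. orbit f u \<subseteq> orbit g u"
      "\<forall>i<l. y i \<in> orbit g (x i)" "\<forall>u. u \<notin> x ` {..<l} \<longrightarrow> u \<notin> y ` {..<l} \<longrightarrow> g u = f u" by auto
    show ?case
    proof (cases "y l \<in> orbit g (x l)")
      case True
      then show ?thesis using g by (intro exI[of _ g]) (auto simp: less_Suc_eq lessThan_Suc)
    next
      case False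
      have perm: "permutation g" using g(1) V by (auto simp: permutation_permutes)
      let ?h = "g \<circ> transpose (x l) (y l)"
      have l: "l < m" using Suc.prems by simp
      have "x l \<notin> x ` {..<l}" "y l \<notin> y ` {..<l}"
        using inj_onD[OF inj(1)] inj_onD[OF inj(2)] l by fastforce+
      moreover have "x l \<notin> y ` {..<l}" "y l \<notin> x ` {..<l}"
        by (metis imageE lessThan_iff order.strict_trans l inj(3))+
      ultimately have gxy: "g (x l) = f (x l)" "g (y l) = f (y l)" using g(5) by blast+
      have "?h permutes V" using xy[OF l] g(1) by (intro permutes_compose permutes_swap_id) auto
      moreover have "\<forall>u\<in>V. adj u (?h u)"
        using g(2) xy[OF l] gxy by (auto simp: transpose_def)
      moreover have "\<forall>u. orbit f u \<subseteq> orbit ?h u"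
        using g(3) transpose_joins_orbits(1)[OF perm False] by blast
      moreover have "\<forall>i<Suc l. y i \<in> orbit ?h (x i)"
      proof (intro allI impI)
        fix i assume "i < Suc l"
        then consider "i < l" | "i = l" by linarith
        then show "y i \<in> orbit ?h (x i)"
        proof cases
          case 1
          then show ?thesis using g(4) transpose_joins_orbits(1)[OF perm False] by blast
        next
          case 2
          then show ?thesis using transpose_joins_orbits(2)[OF perm False] by simp
        qed
      qed
      moreover have "\<forall>u. u \<notin> x ` {..<Suc l} \<longrightarrow> u \<notin> y ` {..<Suc l} \<longrightarrow> ?h u = f u"
        using g(5) by (auto simp: transpose_def lessThan_Suc)
      ultimately show ?thesis by (intro exI[of _ ?h] conjI)
    qed
  qed
  from this[OF order_refl] show ?thesis by blast
qed

text \<open>The set \<open>E\<close> holds the vertices that fit in no layer and is added to both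
  sides of the last matching. As no image of \<open>E\<close> is in \<open>E\<close>, an orbit
  leaving \<open>L K\<close> is in \<open>L 0\<close> after at most two steps, and from any other
  layer it gets to \<open>L K\<close> layer by layer.\<close>

lemma layered_permutation:
  fixes L :: "nat \<Rightarrow> 'a set"
  assumes f: "\<And>t. t < K \<Longrightarrow> bij_betw (f t) (L t) (L (Suc t))"
    and g: "bij_betw g (L K \<union> E) (E \<union> L 0)" and gE: "\<And>u. u \<in> E \<Longrightarrow> g u \<notin> E"
    and disj: "\<And>t t'. t \<le> K \<Longrightarrow> t' \<le> K \<Longrightarrow> t \<noteq> t' \<Longrightarrow> L t \<inter> L t' = {}"
    and disjE: "\<And>t. t \<le> K \<Longrightarrow> L t \<inter> E = {}"
  shows "\<exists>p. p permutes (\<Union>t\<le>K. L t) \<union> E \<and> (\<forall>t<K. \<forall>u\<in>L t. p u = f t u) \<and> (\<forall>u\<in>L K \<union> E. p u = g u)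
    \<and> (\<forall>v\<in>(\<Union>t\<le>K. L t) \<union> E. \<exists>w\<in>L 0. w \<in> orbit p v)"
proof -
  define V where "V = (\<Union>t\<le>K. L t) \<union> E"
  define p where "p v = (if v \<in> L K \<union> E then g v else if v \<in> V then f (THE t. t < K \<and> v \<in> L t) v else v)" for v
  have pf: "p u = f t u" if "t < K" "u \<in> L t" for t u
  proof -
    have "(THE t. t < K \<and> u \<in> L t) = t" using that disj by (intro the_equality) (auto dest: less_imp_le)
    moreover have "u \<notin> L K \<union> E" "u \<in> V" using that disj[of t K] disjE[of t] unfolding V_def by auto
    ultimately show ?thesis unfolding p_def by simp
  qed
  have pg: "p u = g u" if "u \<in> L K \<union> E" for u using that unfolding p_def by simp
  have "bij_betw p (\<Union>t\<in>{..<K}. L t) (\<Union>t\<in>{..<K}. L (Suc t))"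
  proof (rule bij_betw_UNION_disjoint)
    show "disjoint_family_on (\<lambda>t. L (Suc t)) {..<K}" using disj by (auto simp: disjoint_family_on_def)
    fix t assume "t \<in> {..<K}"
    then show "bij_betw p (L t) (L (Suc t))" using f[of t] pf by (subst bij_betw_cong[of _ _ "f t"]) auto
  qed
  moreover have "bij_betw p (L K \<union> E) (E \<union> L 0)"
    using g pg by (subst bij_betw_cong[of _ _ g]) auto
  moreover have "(\<Union>t\<in>{..<K}. L (Suc t)) \<inter> (E \<union> L 0) = {}"
  proof (intro equals0I)
    fix v assume "v \<in> (\<Union>t\<in>{..<K}. L (Suc t)) \<inter> (E \<union> L 0)"
    then obtain t where t: "t < K" "v \<in> L (Suc t)" "v \<in> E \<union> L 0" by blast
    then show False using disj[of "Suc t" 0] disjE[of "Suc t"] by auto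
  qed
  ultimately have bij: "bij_betw p ((\<Union>t\<in>{..<K}. L t) \<union> (L K \<union> E)) ((\<Union>t\<in>{..<K}. L (Suc t)) \<union> (E \<union> L 0))"
    by (rule bij_betw_combine)
  have "(\<Union>t\<in>{..<K}. L t) \<union> (L K \<union> E) = V" unfolding V_def by (auto simp: le_less)
  moreover have "(\<Union>t\<in>{..<K}. L (Suc t)) \<union> (E \<union> L 0) = V"
  proof -
    have "{..K} = insert 0 (Suc ` {..<K})"
      unfolding lessThan_Suc_atMost[symmetric] by (rule lessThan_Suc_eq_insert_0)
    then have "(\<Union>t\<le>K. L t) = L 0 \<union> (\<Union>t\<in>{..<K}. L (Suc t))" by (simp only: UN_insert UN_simps)
    then show ?thesis unfolding V_def by blast
  qed
  ultimately have "bij_betw p V V" using bij by simp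
  moreover have "p v = v" if "v \<notin> V" for v using that unfolding p_def V_def by auto
  ultimately have perm: "p permutes V" by (intro bij_imp_permutes) auto
  have E0: "\<exists>w\<in>L 0. w \<in> orbit p v" if "v \<in> E" for v
  proof -
    have "g v \<in> L 0" using bij_betwE[OF g] gE that by auto
    then show ?thesis using pg[of v] that orbit.base[of p v] by auto
  qed
  have L0: "\<exists>w\<in>L 0. w \<in> orbit p v" if "v \<in> L (K - d)" "d \<le> K" for v d
    using that
  proof (induction d arbitrary: v)
    case 0
    then have "p v \<in> E \<union> L 0" using bij_betwE[OF g] pg by auto
    then show ?case
    proof
      assume "p v \<in> E"
      then obtain w where "w \<in> L 0" "w \<in> orbit p (p v)" using E0 by blast
      then show ?thesis using orbit_trans[OF _ orbit.base[of p v]] by blast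
    next
      assume "p v \<in> L 0"
      then show ?thesis using orbit.base[of p v] by blast
    qed
  next
    case (Suc d)
    have t: "K - Suc d < K" "Suc (K - Suc d) = K - d" using Suc.prems(2) by simp_all
    have "p v \<in> L (K - d)"
      using pf[OF t(1) Suc.prems(1)] bij_betw_apply[OF f[OF t(1)] Suc.prems(1)] t(2) by simp
    then obtain w where "w \<in> L 0" "w \<in> orbit p (p v)" using Suc.IH Suc.prems(2) by auto
    then show ?case using orbit_trans[OF _ orbit.base[of p v]] by blast
  qed
  have "\<forall>v\<in>V. \<exists>w\<in>L 0. w \<in> orbit p v"
  proof
    fix v assume "v \<in> V"
    then consider "v \<in> E" | t where "t \<le> K" "v \<in> L t" unfolding V_def by auto
    then show "\<exists>w\<in>L 0. w \<in> orbit p v"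
    proof cases
      case 2
      then show ?thesis using L0[of v "K - t"] by simp
    qed (rule E0)
  qed
  then show ?thesis using perm pf pg unfolding V_def by (intro exI[of _ p] conjI) simp_all
qed

section \<open>Reserved paths\<close>

lemma card_multiples_interval_le:
  assumes D: "D > 0"
  shows "finite {j. a \<le> int (j * D) \<and> int (j * D) \<le> a + int d}" (is "finite ?Q")
    and "card {j. a \<le> int (j * D) \<and> int (j * D) \<le> a + int d} \<le> d div D + 1"
proof -
  have "j \<le> nat (a + int d)" if "j \<in> ?Q" for j
  proof -
    have "j \<le> j * D" using D by simp
    then have "int j \<le> int (j * D)" by (simp only: of_nat_le_iff)
    then have "int j \<le> a + int d" using that by simp
    then show ?thesis by linarith
  qed
  then show fin: "finite ?Q" by (meson finite_nat_set_iff_bounded_le)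
  show "card ?Q \<le> d div D + 1"
  proof (cases "?Q = {}")
    case False
    define j0 where "j0 = Min ?Q"
    have j0: "j0 \<in> ?Q" "\<And>j. j \<in> ?Q \<Longrightarrow> j0 \<le> j"
      unfolding j0_def by (rule Min_in[OF fin False], rule Min_le[OF fin])
    have "?Q \<subseteq> {j0..j0 + d div D}"
    proof
      fix j assume j: "j \<in> ?Q"
      have "int (j * D) \<le> int (j0 * D) + int d" using j j0(1) by simp
      then have "j * D \<le> j0 * D + d" by linarith
      then have "(j * D) div D \<le> (j0 * D + d) div D" by (rule div_le_mono)
      then have "j \<le> j0 + d div D" using D by simp
      then show "j \<in> {j0..j0 + d div D}" using j0(2)[OF j] by simp
    qed
    then have "card ?Q \<le> card {j0..j0 + d div D}" by (intro card_mono) auto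
    then show ?thesis by simp
  next
    case True
    show ?thesis unfolding True by simp
  qed
qed

lemma card_near_multiples_le:
  assumes D: "D > 0" and a: "a < n" and N: "N * D \<le> n"
  shows "card {j. j < N \<and> near n K a (j * D)} \<le> 3 * (2 * K div D + 1)"
proof (cases "K \<le> n")
  case True
  let ?I = "\<lambda>b. {j. b \<le> int (j * D) \<and> int (j * D) \<le> b + int (2 * K)}"
  have "{j. j < N \<and> near n K a (j * D)} \<subseteq> ?I (int a - int K) \<union> ?I (int a + int n - int K) \<union> ?I (int a - int n - int K)"
  proof
    fix j assume "j \<in> {j. j < N \<and> near n K a (j * D)}"
    then have j: "j < N" "near n K a (j * D)" by auto
    have "j * D < n" using j(1) N D by (meson mult_less_cancel2 order_less_le_trans)
    then show "j \<in> ?I (int a - int K) \<union> ?I (int a + int n - int K) \<union> ?I (int a - int n - int K)"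
      using near_cases[OF j(2) a _ True] by auto
  qed
  then have "card {j. j < N \<and> near n K a (j * D)}
      \<le> card (?I (int a - int K) \<union> ?I (int a + int n - int K) \<union> ?I (int a - int n - int K))"
    by (intro card_mono finite_UnI card_multiples_interval_le(1)[OF D])
  also have "\<dots> \<le> card (?I (int a - int K)) + card (?I (int a + int n - int K)) + card (?I (int a - int n - int K))"
    by (meson add_le_mono1 card_Un_le order_trans)
  also have "\<dots> \<le> (2 * K div D + 1) + (2 * K div D + 1) + (2 * K div D + 1)"
    by (intro add_mono card_multiples_interval_le(2)[OF D])
  finally show ?thesis by simp
next
  case False
  have "card {j. j < N \<and> near n K a (j * D)} \<le> card {..<N}" by (intro card_mono) auto
  moreover have "N = (N * D) div D" using D by simp
  moreover have "(N * D) div D \<le> (2 * K) div D" using False N by (intro div_le_mono) simp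
  ultimately show ?thesis by simp
qed

lemma ex_four_distinct:
  fixes Q :: "'a set"
  assumes "finite Q" "4 \<le> card Q"
  shows "\<exists>a b c d. distinct [a, b, c, d] \<and> {a, b, c, d} \<subseteq> Q"
proof -
  obtain T where T: "T \<subseteq> Q" "card T = 4" "finite T"
    using obtain_subset_with_card_n[OF assms(2)] by blast
  obtain xs where xs: "set xs = T" "distinct xs" using finite_distinct_list[OF T(3)] by blast
  then have "length xs = 4" using T(2) distinct_card by metis
  then obtain a b c d where "xs = [a, b, c, d]"
    by (auto simp: length_Suc_conv eval_nat_numeral)
  then have "distinct [a, b, c, d]" "{a, b, c, d} \<subseteq> Q" using xs T(1) by auto
  then show ?thesis by (intro exI conjI)
qed

text \<open>The graph is a bare relation, confined to windows that do not overlap themselves. A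
  window has \<open>2 * k\<close> vertices besides its centre, so
  \<open>(1 + \<epsilon>) * k\<close> is the proportion \<open>1/2 + \<epsilon>/2\<close>; the other
  half of the excess pays for the confinement.\<close>

locale dense_window_graph =
  fixes n k :: nat and adj :: "nat \<Rightarrow> nat \<Rightarrow> bool" and \<epsilon> :: real
  assumes n: "2 * k + 1 \<le> n"
    and adj_sym: "adj u v \<Longrightarrow> adj v u"
    and adj_irrefl: "\<not> adj u u"
    and adj_near: "adj u v \<Longrightarrow> u < n \<and> v < n \<and> near n k u v"
    and deg: "v < n \<Longrightarrow> (1 + \<epsilon>) * k \<le> card {u. adj v u}"
    and eps: "0 < \<epsilon>" "\<epsilon> \<le> 1"
begin

lemma n_pos: "n > 0" using n by simp

lemma finite_nbrs: "finite {w. adj v w}"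
  by (rule finite_subset[of _ "{..<n}"]) (use adj_near in auto)

lemma finite_nbrs_Collect: "finite {w. adj v w \<and> P w}"
  by (rule finite_subset[OF _ finite_nbrs[of v]]) auto

text \<open>For \<open>v < n\<close> the vertex \<open>v\<close> itself belongs to this set, which
  accounts for the \<open>+ 1\<close> in \<open>card_nonnbr\<close>.\<close>

definition nonnbr :: "nat \<Rightarrow> nat set" where
  "nonnbr v = {u. u < n \<and> near n k v u \<and> \<not> adj v u}"

lemma card_nonnbr:
  assumes "v < n"
  shows "real (card (nonnbr v)) \<le> (1 - \<epsilon>) * k + 1"
proof -
  have "nonnbr v = {u. u < n \<and> near n k v u} - {u. adj v u}" unfolding nonnbr_def by auto
  moreover have "{u. adj v u} \<subseteq> {u. u < n \<and> near n k v u}" using adj_near by auto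
  ultimately have "card (nonnbr v) = card {u. u < n \<and> near n k v u} - card {u. adj v u}"
    "card {u. adj v u} \<le> card {u. u < n \<and> near n k v u}"
    using finite_nbrs by (auto simp: card_Diff_subset intro!: card_mono)
  then have "real (card (nonnbr v)) \<le> real (2 * k + 1) - card {u. adj v u}"
    using card_near_le[OF n_pos, of k v] by linarith
  then show ?thesis using deg[OF assms] by (simp add: algebra_simps)
qed

text \<open>Inclusion and exclusion: both neighbourhoods lie in one interval of
  \<open>2 * k + 1 + d\<close> vertices.\<close>

lemma card_common_nbrs:
  assumes "u < n" "v < n" "near n d u v"
  shows "2 * \<epsilon> * k - 1 - d \<le> card {w. adj u w \<and> adj v w}"
proof -
  have "{w. adj u w} \<union> {w. adj v w} \<subseteq> {w. w < n \<and> (near n k u w \<or> near n k v w)}"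
    using adj_near by auto
  then have "card ({w. adj u w} \<union> {w. adj v w}) \<le> card {w. w < n \<and> (near n k u w \<or> near n k v w)}"
    by (intro card_mono) auto
  also have "\<dots> \<le> 2 * k + 1 + d" by (rule card_near_union_le[OF assms(3)])
  finally have "card ({w. adj u w} \<union> {w. adj v w}) \<le> 2 * k + 1 + d" .
  moreover have "card {w. adj u w} + card {w. adj v w}
      = card ({w. adj u w} \<union> {w. adj v w}) + card ({w. adj u w} \<inter> {w. adj v w})"
    by (rule card_Un_Int[OF finite_nbrs finite_nbrs])
  moreover have "{w. adj u w} \<inter> {w. adj v w} = {w. adj u w \<and> adj v w}" by auto
  ultimately have "card {w. adj u w} + card {w. adj v w} \<le> 2 * k + 1 + d + card {w. adj u w \<and> adj v w}"
    by simp
  then show ?thesis using deg[OF assms(1)] deg[OF assms(2)] by (simp add: algebra_simps)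
qed

text \<open>The average vertex near seven given ones is adjacent to more than three of them, so a positive
  proportion is adjacent to four, and the same four occur often.\<close>

lemma four_with_common_nbrs:
  assumes Z: "card Z = 7" "Z \<subseteq> {a..a + d}" "Z \<subseteq> {..<n}" and k: "6 + 6 * d \<le> k"
  shows "\<exists>x y z w. distinct [x, y, z, w] \<and> {x, y, z, w} \<subseteq> Z
    \<and> real k / 1024 \<le> card {v. adj x v \<and> adj y v \<and> adj z v \<and> adj w v}"
proof -
  have finZ: "finite Z" using Z(1) card.infinite by fastforce
  define W where "W = {w. w < n \<and> (\<exists>u\<in>Z. near n k u w)}"
  have finW: "finite W" unfolding W_def by simp
  have cardW: "card W \<le> 2 * k + 1 + d"
    unfolding W_def using Z(2) by (intro card_near_interval_le[OF n_pos, of _ a]) auto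
  define c where "c w = card {z \<in> Z. adj z w}" for w
  define H where "H = {w \<in> W. 4 \<le> c w}"
  have c7: "c w \<le> 7" for w unfolding c_def Z(1)[symmetric] using finZ by (intro card_mono) auto
  \<comment> \<open>With seven vertices, degree \<open>k\<close> already gives an average near 7/2,
    well above three, so the proportion obtained is independent of \<epsilon>.\<close>
  have "7 * real k \<le> (\<Sum>z\<in>Z. real (card {w. adj z w}))"
  proof -
    have "real k \<le> card {w. adj z w}" if "z \<in> Z" for z
    proof -
      have "real k \<le> (1 + \<epsilon>) * k" using eps by (simp add: algebra_simps)
      then show ?thesis using deg[of z] Z(3) that by fastforce
    qed
    then have "(\<Sum>z\<in>Z. real k) \<le> (\<Sum>z\<in>Z. real (card {w. adj z w}))" by (intro sum_mono)
    then show ?thesis using Z(1) by simp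
  qed
  also have "(\<Sum>z\<in>Z. real (card {w. adj z w})) = (\<Sum>z\<in>Z. \<Sum>w\<in>W. if adj z w then 1 else 0)"
  proof (intro sum.cong refl)
    fix z assume "z \<in> Z"
    then have "{w. adj z w} = {w \<in> W. adj z w}" using adj_near unfolding W_def by auto
    then show "real (card {w. adj z w}) = (\<Sum>w\<in>W. if adj z w then 1 else 0)"
      using finW by (simp add: sum.If_cases Int_def)
  qed
  also have "\<dots> = (\<Sum>w\<in>W. \<Sum>z\<in>Z. if adj z w then 1 else 0)" by (rule sum.swap)
  also have "\<dots> = (\<Sum>w\<in>W. real (c w))"
    unfolding c_def using finZ by (simp add: sum.If_cases Int_def)
  also have "\<dots> \<le> (\<Sum>w\<in>W. 3 + (if 4 \<le> c w then 4 else 0))"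
    using c7 by (intro sum_mono) (auto simp: not_le)
  also have "\<dots> = 3 * card W + 4 * card H"
    unfolding H_def using finW by (simp add: sum.distrib sum.If_cases Int_def)
  finally have "7 * real k \<le> 3 * card W + 4 * card H" by simp
  moreover have "real (card W) \<le> 2 * k + 1 + d" using cardW by linarith
  \<comment> \<open>Here \<open>7 k \<le> 3 (2 k + 1 + d) + 4 card H\<close>, and
    \<open>3 + 3 d\<close> is at most \<open>k / 2\<close>.\<close>
  ultimately have cardH: "real k / 8 \<le> card H" using k by linarith
  \<comment> \<open>Pigeonhole over the \<open>2 ^ 7\<close> possible traces on \<open>Z\<close>:
    one of them occurs \<open>k / 8 / 128 = k / 1024\<close> times.\<close>
  have "\<exists>Q\<in>Pow Z. real k / 1024 \<le> card {w \<in> H. {z \<in> Z. adj z w} = Q}"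
  proof (rule ccontr)
    assume "\<not> ?thesis"
    then have lt: "real (card {w \<in> H. {z \<in> Z. adj z w} = Q}) < real k / 1024" if "Q \<in> Pow Z" for Q
      using that not_le by blast
    let ?HQ = "\<lambda>Q. {w \<in> H. {z \<in> Z. adj z w} = Q}"
    have finHQ: "finite (?HQ Q)" for Q using finW unfolding H_def by simp
    have "H \<subseteq> (\<Union>Q\<in>Pow Z. ?HQ Q)"
    proof
      fix w assume "w \<in> H"
      then show "w \<in> (\<Union>Q\<in>Pow Z. ?HQ Q)" by (intro UN_I[of "{z \<in> Z. adj z w}"]) simp_all
    qed
    then have "card H \<le> card (\<Union>Q\<in>Pow Z. ?HQ Q)" using finZ finHQ by (intro card_mono) simp_all
    also have "\<dots> \<le> (\<Sum>Q\<in>Pow Z. card (?HQ Q))" using finZ by (intro card_UN_le) simp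
    finally have Hle: "card H \<le> (\<Sum>Q\<in>Pow Z. card (?HQ Q))" .
    have "real (card H) \<le> (\<Sum>Q\<in>Pow Z. real (card (?HQ Q)))"
      using of_nat_mono[OF Hle, where ?'a = real] by simp
    also have "\<dots> < (\<Sum>Q\<in>Pow Z. real k / 1024)"
      by (rule sum_strict_mono) (use finZ lt in \<open>simp_all add: Pow_not_empty\<close>)
    also have "\<dots> = real k / 8" using Z(1) finZ by (simp add: card_Pow)
    finally show False using cardH by simp
  qed
  then obtain Q where Q: "Q \<subseteq> Z" "real k / 1024 \<le> card {w \<in> H. {z \<in> Z. adj z w} = Q}" by blast
  have "card {w \<in> H. {z \<in> Z. adj z w} = Q} \<noteq> 0" using Q(2) k by linarith
  then obtain w0 where "w0 \<in> H" "{z \<in> Z. adj z w0} = Q"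
    by (metis (mono_tags, lifting) card.empty empty_Collect_eq)
  then have "4 \<le> card Q" unfolding H_def c_def by blast
  then obtain x y z w where xyzw: "distinct [x, y, z, w]" "{x, y, z, w} \<subseteq> Q"
    using ex_four_distinct[OF finite_subset[OF Q(1) finZ]] by blast
  have "card {w \<in> H. {z \<in> Z. adj z w} = Q} \<le> card {v. adj x v \<and> adj y v \<and> adj z v \<and> adj w v}"
    using xyzw(2) by (intro card_mono finite_nbrs_Collect) blast
  then have "real k / 1024 \<le> card {v. adj x v \<and> adj y v \<and> adj z v \<and> adj w v}" using Q(2) by linarith
  moreover have "{x, y, z, w} \<subseteq> Z" using xyzw(2) Q(1) by (rule subset_trans)
  ultimately show ?thesis using xyzw(1) by (intro exI conjI)
qed

end

lemma inj_on_list_nth: "distinct xs \<Longrightarrow> i < length xs \<Longrightarrow> j < length xs \<Longrightarrow> xs ! i = xs ! j \<Longrightarrow> i = j"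
  by (simp add: nth_eq_iff_index_eq)

section \<open>Exchange gadgets between consecutive paths\<close>

context dense_window_graph
begin

text \<open>Anchors 0 and 1 are the prescribed ends of path \<open>j\<close>, and anchors 2 to 5
  carry the exchange. The bound \<open>D \<ge> 9\<close> leaves seven candidates besides the
  ends.\<close>

lemma gadget_anchors:
  assumes D: "D \<ge> 9" "6 + 6 * D \<le> k" and j: "j * D + D \<le> n"
    and pr: "p \<in> {j * D..<j * D + D}" "r \<in> {j * D..<j * D + D}" "p \<noteq> r"
  shows "\<exists>w::nat \<Rightarrow> nat. inj_on w {..<6} \<and> w 0 = p \<and> w 1 = r \<and> (\<forall>s<6. w s \<in> {j * D..<j * D + D})
    \<and> real k / 1024 \<le> card {v. adj (w 2) v \<and> adj (w 3) v \<and> adj (w 4) v \<and> adj (w 5) v}"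
proof -
  have "card ({j * D..<j * D + D} - {p, r}) = D - 2"
    using pr by (subst card_Diff_subset) auto
  then have "7 \<le> card ({j * D..<j * D + D} - {p, r})" using D by simp
  then obtain Z where Z: "Z \<subseteq> {j * D..<j * D + D} - {p, r}" "card Z = 7"
    using obtain_subset_with_card_n by metis
  have "Z \<subseteq> {j * D..j * D + D}" "Z \<subseteq> {..<n}" using Z(1) j by auto
  then obtain x y z w where xyzw: "distinct [x, y, z, w]" "{x, y, z, w} \<subseteq> Z"
    "real k / 1024 \<le> card {v. adj x v \<and> adj y v \<and> adj z v \<and> adj w v}"
    using four_with_common_nbrs[OF Z(2) _ _ D(2)] by blast
  let ?l = "[p, r, x, y, z, w]"
  have in_j: "set ?l \<subseteq> {j * D..<j * D + D}" using xyzw(2) Z(1) pr by auto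
  have dist: "distinct ?l" using xyzw Z(1) pr(3) by auto
  show ?thesis
  proof (intro exI[of _ "\<lambda>s. ?l ! s"] conjI allI impI)
    show "inj_on (\<lambda>s. ?l ! s) {..<6}"
      using inj_on_list_nth[OF dist] by (intro inj_onI) simp
    show "?l ! s \<in> {j * D..<j * D + D}" if "s < 6" for s
      by (rule subsetD[OF in_j nth_mem]) (use that in simp)
    show "real k / 1024 \<le> card {v. adj (?l ! 2) v \<and> adj (?l ! 3) v \<and> adj (?l ! 4) v \<and> adj (?l ! 5) v}"
      using xyzw(3) by simp
  qed simp_all
qed

text \<open>The order in which path \<open>j\<close> visits the anchors (codes below 6) and the connecting vertices
  (codes 6 to 10); the entries in positions 2 to 4 belong to the gadget of path \<open>j - 1\<close>.\<close>

definition path_code :: "nat \<Rightarrow> nat" where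
  "path_code t = [0, 6, 4, 10, 5, 7, 2, 9, 3, 8, 1] ! t"

lemma path_code_simps:
  "path_code 0 = 0" "path_code 1 = 6" "path_code 2 = 4" "path_code 3 = 10" "path_code 4 = 5" "path_code 5 = 7"
  "path_code 6 = 2" "path_code 7 = 9" "path_code 8 = 3" "path_code 9 = 8" "path_code 10 = 1"
  unfolding path_code_def by simp_all

lemma path_code_less:
  assumes "t < 11"
  shows "path_code t < 11"
proof -
  have "path_code t \<in> set [0, 6, 4, 10, 5, 7, 2, 9, 3, 8, 1]"
    unfolding path_code_def using assms by (intro nth_mem) simp
  then show ?thesis by auto
qed

lemma path_code_inj: "t < 11 \<Longrightarrow> t' < 11 \<Longrightarrow> path_code t = path_code t' \<Longrightarrow> t = t'"
  unfolding path_code_def by (rule inj_on_list_nth[of "[0::nat, 6, 4, 10, 5, 7, 2, 9, 3, 8, 1]"]) simp_all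

text \<open>In gadget \<open>j\<close> the connecting vertices 9 and 10 are both adjacent to all of
  the anchors 2 to 5. Path \<open>j\<close> crosses 2, 9, 3 and path \<open>j + 1\<close> crosses 4,
  10, 5; hence 9 and 10 can be exchanged as successors of 2 and 4, which is the last conclusion. The
  ends are prescribed so that they can be taken evenly spread, whereas the interior vertices are
  only known to be close to \<open>j * D\<close>.\<close>

lemma gadget_paths:
  fixes p r :: "nat \<Rightarrow> nat"
  assumes D: "D \<ge> 9" "6 + 6 * D \<le> k" "3 * real D + 1 \<le> \<epsilon> * k" and N: "N = n div D" "N > 0"
    and conf: "33 * (real (4 * k + 4 * D) / D + 1) < \<epsilon> * k / 1024"
    and pr: "\<And>j. j < N \<Longrightarrow> p j \<in> {j * D..<j * D + D} \<and> r j \<in> {j * D..<j * D + D} \<and> p j \<noteq> r j"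
  shows "\<exists>q. inj_on (\<lambda>(j, t). q j t) ({..<N} \<times> {..<11})
    \<and> (\<forall>j<N. \<forall>t<11. q j t < n \<and> near n (k + 3 * D) (j * D) (q j t))
    \<and> (\<forall>j<N. \<forall>t<10. adj (q j t) (q j (Suc t)))
    \<and> (\<forall>j<N. q j 0 = p j \<and> q j 10 = r j)
    \<and> (\<forall>j. Suc j < N \<longrightarrow> adj (q j 6) (q (Suc j) 3) \<and> adj (q (Suc j) 2) (q j 7))"
proof -
  have D0: "D > 0" and k0: "k > 0" using D by simp_all
  have ND: "N * D \<le> n" "n < N * D + D"
    unfolding N(1) by (simp_all add: dividend_less_times_div[OF D0] add.commute[of _ D] mult.commute[of _ D])
  have jD: "j * D + D \<le> n" if "j < N" for j
  proof -
    have "Suc j * D \<le> N * D" using that by (intro mult_le_mono1) simp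
    then show ?thesis using ND(1) by simp
  qed
  have "\<forall>j. \<exists>w::nat \<Rightarrow> nat. j < N \<longrightarrow> inj_on w {..<6} \<and> w 0 = p j \<and> w 1 = r j \<and> (\<forall>s<6. w s \<in> {j * D..<j * D + D})
    \<and> real k / 1024 \<le> card {v. adj (w 2) v \<and> adj (w 3) v \<and> adj (w 4) v \<and> adj (w 5) v}"
    using gadget_anchors[OF D(1,2) jD] pr by blast
  from choice[OF this] obtain w :: "nat \<Rightarrow> nat \<Rightarrow> nat" where w0: "\<forall>j. j < N \<longrightarrow>
    inj_on (w j) {..<6} \<and> w j 0 = p j \<and> w j 1 = r j \<and> (\<forall>s<6. w j s \<in> {j * D..<j * D + D})
    \<and> real k / 1024 \<le> card {v. adj (w j 2) v \<and> adj (w j 3) v \<and> adj (w j 4) v \<and> adj (w j 5) v}" ..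
  have w: "inj_on (w j) {..<6}" "w j 0 = p j" "w j 1 = r j" "\<And>s. s < 6 \<Longrightarrow> w j s \<in> {j * D..<j * D + D}"
    "real k / 1024 \<le> card {v. adj (w j 2) v \<and> adj (w j 3) v \<and> adj (w j 4) v \<and> adj (w j 5) v}" if "j < N" for j
    using w0[THEN spec, THEN mp, OF that] by simp_all
  \<comment> \<open>Cyclic, so that path 0 has the shape of the others and uses the last gadget; no
    exchange is claimed across this gap.\<close>
  define pred where "pred j = (if j = 0 then N - 1 else j - 1)" for j
  have pred: "pred j < N" if "j < N" for j using that unfolding pred_def by auto
  have pred_inj: "pred j = pred j' \<Longrightarrow> j = j'" if "j < N" "j' < N" for j j'
    using that unfolding pred_def by (auto split: if_splits)
  have w_lt: "w j s < n" if "j < N" "s < 6" for j s using w(4)[OF that] jD[OF that(1)] by auto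
  \<comment> \<open>For \<open>j = 0\<close> the remainder of \<open>n\<close> modulo
    \<open>D\<close> separates the two blocks; with the lengths of the blocks it stays below
    \<open>3 * D\<close>.\<close>
  have near_pred: "near n (3 * D) u v"
    if "j < N" "u \<in> {j * D..<j * D + D}" "v \<in> {pred j * D..<pred j * D + D}" for j u v
  proof (cases j)
    case 0
    have "(N - 1) * D + D = N * D" using N(2) by (cases N) auto
    then have v: "int N * int D - int D \<le> int v" "int v < int N * int D"
      using that(3) 0 unfolding pred_def by (auto simp flip: of_nat_mult of_nat_add)
    have "int n < int N * int D + int D" "int N * int D \<le> int n"
      using ND by (simp_all flip: of_nat_mult of_nat_add)
    moreover have "0 \<le> int u" "int u < int D" using that(2) 0 by auto
    ultimately have "\<bar>int v - int u - int n\<bar> \<le> int (3 * D)" using v by simp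
    moreover have "int n dvd int v - int u - (int v - int u - int n)" by simp
    ultimately show ?thesis unfolding near_def by blast
  next
    case (Suc i)
    then show ?thesis using that unfolding pred_def by (intro near_of_abs_diff) auto
  qed
  have near_same: "near n D u v" if "u \<in> {j * D..j * D + D}" "v \<in> {j * D..j * D + D}" for j u v
    using that by (intro near_of_abs_diff) auto
  \<comment> \<open>Candidates for the connecting vertex with code \<open>6 + t\<close> of index
    \<open>j\<close>. Residues 0, 1, 2 join two anchors; residues 3 and 4 supply the two
    interchangeable vertices of the gadget.\<close>
  define X where "X i = (let j = i div 5; t = i mod 5 in
    if t = 0 then {v. adj (w j 0) v \<and> adj (w (pred j) 4) v}
    else if t = 1 then {v. adj (w (pred j) 5) v \<and> adj (w j 2) v}
    else if t = 2 then {v. adj (w j 3) v \<and> adj (w j 1) v}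
    else {v. adj (w j 2) v \<and> adj (w j 3) v \<and> adj (w j 4) v \<and> adj (w j 5) v})" for i
  define F where "F = (\<lambda>(j, s). w j s) ` ({..<N} \<times> {..<6})"
  have finX: "finite (X i)" for i
    unfolding X_def Let_def using finite_nbrs_Collect by simp
  have anchor: "\<exists>s<6. adj (w (i div 5) s) v" if "v \<in> X i" for i v
  proof -
    have "adj (w (i div 5) 0) v \<or> adj (w (i div 5) 2) v \<or> adj (w (i div 5) 3) v"
      using that unfolding X_def Let_def by (simp split: if_splits)
    then show ?thesis
      by (elim disjE) (rule exI[of _ 0], simp, rule exI[of _ 2], simp, rule exI[of _ 3], simp)
  qed
  have X_near: "v < n \<and> near n (k + D) (j * D) v" if v: "v \<in> X i" "i div 5 = j" and j: "j < N" for i j v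
  proof -
    obtain s where s: "s < 6" "adj (w j s) v" using anchor[OF v(1)] v(2) by blast
    have "near n D (j * D) (w j s)" using w(4)[OF j s(1)] by (intro near_same[of _ j]) auto
    then have "near n (D + k) (j * D) v" using near_trans adj_near[OF s(2)] by blast
    then show ?thesis using adj_near[OF s(2)] by (simp add: add.commute)
  qed
  have cardX: "\<epsilon> * k / 1024 \<le> card (X i)" if "i < 5 * N" for i
  proof -
    define j t where "j = i div 5" and "t = i mod 5"
    have j: "j < N" using that unfolding j_def by (simp add: less_mult_imp_div_less mult.commute)
    have common: "\<epsilon> * k / 1024 \<le> card {v. adj x v \<and> adj y v}"
      if "x < n" "y < n" "near n (3 * D) x y" for x y
    proof -
      have "2 * \<epsilon> * k - 1 - real (3 * D) \<le> card {v. adj x v \<and> adj y v}" by (rule card_common_nbrs[OF that])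
      moreover have "\<epsilon> * k / 1024 \<le> \<epsilon> * k" using eps by simp
      ultimately show ?thesis using D(3) by simp
    qed
    consider "t = 0" | "t = 1" | "t = 2" | "t = 3 \<or> t = 4" unfolding t_def by linarith
    then show ?thesis
    proof cases
      case 1
      then have "X i = {v. adj (w j 0) v \<and> adj (w (pred j) 4) v}" unfolding X_def Let_def j_def t_def by simp
      then show ?thesis
        using common[OF w_lt[OF j] w_lt[OF pred[OF j]], of 0 4] near_pred[OF j w(4)[OF j] w(4)[OF pred[OF j]]] by simp
    next
      case 2
      then have "X i = {v. adj (w (pred j) 5) v \<and> adj (w j 2) v}" unfolding X_def Let_def j_def t_def by simp
      then show ?thesis
        using common[OF w_lt[OF pred[OF j]] w_lt[OF j], of 5 2] near_pred[OF j w(4)[OF j] w(4)[OF pred[OF j]], of 2 5] near_sym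
        by simp
    next
      case 3
      then have Xi: "X i = {v. adj (w j 3) v \<and> adj (w j 1) v}" unfolding X_def Let_def j_def t_def by simp
      have "near n D (w j 3) (w j 1)" using w(4)[OF j, of 3] w(4)[OF j, of 1] by (intro near_same[of _ j]) auto
      then have "near n (3 * D) (w j 3) (w j 1)" by (rule near_mono) simp
      then show ?thesis unfolding Xi using w_lt[OF j] by (intro common) simp_all
    next
      case 4
      then have Xi: "X i = {v. adj (w j 2) v \<and> adj (w j 3) v \<and> adj (w j 4) v \<and> adj (w j 5) v}"
        unfolding X_def Let_def j_def t_def by auto
      have "\<epsilon> * k / 1024 \<le> real k / 1024" using eps by (simp add: mult_left_le_one_le)
      then show ?thesis using w(5)[OF j] unfolding Xi by linarith
    qed
  qed
  have finF: "finite F" unfolding F_def by simp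
  \<comment> \<open>Whatever is in the way belongs to an index \<open>j'\<close> with
    \<open>j' * D\<close> within \<open>2 * k + 2 * D\<close> of \<open>j * D\<close>. Such indices
    come from three unwindings, and each has 6 anchors and 5 candidate sets; hence
    \<open>33 = 3 * (6 + 5)\<close> in \<open>conf\<close>.\<close>
  have choice: "card (F \<inter> X i) + card {i'. i' < 5 * N \<and> X i' \<inter> X i \<noteq> {}} < card (X i)" if i: "i < 5 * N" for i
  proof -
    define j where "j = i div 5"
    have j: "j < N" using i unfolding j_def by (simp add: less_mult_imp_div_less mult.commute)
    define J where "J = {j'. j' < N \<and> near n (2 * k + 2 * D) (j * D) (j' * D)}"
    have finJ: "finite J" unfolding J_def by simp
    have "card J \<le> 3 * (2 * (2 * k + 2 * D) div D + 1)"
      unfolding J_def using jD[OF j] D0 by (intro card_near_multiples_le ND(1)) auto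
    moreover have "2 * (2 * k + 2 * D) = 4 * k + 4 * D" by simp
    ultimately have cardJ: "card J \<le> 3 * ((4 * k + 4 * D) div D + 1)" by metis
    have "F \<inter> X i \<subseteq> (\<lambda>(j, s). w j s) ` (J \<times> {..<6})"
    proof
      fix v assume v: "v \<in> F \<inter> X i"
      then obtain j' s where js: "j' < N" "s < 6" "v = w j' s" unfolding F_def by auto
      have "near n (k + D) (j * D) v" using X_near[OF _ j_def[symmetric] j] v by blast
      moreover have "near n D v (j' * D)" using w(4)[OF js(1,2)] js(3) by (intro near_same[of _ j']) auto
      ultimately have "near n (k + D + D) (j * D) (j' * D)" by (rule near_trans)
      then have "near n (2 * k + 2 * D) (j * D) (j' * D)" by (rule near_mono) simp
      then show "v \<in> (\<lambda>(j, s). w j s) ` (J \<times> {..<6})" using js unfolding J_def by auto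
    qed
    then have "card (F \<inter> X i) \<le> card (J \<times> {..<6::nat})"
      using finJ by (intro surj_card_le) auto
    then have c1: "card (F \<inter> X i) \<le> card J * 6" by (simp add: card_cartesian_product)
    have "{i'. i' < 5 * N \<and> X i' \<inter> X i \<noteq> {}} \<subseteq> (\<lambda>(j, t). 5 * j + t) ` (J \<times> {..<5})"
    proof
      fix i' assume i': "i' \<in> {i'. i' < 5 * N \<and> X i' \<inter> X i \<noteq> {}}"
      define j' where "j' = i' div 5"
      have j': "j' < N" using i' unfolding j'_def by (simp add: less_mult_imp_div_less mult.commute)
      obtain v where v: "v \<in> X i'" "v \<in> X i" using i' by blast
      have "near n (k + D) (j * D) v" "near n (k + D) v (j' * D)"
        using X_near[OF v(2) j_def[symmetric] j] X_near[OF v(1) j'_def[symmetric] j'] near_sym by blast+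
      then have "near n ((k + D) + (k + D)) (j * D) (j' * D)" by (rule near_trans)
      then have "near n (2 * k + 2 * D) (j * D) (j' * D)" by (rule near_mono) simp
      then have "j' \<in> J" using j' unfolding J_def by simp
      moreover have "i' = 5 * j' + i' mod 5" "i' mod 5 < 5" unfolding j'_def by simp_all
      ultimately show "i' \<in> (\<lambda>(j, t). 5 * j + t) ` (J \<times> {..<5})" by (intro image_eqI[of _ _ "(j', i' mod 5)"]) auto
    qed
    then have "card {i'. i' < 5 * N \<and> X i' \<inter> X i \<noteq> {}} \<le> card (J \<times> {..<5::nat})"
      using finJ by (intro surj_card_le) auto
    then have c2: "card {i'. i' < 5 * N \<and> X i' \<inter> X i \<noteq> {}} \<le> card J * 5" by (simp add: card_cartesian_product)
    have "real ((4 * k + 4 * D) div D) \<le> real (4 * k + 4 * D) / D" by (rule of_nat_div_le_of_nat)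
    then have "33 * (real ((4 * k + 4 * D) div D) + 1) \<le> 33 * (real (4 * k + 4 * D) / D + 1)"
      by (intro mult_left_mono add_right_mono) (assumption, simp)
    then have "real (33 * ((4 * k + 4 * D) div D + 1)) \<le> 33 * (real (4 * k + 4 * D) / D + 1)" by (simp only: of_nat_mult of_nat_add of_nat_numeral of_nat_1)
    also have "\<dots> < card (X i)" using conf cardX[OF i] by linarith
    finally have "33 * ((4 * k + 4 * D) div D + 1) < card (X i)" by (simp only: of_nat_less_iff)
    then show ?thesis using c1 c2 cardJ by linarith
  qed
  obtain f where f: "inj_on f {..<5 * N}" "\<And>i. i < 5 * N \<Longrightarrow> f i \<in> X i - F"
    using greedy_distinct_choice[OF finF finX choice] by blast
  define base where "base j s = (if s < 6 then w j s else f (5 * j + (s - 6)))" for j s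
  have f_idx: "5 * j + (s - 6) < 5 * N" if "j < N" "s < 11" "\<not> s < 6" for j s :: nat using that by linarith
  have base_inj: "j = j' \<and> s = s'"
    if "j < N" "s < 11" "j' < N" "s' < 11" "base j s = base j' s'" for j s j' s'
  proof -
    have mixed: False if "j < N" "s < 6" "j' < N" "s' < 11" "\<not> s' < 6" "w j s = f (5 * j' + (s' - 6))" for j s j' s'
    proof -
      have "w j s \<in> F" using that(1,2) unfolding F_def by auto
      then show False using f(2)[OF f_idx[OF that(3-5)]] that(6) by simp
    qed
    show ?thesis
    proof (cases "s < 6"; cases "s' < 6")
      assume s: "s < 6" "s' < 6"
      then have eq: "w j s = w j' s'" using that(5) unfolding base_def by simp
      have "w j s div D = j" "w j' s' div D = j'"
        using w(4)[OF that(1) s(1)] w(4)[OF that(3) s(2)] D0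
        by (auto intro!: div_nat_eqI simp: mult.commute)
      then have "j = j'" using eq by simp
      then show ?thesis using inj_onD[OF w(1)[OF that(1)]] eq s by simp
    next
      assume s: "\<not> s < 6" "\<not> s' < 6"
      then have "f (5 * j + (s - 6)) = f (5 * j' + (s' - 6))" using that(5) unfolding base_def by simp
      then have eq: "5 * j + (s - 6) = 5 * j' + (s' - 6)"
        using inj_onD[OF f(1)] f_idx[OF that(1,2) s(1)] f_idx[OF that(3,4) s(2)] by simp
      have "(5 * j + (s - 6)) div 5 = j" "(5 * j' + (s' - 6)) div 5 = j'" using that(2,4) by simp_all
      then have "j = j'" using eq by simp
      then show ?thesis using eq s by simp
    next
      assume s: "s < 6" "\<not> s' < 6"
      then show ?thesis using mixed[OF that(1) s(1) that(3,4) s(2)] that(5) unfolding base_def by simp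
    next
      assume s: "\<not> s < 6" "s' < 6"
      then show ?thesis using mixed[OF that(3) s(2) that(1,2) s(1)] that(5) unfolding base_def by simp
    qed
  qed
  define own where "own j t = (if t \<in> {2, 3, 4} then pred j else j)" for j t :: nat
  have own: "own j t < N" if "j < N" for j t using that pred unfolding own_def by simp
  define q where "q j t = base (own j t) (path_code t)" for j t
  have base_in: "base j s < n \<and> near n (k + D) (j * D) (base j s)" if "j < N" "s < 11" for j s
  proof (cases "s < 6")
    case True
    have "near n D (j * D) (w j s)" using w(4)[OF that(1) True] by (intro near_same[of _ j]) auto
    then have "near n (k + D) (j * D) (w j s)" by (rule near_mono) simp
    then show ?thesis using True w_lt[OF that(1) True] unfolding base_def by simp
  next
    case False
    have "(5 * j + (s - 6)) div 5 = j" using that(2) False by simp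
    moreover have "f (5 * j + (s - 6)) \<in> X (5 * j + (s - 6))" using f(2)[OF f_idx[OF that False]] by blast
    ultimately have "f (5 * j + (s - 6)) < n \<and> near n (k + D) (j * D) (f (5 * j + (s - 6)))"
      by (intro X_near that(1))
    then show ?thesis using False unfolding base_def by (simp only: if_False)
  qed
  have f_adj:
    "adj (w j 0) (f (5 * j))" "adj (w (pred j) 4) (f (5 * j))"
    "adj (w (pred j) 5) (f (5 * j + 1))" "adj (w j 2) (f (5 * j + 1))"
    "adj (w j 3) (f (5 * j + 2))" "adj (w j 1) (f (5 * j + 2))"
    "adj (w j 2) (f (5 * j + 3)) \<and> adj (w j 3) (f (5 * j + 3)) \<and> adj (w j 4) (f (5 * j + 3)) \<and> adj (w j 5) (f (5 * j + 3))"
    "adj (w j 2) (f (5 * j + 4)) \<and> adj (w j 3) (f (5 * j + 4)) \<and> adj (w j 4) (f (5 * j + 4)) \<and> adj (w j 5) (f (5 * j + 4))"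
    if j: "j < N" for j
  proof -
    have idx: "5 * j < 5 * N" "5 * j + 1 < 5 * N" "5 * j + 2 < 5 * N" "5 * j + 3 < 5 * N" "5 * j + 4 < 5 * N"
      using j by linarith+
    have "(5 * j + 1) mod 5 = 1" "(5 * j + 2) mod 5 = 2" "(5 * j + 3) mod 5 = 3" "(5 * j + 4) mod 5 = 4"
      "(5 * j + 1) div 5 = j" "(5 * j + 2) div 5 = j" "(5 * j + 3) div 5 = j" "(5 * j + 4) div 5 = j"
      by (presburger+)
    then show "adj (w j 0) (f (5 * j))" "adj (w (pred j) 4) (f (5 * j))"
      "adj (w (pred j) 5) (f (5 * j + 1))" "adj (w j 2) (f (5 * j + 1))"
      "adj (w j 3) (f (5 * j + 2))" "adj (w j 1) (f (5 * j + 2))"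
      "adj (w j 2) (f (5 * j + 3)) \<and> adj (w j 3) (f (5 * j + 3)) \<and> adj (w j 4) (f (5 * j + 3)) \<and> adj (w j 5) (f (5 * j + 3))"
      "adj (w j 2) (f (5 * j + 4)) \<and> adj (w j 3) (f (5 * j + 4)) \<and> adj (w j 4) (f (5 * j + 4)) \<and> adj (w j 5) (f (5 * j + 4))"
      using f(2)[OF idx(1)] f(2)[OF idx(2)] f(2)[OF idx(3)] f(2)[OF idx(4)] f(2)[OF idx(5)]
      unfolding X_def Let_def by simp_all
  qed
  have q_simps: "q j 0 = w j 0" "q j 1 = f (5 * j)" "q j 2 = w (pred j) 4" "q j 3 = f (5 * pred j + 4)"
    "q j 4 = w (pred j) 5" "q j 5 = f (5 * j + 1)" "q j 6 = w j 2" "q j 7 = f (5 * j + 3)" "q j 8 = w j 3"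
    "q j 9 = f (5 * j + 2)" "q j 10 = w j 1" for j
    unfolding q_def own_def base_def path_code_simps by simp_all
  show ?thesis
  proof (intro exI[of _ q] conjI allI impI)
    show "inj_on (\<lambda>(j, t). q j t) ({..<N} \<times> {..<11})"
    proof (rule inj_onI)
      fix a b assume ab: "a \<in> {..<N} \<times> {..<11::nat}" "b \<in> {..<N} \<times> {..<11::nat}"
        "(\<lambda>(j, t). q j t) a = (\<lambda>(j, t). q j t) b"
      obtain j t j' t' where eqs: "a = (j, t)" "b = (j', t')" by (metis surj_pair)
      then have jt: "j < N" "t < 11" "j' < N" "t' < 11" and *: "q j t = q j' t'" using ab by simp_all
      have "own j t = own j' t' \<and> path_code t = path_code t'"
        by (rule base_inj[OF own[OF jt(1)] path_code_less[OF jt(2)] own[OF jt(3)] path_code_less[OF jt(4)] *[unfolded q_def]])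
      then have "t = t'" "own j t = own j' t" using path_code_inj[OF jt(2,4)] by auto
      then show "a = b" using pred_inj[OF jt(1,3)] unfolding own_def eqs by (simp split: if_splits)
    qed
  next
    fix j t :: nat assume jt: "j < N" "t < 11"
    show "q j t < n" unfolding q_def using base_in[OF own[OF jt(1)] path_code_less[OF jt(2)]] by blast
    have "near n (2 * D) (j * D) (own j t * D)"
    proof (cases "own j t = j")
      case False
      then have pj: "own j t = pred j" unfolding own_def by (simp split: if_splits)
      show ?thesis
      proof (cases j)
        case 0
        have "(N - 1) * D + D = N * D" using N(2) by (cases N) auto
        then have eq: "int ((N - 1) * D) = int (N * D) - int D" by linarith
        have "\<bar>int ((N - 1) * D) - int n\<bar> \<le> int (2 * D)" using ND eq by linarith
        moreover have "int n dvd int ((N - 1) * D) - int (0 * D) - (int ((N - 1) * D) - int n)" by simp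
        ultimately have "near n (2 * D) (0 * D) ((N - 1) * D)" unfolding near_def by blast
        then show ?thesis unfolding pj using 0 unfolding pred_def by simp
      next
        case (Suc i)
        then show ?thesis unfolding pj pred_def by (intro near_of_abs_diff) simp
      qed
    qed simp
    moreover have "near n (k + D) (own j t * D) (q j t)"
      unfolding q_def using base_in[OF own[OF jt(1)] path_code_less[OF jt(2)]] by blast
    ultimately have "near n (2 * D + (k + D)) (j * D) (q j t)" by (rule near_trans)
    then show "near n (k + 3 * D) (j * D) (q j t)" by (rule near_mono) simp
  next
    fix j t :: nat assume j: "j < N" and t: "t < 10"
    note fa = f_adj[OF j] f_adj(7,8)[OF pred[OF j]]
    have "adj (q j 0) (q j 1)" "adj (q j 1) (q j 2)" "adj (q j 2) (q j 3)" "adj (q j 3) (q j 4)"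
      "adj (q j 4) (q j 5)" "adj (q j 5) (q j 6)" "adj (q j 6) (q j 7)" "adj (q j 7) (q j 8)"
      "adj (q j 8) (q j 9)" "adj (q j 9) (q j 10)"
      unfolding q_simps using fa adj_sym by blast+
    then have all: "\<forall>t<10. adj (q j t) (q j (Suc t))"
      by (auto simp: eval_nat_numeral less_Suc_eq)
    show "adj (q j t) (q j (Suc t))" using all t by simp
  next
    fix j assume j: "j < N"
    show "q j 0 = p j" using w(2)[OF j] q_simps(1)[of j] by simp
    show "q j 10 = r j" using w(3)[OF j] q_simps(11)[of j] by simp
  next
    fix j assume j: "Suc j < N"
    have "pred (Suc j) = j" unfolding pred_def by simp
    then show "adj (q j 6) (q (Suc j) 3)" "adj (q (Suc j) 2) (q j 7)"
      using f_adj(7,8)[of j] j unfolding q_simps by simp_all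
  qed
qed

end

section \<open>Layers\<close>

lemma downset_eq_lessThan:
  fixes S :: "nat set"
  assumes "finite S" "\<And>a b. a \<in> S \<Longrightarrow> b < a \<Longrightarrow> b \<in> S"
  shows "S = {..<card S}"
proof (cases "S = {}")
  case False
  have "S = {..Max S}"
  proof (intro equalityI subsetI)
    fix a assume "a \<in> {..Max S}"
    then show "a \<in> S" using assms(2)[OF Max_in[OF assms(1) False], of a] Max_in[OF assms(1) False]
      by (cases "a = Max S") auto
  qed (use assms(1) in auto)
  then have "S = {..<Suc (Max S)}" by (simp add: lessThan_Suc_atMost)
  then show ?thesis by (metis card_lessThan)
qed simp

text \<open>Each group of \<open>M\<close> consecutive terms is rotated by its own offset, so that
  for a strictly increasing \<open>e\<close> the transversals with \<open>i < M\<close> partition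
  the first \<open>N * M\<close> terms, whatever \<open>s\<close> is.\<close>

definition transversal :: "(nat \<Rightarrow> nat) \<Rightarrow> (nat \<Rightarrow> nat) \<Rightarrow> nat \<Rightarrow> nat \<Rightarrow> nat \<Rightarrow> nat set" where
  "transversal e s M N i = (\<lambda>j. e (j * M + (i + s j) mod M)) ` {..<N}"

lemma group_index_eqD:
  fixes a b :: nat
  assumes "j * M + a = j' * M + b" "a < M" "b < M"
  shows "j = j' \<and> a = b"
proof -
  have "(j * M + a) div M = j" "(j' * M + b) div M = j'" using assms(2,3) by simp_all
  then show ?thesis using assms(1) by auto
qed

lemma group_index_less:
  fixes a :: nat
  assumes "j < N" "a < M"
  shows "j * M + a < N * M"
proof -
  have "j * M + a < Suc j * M" using assms(2) by simp
  also have "\<dots> \<le> N * M" using assms(1) by (intro mult_le_mono1) simp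
  finally show ?thesis .
qed

lemma inj_on_transversal:
  fixes e :: "nat \<Rightarrow> nat"
  assumes "strict_mono e" "M > 0"
  shows "inj_on (\<lambda>j. e (j * M + (i + s j) mod M)) A"
proof (rule inj_onI)
  fix j j' assume "e (j * M + (i + s j) mod M) = e (j' * M + (i + s j') mod M)"
  then have "j * M + (i + s j) mod M = j' * M + (i + s j') mod M"
    using strict_mono_eq[OF assms(1)] by blast
  then show "j = j'" using group_index_eqD assms(2) mod_less_divisor by blast
qed

lemma card_transversal: "strict_mono e \<Longrightarrow> M > 0 \<Longrightarrow> card (transversal e s M N i) = N"
  unfolding transversal_def by (simp add: card_image inj_on_transversal)

lemma transversal_disjoint:
  assumes "strict_mono e" "i < M" "i' < M" "i \<noteq> i'"
  shows "transversal e s M N i \<inter> transversal e s M N i' = {}"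
proof (rule equals0I)
  fix v assume "v \<in> transversal e s M N i \<inter> transversal e s M N i'"
  then obtain j j' where v: "v = e (j * M + (i + s j) mod M)" "v = e (j' * M + (i' + s j') mod M)"
    unfolding transversal_def by blast
  then have "j * M + (i + s j) mod M = j' * M + (i' + s j') mod M"
    using strict_mono_eq[OF assms(1)] by metis
  moreover have "(i + s j) mod M < M" "(i' + s j') mod M < M" using assms(2) by simp_all
  ultimately have "j = j' \<and> (i + s j) mod M = (i' + s j') mod M" by (rule group_index_eqD)
  then have "(s j + i) mod M = (s j + i') mod M" by (metis add.commute)
  then show False
    using inj_onD[OF bij_betw_imp_inj_on[OF bij_betw_shift_mod[of M "s j"]], of i i'] assms(2-4) by simp
qed

lemma UN_transversal:
  assumes "M > 0"
  shows "(\<Union>i<M. transversal e s M N i) = e ` {..<N * M}"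
proof (intro equalityI subsetI)
  fix v assume "v \<in> (\<Union>i<M. transversal e s M N i)"
  then obtain i j where j: "j < N" "v = e (j * M + (i + s j) mod M)" unfolding transversal_def by blast
  have "j * M + (i + s j) mod M < N * M" using assms by (intro group_index_less[OF j(1)]) simp
  then show "v \<in> e ` {..<N * M}" using j(2) by simp
next
  fix v assume "v \<in> e ` {..<N * M}"
  then obtain m where m: "m < N * M" "v = e m" by blast
  have "m mod M \<in> (\<lambda>h. (s (m div M) + h) mod M) ` {..<M}"
    using bij_betw_imp_surj_on[OF bij_betw_shift_mod[OF assms, of "s (m div M)"]] assms by simp
  then obtain i where i: "i < M" "m mod M = (s (m div M) + i) mod M" by auto
  then have "m div M * M + (i + s (m div M)) mod M = m" by (metis add.commute div_mult_mod_eq)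
  then have "v = e (m div M * M + (i + s (m div M)) mod M)" using m(2) by simp
  moreover have "m div M < N" using m(1) by (simp add: less_mult_imp_div_less)
  ultimately show "v \<in> (\<Union>i<M. transversal e s M N i)" using i(1) unfolding transversal_def by blast
qed

text \<open>The terms below \<open>x\<close> form an initial segment: whole groups and at most one
  partial group. Each whole group contributes exactly one element and the partial one at most
  one.\<close>

lemma transversal_equidistributed:
  assumes e: "strict_mono e" and M: "M > 0"
  shows "\<bar>real M * card (transversal e s M N i \<inter> {..<x}) - card {m. m < N * M \<and> e m < x}\<bar> \<le> M"
proof -
  define u where "u = card {m. m < N * M \<and> e m < x}"
  have "{m. m < N * M \<and> e m < x} = {..<u}"
    unfolding u_def using e by (intro downset_eq_lessThan) (auto simp: strict_mono_def dest: order.strict_trans)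
  then have u: "m < N * M \<and> e m < x \<longleftrightarrow> m < u" for m by auto
  define J where "J = {j. j < N \<and> e (j * M + (i + s j) mod M) < x}"
  have "transversal e s M N i \<inter> {..<x} = (\<lambda>j. e (j * M + (i + s j) mod M)) ` J"
    unfolding transversal_def J_def by auto
  then have card: "card (transversal e s M N i \<inter> {..<x}) = card J"
    by (simp add: card_image inj_on_transversal[OF e M])
  have finJ: "finite J" unfolding J_def by simp
  have "{..<u div M} \<subseteq> J"
  proof
    fix j assume "j \<in> {..<u div M}"
    then have "Suc j \<le> u div M" by simp
    then have "Suc j * M \<le> u" using M by (metis div_times_less_eq_dividend mult_le_mono1 order_trans)
    moreover have "(i + s j) mod M < M" using M by simp
    ultimately have *: "j * M + (i + s j) mod M < u" unfolding mult_Suc by linarith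
    then have "e (j * M + (i + s j) mod M) < x" "j * M + (i + s j) mod M < N * M" using u by blast+
    moreover from this(2) have "j * M < N * M" by linarith
    then have "j < N" by simp
    ultimately show "j \<in> J" unfolding J_def by simp
  qed
  then have "u div M \<le> card J" using card_mono[OF finJ, of "{..<u div M}"] by simp
  moreover have "u < (u div M + 1) * M" using dividend_less_div_times[OF M, of u] by (simp add: mult.commute)
  ultimately have lower: "u < (card J + 1) * M" by (meson add_le_mono1 mult_le_mono1 order_less_le_trans)
  have "J \<subseteq> {..<(u + M - 1) div M}"
  proof
    fix j assume j: "j \<in> J"
    have "j * M + (i + s j) mod M < N * M"
      using j M unfolding J_def by (intro group_index_less) simp_all
    then have "j * M + (i + s j) mod M < u" using u j unfolding J_def by blast
    then have "Suc j * M \<le> u + M - 1" by (simp only: mult_Suc)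
    then show "j \<in> {..<(u + M - 1) div M}"
      using M by (simp add: Suc_le_eq[symmetric] less_eq_div_iff_mult_less_eq)
  qed
  then have "card J \<le> (u + M - 1) div M" using card_mono[of "{..<(u + M - 1) div M}" J] by simp
  then have "card J * M \<le> (u + M - 1) div M * M" by (rule mult_le_mono1)
  also have "\<dots> \<le> u + M - 1" by (rule div_times_less_eq_dividend)
  finally have upper: "card J * M \<le> u + M" by simp
  have "real u < real ((card J + 1) * M)" using lower by (simp only: of_nat_less_iff)
  moreover have "real (card J * M) \<le> real (u + M)" using upper by (simp only: of_nat_le_iff)
  ultimately show ?thesis unfolding card u_def[symmetric] by (simp add: abs_le_iff algebra_simps)
qed

text \<open>Beyond \<open>U\<close> the sequence continues through the numbers from \<open>n\<close>
  on. It is then strictly increasing on all natural numbers, as \<open>local_transversals\<close>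
  requires, and the additional values lie in no window.\<close>

lemma ex_strict_mono_enumeration:
  fixes U :: "nat set"
  assumes U: "U \<subseteq> {..<n}"
  shows "\<exists>e. strict_mono e \<and> e ` {..<card U} = U \<and> (\<forall>m. e m < n \<longleftrightarrow> m < card U)"
proof -
  let ?W = "U \<union> {n..}"
  have inf: "infinite ?W" by (simp add: infinite_Ici)
  define e where "e = enumerate ?W"
  have e: "strict_mono e" unfolding e_def by (rule strict_mono_enumerate[OF inf])
  have range: "range e = ?W" unfolding e_def by (rule range_enumerate[OF inf])
  have eU: "e ` {m. e m < n} = U"
  proof (intro equalityI subsetI)
    fix v assume "v \<in> U"
    moreover then obtain m where "v = e m" using range by blast
    ultimately show "v \<in> e ` {m. e m < n}" using U by auto
  next
    fix v assume "v \<in> e ` {m. e m < n}"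
    then show "v \<in> U" using range by (metis (no_types, lifting) UnE atLeast_iff image_iff linorder_not_le mem_Collect_eq rangeI)
  qed
  have fin: "finite {m. e m < n}"
    by (rule finite_subset[of _ "{..<n}"]) (use strict_mono_imp_increasing[OF e] order_le_less_trans in auto)
  have "inj_on e {m. e m < n}" using strict_mono_imp_inj_on[OF e] inj_on_subset by blast
  then have "card {m. e m < n} = card U" using eU card_image by metis
  moreover have "{m. e m < n} = {..<card {m. e m < n}}"
    using fin e by (intro downset_eq_lessThan) (auto simp: strict_mono_def dest: order.strict_trans)
  ultimately have eq: "{m. e m < n} = {..<card U}" by simp
  have "\<forall>m. e m < n \<longleftrightarrow> m < card U" using eq by blast
  then show ?thesis using e eU unfolding eq by (intro exI[of _ e] conjI)
qed

text \<open>Displacing points by at most \<open>K\<close> affects the count only for those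
  \<open>j\<close> whose multiple \<open>j * D\<close> is within about \<open>K\<close> of
  \<open>x\<close> or of the seam at \<open>0\<close>. There are about \<open>K / D\<close> of them
  on either side, with \<open>c\<close> points each.\<close>

lemma card_clustered_upto:
  fixes q :: "nat \<Rightarrow> nat \<Rightarrow> nat"
  assumes D: "D > 0" and N: "N = n div D" and K: "K \<le> n" and x: "x \<le> n"
    and inj: "inj_on (\<lambda>(j, t). q j t) ({..<N} \<times> {..<c})"
    and q: "\<And>j t. j < N \<Longrightarrow> t < c \<Longrightarrow> q j t < n \<and> near n K (j * D) (q j t)"
  shows "\<bar>real D * card ((\<lambda>(j, t). q j t) ` ({..<N} \<times> {..<c}) \<inter> {..<x}) - real c * x\<bar> \<le> 2 * real c * (K + D)"
proof -
  define I where "I = (\<lambda>(j, t). q j t) ` ({..<N} \<times> {..<c})"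
  have finI: "finite (I \<inter> {..<x})" by simp
  have ND: "j < N \<Longrightarrow> j * D < n" for j
  proof -
    assume "j < N"
    then have "Suc j * D \<le> N * D" by (intro mult_le_mono1) simp
    also have "\<dots> \<le> n" unfolding N by (rule div_times_less_eq_dividend)
    finally show "j * D < n" using D by simp
  qed
  have cases: "\<bar>int (q j t) - int (j * D)\<bar> \<le> int K \<or> \<bar>int (q j t) - int (j * D) - int n\<bar> \<le> int K
      \<or> \<bar>int (q j t) - int (j * D) + int n\<bar> \<le> int K" if "j < N" "t < c" for j t
    using q[OF that] ND[OF that(1)] K by (intro near_cases) auto
  have lower: "real c * (real x - 2 * K - 2 * D) \<le> real D * card (I \<inter> {..<x})"
  proof (cases "K \<le> x")
    case True
    \<comment> \<open>A multiple beyond \<open>K\<close> cannot be displaced backwards across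
      \<open>0\<close> to the far end, and one below \<open>x - K\<close> stays below
      \<open>x\<close>.\<close>
    define a b where "a = K div D + 1" and "b = (x - K) div D"
    have in_I: "q j t \<in> I \<inter> {..<x}" if "j \<in> {a..<b}" "t < c" for j t
    proof -
      have "Suc j * D \<le> b * D" using that(1) by (intro mult_le_mono1) simp
      also have "\<dots> \<le> x - K" unfolding b_def by (rule div_times_less_eq_dividend)
      finally have jb: "j * D + D + K \<le> x" using True by simp
      have "K < (K div D + 1) * D" using dividend_less_div_times[OF D, of K] by simp
      also have "\<dots> \<le> j * D" using that(1) unfolding a_def by (intro mult_le_mono1) simp
      finally have ja: "K < j * D" .
      have "Suc j * D \<le> n" using jb x by simp
      then have jN: "j < N" unfolding N using D by (simp add: Suc_le_eq[symmetric] less_eq_div_iff_mult_less_eq)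
      have "int (j * D) + int D + int K \<le> int x" "int K < int (j * D)" "int x \<le> int n" "int (q j t) < int n" "0 < int D"
        using ja jb x q[OF jN that(2)] D by linarith+
      then have "int (q j t) < int x" using cases[OF jN that(2)] by linarith
      then show ?thesis using jN that(2) unfolding I_def by auto
    qed
    have jN: "j < N" if "j \<in> {a..<b}" for j
    proof -
      have "b \<le> n div D" unfolding b_def using x by (intro div_le_mono) simp
      then show ?thesis using that unfolding N by simp
    qed
    have "card ((\<lambda>(j, t). q j t) ` ({a..<b} \<times> {..<c})) = card ({a..<b} \<times> {..<c})"
      using jN by (intro card_image inj_on_subset[OF inj]) auto
    moreover have "(\<lambda>(j, t). q j t) ` ({a..<b} \<times> {..<c}) \<subseteq> I \<inter> {..<x}"
    proof (rule image_subsetI)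
      fix z assume "z \<in> {a..<b} \<times> {..<c}"
      then show "(\<lambda>(j, t). q j t) z \<in> I \<inter> {..<x}" using in_I by (cases z) simp
    qed
    then have "card ((\<lambda>(j, t). q j t) ` ({a..<b} \<times> {..<c})) \<le> card (I \<inter> {..<x})"
      by (rule card_mono[OF finI])
    ultimately have "(b - a) * c \<le> card (I \<inter> {..<x})" by (simp add: card_cartesian_product)
    then have "D * ((b - a) * c) \<le> D * card (I \<inter> {..<x})" by (rule mult_le_mono2)
    then have *: "real (D * ((b - a) * c)) \<le> real (D * card (I \<inter> {..<x}))" by (simp only: of_nat_le_iff)
    have "x - K < b * D + D" unfolding b_def using dividend_less_div_times[OF D, of "x - K"] by (simp add: algebra_simps)
    then have b: "real x - K - D \<le> real b * D"
      using True by (simp flip: of_nat_mult of_nat_add of_nat_diff)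
    have "a * D \<le> K + D" unfolding a_def by (simp add: div_times_less_eq_dividend)
    then have a: "real a * D \<le> K + D" by (simp flip: of_nat_mult of_nat_add)
    have "real x - 2 * K - 2 * D \<le> real D * real (b - a)"
    proof -
      have "(real b - real a) * D \<le> real (b - a) * D" by (intro mult_right_mono) auto
      then show ?thesis using a b by (simp add: algebra_simps)
    qed
    then have "real c * (real x - 2 * K - 2 * D) \<le> real c * (real D * real (b - a))" by (intro mult_left_mono) auto
    also have "\<dots> = real (D * ((b - a) * c))" by (simp only: of_nat_mult mult_ac)
    finally show ?thesis using * by simp
  next
    case False
    then have "real c * (real x - 2 * K - 2 * D) \<le> 0" by (intro mult_nonneg_nonpos) auto
    also have "0 \<le> real D * card (I \<inter> {..<x})" by simp
    finally show ?thesis .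
  qed
  have upper: "real D * card (I \<inter> {..<x}) \<le> real c * (real x + 2 * K + 2 * D)"
  proof -
    let ?J1 = "{j. 0 \<le> int (j * D) \<and> int (j * D) \<le> 0 + int (x + K)}"
    \<comment> \<open>Points may fall below \<open>x\<close> although their multiple is near
      \<open>n\<close>, by crossing the seam.\<close>
    let ?J2 = "{j. int (n - K) \<le> int (j * D) \<and> int (j * D) \<le> int (n - K) + int K}"
    have finJ: "finite ?J1" "finite ?J2"
      using card_multiples_interval_le(1)[OF D, of 0 "x + K"] card_multiples_interval_le(1)[OF D, of "int (n - K)" K] by simp_all
    have J: "card ?J1 \<le> (x + K) div D + 1" "card ?J2 \<le> K div D + 1"
      using card_multiples_interval_le(2)[OF D, of 0 "x + K"] card_multiples_interval_le(2)[OF D, of "int (n - K)" K] by simp_all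
    have "I \<inter> {..<x} \<subseteq> (\<lambda>(j, t). q j t) ` ((?J1 \<union> ?J2) \<times> {..<c})"
    proof
      fix v assume v: "v \<in> I \<inter> {..<x}"
      then obtain j t where jt: "j < N" "t < c" "v = q j t" unfolding I_def by auto
      have "int v < int x" "int (n - K) = int n - int K" "int v < int n"
        using v K x by auto
      moreover have "int (j * D) < int n" using ND[OF jt(1)] by (simp only: of_nat_less_iff)
      ultimately have "j \<in> ?J1 \<union> ?J2" using cases[OF jt(1,2)] jt(3) by auto
      then show "v \<in> (\<lambda>(j, t). q j t) ` ((?J1 \<union> ?J2) \<times> {..<c})" using jt by auto
    qed
    then have "card (I \<inter> {..<x}) \<le> card ((?J1 \<union> ?J2) \<times> {..<c})"
      using finJ by (intro surj_card_le) simp_all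
    also have "\<dots> = card (?J1 \<union> ?J2) * c" by (simp add: card_cartesian_product)
    also have "\<dots> \<le> ((x + K) div D + 1 + (K div D + 1)) * c"
      using J card_Un_le[of ?J1 ?J2] by (intro mult_le_mono1) linarith
    finally have "D * card (I \<inter> {..<x}) \<le> D * (((x + K) div D + 1 + (K div D + 1)) * c)" by (rule mult_le_mono2)
    also have "\<dots> = ((x + K) div D * D + D + (K div D * D + D)) * c" by (simp add: algebra_simps)
    also have "\<dots> \<le> (x + K + D + (K + D)) * c"
      by (intro mult_le_mono1 add_mono div_times_less_eq_dividend order_refl)
    finally have "real (D * card (I \<inter> {..<x})) \<le> real ((x + K + D + (K + D)) * c)" by (simp only: of_nat_le_iff)
    then show ?thesis by (simp add: algebra_simps)
  qed
  show ?thesis using lower upper unfolding I_def[symmetric] by (simp add: abs_le_iff algebra_simps)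
qed

section \<open>Evenly spread layers and the assembly of the cycle\<close>

context dense_window_graph
begin

text \<open>Here \<open>D\<close> is the mean gap and \<open>e\<close> the discrepancy, measured in
  positions rather than in elements.\<close>

definition equidistributed :: "real \<Rightarrow> real \<Rightarrow> nat set \<Rightarrow> bool" where
  "equidistributed D e A \<longleftrightarrow> A \<subseteq> {..<n} \<and> (\<forall>x\<le>n. \<bar>D * card (A \<inter> {..<x}) - x\<bar> \<le> e)"

text \<open>A relation \<open>R\<close> replaces \<open>adj\<close> because the closing matching has
  to exclude edges inside the set of leftover vertices.\<close>

lemma equidistributed_matching:
  fixes R :: "nat \<Rightarrow> nat \<Rightarrow> bool"
  assumes A: "equidistributed D e A" and B: "equidistributed D e B" and card: "card A = card B"
    and D: "D > 0" and h: "D * (real h + 1) + 3 * e \<le> real k + 1"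
    and nA: "\<And>v. v \<in> B \<Longrightarrow> card {u \<in> A. near n k v u \<and> \<not> R u v} \<le> h"
    and nB: "\<And>u. u \<in> A \<Longrightarrow> card {v \<in> B. near n k u v \<and> \<not> R u v} \<le> h"
  shows "\<exists>f. bij_betw f A B \<and> (\<forall>u\<in>A. R u (f u))"
proof -
  have sub: "A \<subseteq> {..<n}" "B \<subseteq> {..<n}" using A B unfolding equidistributed_def by auto
  have eq: "\<And>x. x \<le> n \<Longrightarrow> \<bar>D * card (A \<inter> {..<x}) - x\<bar> \<le> e" "\<And>x. x \<le> n \<Longrightarrow> \<bar>D * card (B \<inter> {..<x}) - x\<bar> \<le> e"
    using A B unfolding equidistributed_def by auto
  show ?thesis
    by (rule layer_matching[OF n sub card cnt_add_le_of_equidistributed[OF n sub card D eq h]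
          cnt_add_le_of_equidistributed[OF n sub(2,1) card[symmetric] D eq(2,1) h] nA nB])
qed

lemma transversals_few_nonnbrs:
  fixes e :: "nat \<Rightarrow> nat" and \<delta> :: real
  assumes e: "strict_mono e" and k: "k > 0" and M: "M \<ge> 3" and \<delta>: "0 < \<delta>" "\<delta> \<le> 1"
  shows "\<exists>s. \<forall>i<M. \<forall>v<n. (1 - \<delta>) * card (transversal e s M N i \<inter> nonnbr v)
      \<le> ((1 - \<epsilon>) * k + 1) / M + 6 * (ln (real (k * M * (2 * k + 1) * M)) / \<delta>)"
proof -
  have "nonnbr c \<subseteq> {v. v < n \<and> near n k c v}" for c unfolding nonnbr_def by auto
  then obtain s where s: "\<forall>c<n. \<forall>i<M. (1 - \<delta>) * card {j. e (j * M + (i + s j) mod M) \<in> nonnbr c}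
      \<le> card (nonnbr c) / M + 6 * (ln (real (k * M * (2 * k + 1) * M)) / \<delta>)"
    using local_transversals[OF e n k M \<delta>, of nonnbr] by blast
  show ?thesis
  proof (intro exI[of _ s] allI impI)
    fix i v assume i: "i < M" and v: "v < n"
    let ?g = "\<lambda>j. e (j * M + (i + s j) mod M)"
    have inj: "inj ?g" using M by (intro inj_on_transversal[OF e]) simp
    have "finite (nonnbr v)" unfolding nonnbr_def by simp
    then have fin: "finite {j. ?g j \<in> nonnbr v}" using inj by (metis finite_vimageI vimage_def)
    have "transversal e s M N i \<inter> nonnbr v \<subseteq> ?g ` {j. ?g j \<in> nonnbr v}" unfolding transversal_def by auto
    then have "card (transversal e s M N i \<inter> nonnbr v) \<le> card {j. ?g j \<in> nonnbr v}"
      by (rule surj_card_le[OF fin])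
    then have "(1 - \<delta>) * card (transversal e s M N i \<inter> nonnbr v) \<le> (1 - \<delta>) * card {j. ?g j \<in> nonnbr v}"
      using \<delta> by (intro mult_left_mono) auto
    also have "\<dots> \<le> card (nonnbr v) / M + 6 * (ln (real (k * M * (2 * k + 1) * M)) / \<delta>)"
      using s i v by blast
    also have "card (nonnbr v) / M \<le> ((1 - \<epsilon>) * k + 1) / M"
      using card_nonnbr[OF v] by (intro divide_right_mono) auto
    finally show "(1 - \<delta>) * card (transversal e s M N i \<inter> nonnbr v)
      \<le> ((1 - \<epsilon>) * k + 1) / M + 6 * (ln (real (k * M * (2 * k + 1) * M)) / \<delta>)" by simp
  qed
qed


text \<open>Each numerical hypothesis feeds one step: \<open>conf\<close> the greedy choice of the
  paths, \<open>H(2)\<close> the bound on the nonneighbours of a vertex in a layer, and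
  \<open>bal\<close> the closing matching, whose condition is the strictest because of the leftover
  vertices.\<close>

lemma single_cycle_permutation:
  fixes M D :: nat and \<delta> H :: real
  assumes M: "M \<ge> 3" and D: "D = M + 11" "6 + 6 * D \<le> k" "3 * real D + 1 \<le> \<epsilon> * k"
    and conf: "33 * (real (4 * k + 4 * D) / D + 1) < \<epsilon> * k / 1024"
    and \<delta>: "0 < \<delta>" "\<delta> < 1"
    and H: "H \<ge> 0" "((1 - \<epsilon>) * k + 1) / M + 6 * (ln (real (k * D * (2 * k + 1) * D)) / \<delta>) \<le> (1 - \<delta>) * H"
    and bal: "real D * (H + D + 1) + 3 * (real D + (real D)\<^sup>2 + (real D)\<^sup>2 / M + 22 * (real k + 4 * D) / M) \<le> k + 1"
  shows "\<exists>p z. p permutes {..<n} \<and> (\<forall>u<n. adj u (p u)) \<and> z < n \<and> (\<forall>v<n. v \<in> orbit p z)"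
proof -
  define N where "N = n div D"
  define \<rho> where "\<rho> = n mod D"
  have D0: "D > 0" "D \<ge> 9" "D \<ge> 3" and M0: "M > 0" and k0: "k > 0" using D(1,2) M by simp_all
  have nN: "n = N * D + \<rho>" and \<rho>: "\<rho> < D" unfolding N_def \<rho>_def using D0 by simp_all
  have Dn: "k + 3 * D \<le> n" "D \<le> n" using D(2) n by simp_all
  have N0: "N > 0" unfolding N_def using Dn(2) D0(1) by (simp add: div_greater_zero_iff)
  \<comment> \<open>Discrepancy of a layer: \<open>D\<close> from rounding to groups,
    \<open>(real D)\<^sup>2 / M\<close> from the leftover vertices, and the last term from the
    reserved ones, 11 per path and displaced by up to \<open>k + 3 * D\<close>. In \<open>e1\<close>
    fewer than \<open>D\<close> leftover vertices count with weight \<open>D\<close>.\<close>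
  define e0 where "e0 = real D + (real D)\<^sup>2 / M + 22 * (real k + 4 * D) / M"
  define e1 where "e1 = e0 + (real D)\<^sup>2"
  define h where "h = nat \<lfloor>H\<rfloor>"
  have e0: "2 * real D \<le> e0"
  proof -
    have "real D * M \<le> real D * D" using D(1) by (intro mult_left_mono) auto
    then have "real D \<le> (real D)\<^sup>2 / M" using M0 by (simp add: field_simps power2_eq_square)
    moreover have "0 \<le> 22 * (real k + 4 * D) / M" by simp
    ultimately show ?thesis unfolding e0_def by linarith
  qed
  have hH: "real h \<le> H" unfolding h_def using H(1) by linarith
  have bal1: "real D * (real (h + D) + 1) + 3 * e1 \<le> real k + 1"
  proof -
    have "real D * (real h + D + 1) \<le> real D * (H + D + 1)" using hH by (intro mult_left_mono) auto
    then show ?thesis using bal unfolding e1_def e0_def by (simp add: algebra_simps)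
  qed
  have bal0: "real D * (real h + 1) + 3 * e0 \<le> real k + 1"
  proof -
    have "real D * (real h + 1) + 3 * e0 \<le> real D * (real (h + D) + 1) + 3 * e1"
      unfolding e1_def by (intro add_mono mult_left_mono) auto
    then show ?thesis using bal1 by (rule order_trans)
  qed
  \<comment> \<open>Serves both families of transversals: groups of \<open>D\<close> consecutive
    positions, and groups of \<open>M\<close> unreserved vertices.\<close>
  have few: "X \<le> h"
    if L: "M \<le> L" "L \<le> D" and X: "(1 - \<delta>) * real X \<le> ((1 - \<epsilon>) * k + 1) / L + 6 * (ln (real (k * L * (2 * k + 1) * L)) / \<delta>)"
    for X L
  proof -
    have L0: "L > 0" using L M0 by simp
    have "((1 - \<epsilon>) * k + 1) / L \<le> ((1 - \<epsilon>) * k + 1) / M"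
      using eps L L0 M0 by (intro divide_left_mono) (auto intro!: add_nonneg_nonneg mult_nonneg_nonneg)
    moreover have "ln (real (k * L * (2 * k + 1) * L)) / \<delta> \<le> ln (real (k * D * (2 * k + 1) * D)) / \<delta>"
    proof (intro divide_right_mono ln_mono)
      show "real (k * L * (2 * k + 1) * L) \<le> real (k * D * (2 * k + 1) * D)"
        using L(2) by (intro of_nat_mono mult_le_mono) auto
      have "0 < k * L * (2 * k + 1) * L" using k0 L0 by simp
      then show "0 < real (k * L * (2 * k + 1) * L)" by (simp only: of_nat_0_less_iff)
    qed (use \<delta> in simp)
    ultimately have "(1 - \<delta>) * real X \<le> (1 - \<delta>) * H" using H(2) X by linarith
    then have "real X \<le> H" using \<delta> by simp
    then show "X \<le> h" unfolding h_def by linarith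
  qed
  \<comment> \<open>The ends of the paths are themselves transversals, of the groups of
    \<open>D\<close> consecutive positions. So they are evenly spread and poor in nonneighbours like
    any layer, and both ends of path \<open>j\<close> lie in group \<open>j\<close>.\<close>
  obtain s0 where s0: "\<forall>i<D. \<forall>v<n. (1 - \<delta>) * card (transversal id s0 D N i \<inter> nonnbr v)
      \<le> ((1 - \<epsilon>) * k + 1) / D + 6 * (ln (real (k * D * (2 * k + 1) * D)) / \<delta>)"
    using transversals_few_nonnbrs[of id D \<delta> N] k0 D0 \<delta> by (auto simp: strict_mono_def)
  define p0 where "p0 j = j * D + (0 + s0 j) mod D" for j
  define r0 where "r0 j = j * D + (1 + s0 j) mod D" for j
  have P_eq: "p0 ` {..<N} = transversal id s0 D N 0" and R_eq: "r0 ` {..<N} = transversal id s0 D N 1"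
    unfolding transversal_def p0_def r0_def by simp_all
  have smid: "strict_mono (id :: nat \<Rightarrow> nat)" by (simp add: strict_mono_def)
  have pr: "p0 j \<in> {j * D..<j * D + D} \<and> r0 j \<in> {j * D..<j * D + D} \<and> p0 j \<noteq> r0 j" if "j < N" for j
  proof -
    have "p0 j \<in> transversal id s0 D N 0" "r0 j \<in> transversal id s0 D N 1"
      using that unfolding P_eq[symmetric] R_eq[symmetric] by simp_all
    then have "p0 j \<noteq> r0 j" using transversal_disjoint[OF smid, of 0 D 1 s0 N] D0 by auto
    then show ?thesis unfolding p0_def r0_def using D0 by simp
  qed
  obtain q where q: "inj_on (\<lambda>(j, t). q j t) ({..<N} \<times> {..<11})"
    "\<forall>j<N. \<forall>t<11. q j t < n \<and> near n (k + 3 * D) (j * D) (q j t)"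
    "\<forall>j<N. \<forall>t<10. adj (q j t) (q j (Suc t))"
    "\<forall>j<N. q j 0 = p0 j \<and> q j 10 = r0 j"
    "\<forall>j. Suc j < N \<longrightarrow> adj (q j 6) (q (Suc j) 3) \<and> adj (q (Suc j) 2) (q j 7)"
    using gadget_paths[OF D0(2) D(2,3) N_def N0 conf, of p0 r0] pr by blast
  have q_eqD: "j = j' \<and> t = t'" if "j < N" "j' < N" "t < 11" "t' < 11" "q j t = q j' t'" for j j' t t'
    using inj_onD[OF q(1), of "(j, t)" "(j', t')"] that by simp
  have inj_t: "inj_on (\<lambda>j. q j t) {..<N}" if t: "t < 11" for t
  proof (rule inj_onI)
    fix i j assume "i \<in> {..<N}" "j \<in> {..<N}" "q i t = q j t"
    then show "i = j" using q_eqD[of i j t t] t by simp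
  qed
  define I where "I = (\<lambda>(j, t). q j t) ` ({..<N} \<times> {..<11::nat})"
  have In: "I \<subseteq> {..<n}" unfolding I_def using q(2) by auto
  have cardI: "card I = 11 * N" unfolding I_def using q(1) by (simp add: card_image card_cartesian_product)
  define U where "U = {..<n} - I"
  have U: "U \<subseteq> {..<n}" unfolding U_def by blast
  have finI: "finite I" using In finite_subset by blast
  have cardU: "card U = N * M + \<rho>"
    unfolding U_def using In finI cardI nN D(1) by (simp add: card_Diff_subset algebra_simps)
  obtain e where e: "strict_mono e" "e ` {..<card U} = U" "\<forall>m. e m < n \<longleftrightarrow> m < card U"
    using ex_strict_mono_enumeration[OF U] by blast
  obtain s1 where s1: "\<forall>i<M. \<forall>v<n. (1 - \<delta>) * card (transversal e s1 M N i \<inter> nonnbr v)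
      \<le> ((1 - \<epsilon>) * k + 1) / M + 6 * (ln (real (k * M * (2 * k + 1) * M)) / \<delta>)"
    using transversals_few_nonnbrs[OF e(1) k0 M, of \<delta> N] \<delta> by auto
  define V where "V i = transversal e s1 M N i" for i
  \<comment> \<open>The unreserved vertices after the last full group, \<open>n mod D\<close> in
    number.\<close>
  define E where "E = e ` {N * M..<N * M + \<rho>}"
  have inj_e: "inj_on e A" for A using strict_mono_imp_inj_on[OF e(1)] inj_on_subset by blast
  have cardE: "card E = \<rho>" unfolding E_def using inj_e by (simp add: card_image)
  have finE: "finite E" unfolding E_def by simp
  have U_split: "(\<Union>i<M. V i) \<union> E = U" "(\<Union>i<M. V i) \<inter> E = {}"
  proof -
    have UN: "(\<Union>i<M. V i) = e ` {..<N * M}" unfolding V_def by (rule UN_transversal[OF M0])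
    have "{..<card U} = {..<N * M} \<union> {N * M..<N * M + \<rho>}" unfolding cardU by auto
    then show "(\<Union>i<M. V i) \<union> E = U" using e(2) unfolding UN E_def by (metis image_Un)
    show "(\<Union>i<M. V i) \<inter> E = {}"
      unfolding UN E_def image_Int[OF inj_e, symmetric, of "{..<N * M}" "{N * M..<N * M + \<rho>}"] by auto
  qed
  have VU: "V i \<subseteq> U" if "i < M" for i using U_split(1) that by blast
  have EU: "E \<subseteq> U" using U_split(1) by blast

  have eq_tid: "equidistributed D e0 (transversal id s0 D N i)" if i: "i < D" for i
    unfolding equidistributed_def
  proof (intro conjI allI impI)
    have "(\<Union>i<D. transversal id s0 D N i) = {..<N * D}" using UN_transversal[OF D0(1), of id s0 N] by simp
    then have "transversal id s0 D N i \<subseteq> {..<N * D}" using i by blast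
    moreover have "{..<N * D} \<subseteq> {..<n}" using nN by auto
    ultimately show "transversal id s0 D N i \<subseteq> {..<n}" by (rule subset_trans)
    fix x assume x: "x \<le> n"
    have "card {m. m < N * D \<and> id m < x} = min (N * D) x"
    proof -
      have "{m. m < N * D \<and> id m < x} = {..<min (N * D) x}" by auto
      then show ?thesis by simp
    qed
    then have "\<bar>real D * card (transversal id s0 D N i \<inter> {..<x}) - min (N * D) x\<bar> \<le> D"
      using transversal_equidistributed[OF smid D0(1), of s0 N i x] by simp
    moreover have "\<bar>real (min (N * D) x) - x\<bar> \<le> D"
    proof -
      have "x \<le> min (N * D) x + D" "min (N * D) x \<le> x" using x nN \<rho> by auto
      then have "real x \<le> real (min (N * D) x) + D" "real (min (N * D) x) \<le> x"
        by (simp_all only: of_nat_le_iff flip: of_nat_add)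
      then show ?thesis by (simp add: abs_le_iff)
    qed
    ultimately show "\<bar>real D * card (transversal id s0 D N i \<inter> {..<x}) - x\<bar> \<le> e0"
      using e0 by linarith
  qed
  have eqP: "equidistributed D e0 (p0 ` {..<N})" and eqR: "equidistributed D e0 (r0 ` {..<N})"
    unfolding P_eq R_eq using eq_tid D0 by simp_all
  have eqV: "equidistributed D e0 (V i)" if i: "i < M" for i
    unfolding equidistributed_def
  proof (intro conjI allI impI)
    show "V i \<subseteq> {..<n}" using VU[OF i] U by blast
    fix x assume x: "x \<le> n"
    define u where "u = card {m. m < N * M \<and> e m < x}"
    define c where "c = card (I \<inter> {..<x})"
    have "{..<x} = (I \<inter> {..<x}) \<union> (U \<inter> {..<x})" unfolding U_def using x by auto
    moreover have "(I \<inter> {..<x}) \<inter> (U \<inter> {..<x}) = {}" unfolding U_def by auto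
    ultimately have "card {..<x} = c + card (U \<inter> {..<x})" unfolding c_def by (metis card_Un_disjoint finite_Int finite_lessThan)
    then have xc: "x = c + card (U \<inter> {..<x})" by simp
    have "card (e ` {m. m < N * M \<and> e m < x}) = u" unfolding u_def using inj_e by (simp add: card_image)
    moreover have Usub: "U \<inter> {..<x} \<subseteq> e ` {m. m < N * M \<and> e m < x} \<union> E" "e ` {m. m < N * M \<and> e m < x} \<subseteq> U \<inter> {..<x}"
    proof -
      have "U = e ` {..<N * M} \<union> E" using U_split(1) UN_transversal[OF M0, of e s1 N] unfolding V_def by simp
      then show "U \<inter> {..<x} \<subseteq> e ` {m. m < N * M \<and> e m < x} \<union> E" "e ` {m. m < N * M \<and> e m < x} \<subseteq> U \<inter> {..<x}" by auto
    qed
    ultimately have u: "u \<le> card (U \<inter> {..<x})" "card (U \<inter> {..<x}) \<le> u + \<rho>"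
    proof -
      show "u \<le> card (U \<inter> {..<x})"
        using card_mono[OF _ Usub(2)] \<open>card (e ` {m. m < N * M \<and> e m < x}) = u\<close> by simp
      have "card (U \<inter> {..<x}) \<le> card (e ` {m. m < N * M \<and> e m < x} \<union> E)" using Usub(1) finE by (intro card_mono) auto
      also have "\<dots> \<le> u + \<rho>" using card_Un_le[of "e ` {m. m < N * M \<and> e m < x}" E] \<open>card (e ` {m. m < N * M \<and> e m < x}) = u\<close> cardE by simp
      finally show "card (U \<inter> {..<x}) \<le> u + \<rho>" .
    qed
    have c: "\<bar>real D * c - 11 * x\<bar> \<le> 2 * 11 * (real (k + 3 * D) + D)"
      using card_clustered_upto[OF D0(1) N_def Dn(1) x q(1)] q(2) unfolding c_def I_def by simp
    have ru: "real u \<le> real x - c" "real x - c \<le> real u + D"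
      using u xc \<rho> by linarith+
    have "real D * u \<le> real D * (real x - c)" "real D * (real x - c) \<le> real D * (real u + D)"
      using ru by (intro mult_left_mono; simp)+
    \<comment> \<open>Of \<open>x\<close> positions about \<open>11 x / D\<close> are reserved;
      since \<open>D - 11 = M\<close>, about \<open>M x / D\<close> remain.\<close>
    then have Du: "\<bar>real D * u - M * x\<bar> \<le> 22 * (real k + 4 * D) + (real D)\<^sup>2"
      using c D(1) by (simp add: abs_le_iff algebra_simps power2_eq_square)
    have "\<bar>real M * card (V i \<inter> {..<x}) - u\<bar> \<le> M"
      unfolding V_def u_def by (rule transversal_equidistributed[OF e(1) M0])
    then have "real D * \<bar>real M * card (V i \<inter> {..<x}) - u\<bar> \<le> real D * M" by (intro mult_left_mono) auto
    then have "\<bar>real D * (real M * card (V i \<inter> {..<x}) - u)\<bar> \<le> real D * M" by (simp add: abs_mult)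
    then have "\<bar>real D * (real M * card (V i \<inter> {..<x})) - M * x\<bar> \<le> real D * M + (22 * (real k + 4 * D) + (real D)\<^sup>2)"
      using Du by (simp add: abs_le_iff algebra_simps)
    moreover have "real D * (real M * card (V i \<inter> {..<x})) - M * x = M * (real D * card (V i \<inter> {..<x}) - x)"
      by (simp add: algebra_simps)
    ultimately have "real M * \<bar>real D * card (V i \<inter> {..<x}) - x\<bar> \<le> real D * M + (22 * (real k + 4 * D) + (real D)\<^sup>2)"
      by (simp add: abs_mult)
    then have "\<bar>real D * card (V i \<inter> {..<x}) - x\<bar> \<le> (real D * M + (22 * (real k + 4 * D) + (real D)\<^sup>2)) / M"
      using M0 by (simp add: field_simps)
    also have "\<dots> = e0" unfolding e0_def using M0 by (simp add: field_simps)
    finally show "\<bar>real D * card (V i \<inter> {..<x}) - x\<bar> \<le> e0" .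
  qed
  have eq_Un_E: "equidistributed D e1 (A \<union> E)" if A: "equidistributed D e0 A" and AE: "A \<inter> E = {}" for A
    unfolding equidistributed_def
  proof (intro conjI allI impI)
    have An: "A \<subseteq> {..<n}" using A unfolding equidistributed_def by blast
    show "A \<union> E \<subseteq> {..<n}" using An EU U by blast
    fix x assume x: "x \<le> n"
    have "finite A" using An finite_subset by blast
    then have "card ((A \<union> E) \<inter> {..<x}) = card (A \<inter> {..<x}) + card (E \<inter> {..<x})"
      unfolding Int_Un_distrib2 using finE AE by (intro card_Un_disjoint) auto
    moreover have "card (E \<inter> {..<x}) \<le> D"
      using card_mono[OF finE, of "E \<inter> {..<x}"] cardE \<rho> by simp
    then have "real D * card (E \<inter> {..<x}) \<le> (real D)\<^sup>2" unfolding power2_eq_square by (intro mult_left_mono) auto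
    moreover have "\<bar>real D * card (A \<inter> {..<x}) - x\<bar> \<le> e0" using A x unfolding equidistributed_def by blast
    moreover have "0 \<le> real D * card (E \<inter> {..<x})" by simp
    ultimately show "\<bar>real D * card ((A \<union> E) \<inter> {..<x}) - x\<bar> \<le> e1"
      unfolding e1_def by (simp only: of_nat_add distrib_left)
  qed

  \<comment> \<open>Layers 0 to 10 are the positions on the paths. Those strictly between 0 and 10
    need not be evenly spread, since the paths themselves match them.\<close>
  define L where "L t = (if t \<le> 10 then (\<lambda>j. q j t) ` {..<N} else V (t - 11))" for t
  define K where "K = 10 + M"
  have L0: "L 0 = p0 ` {..<N}" and L10: "L 10 = r0 ` {..<N}"
    using q(4) unfolding L_def by auto
  have LV: "L (11 + i) = V i" for i unfolding L_def by simp
  have LK: "L K = V (M - 1)" unfolding L_def K_def using M by auto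
  have L_eq: "equidistributed D e0 (L t) \<and> card (L t) = N \<and> (\<forall>v<n. card (L t \<inter> nonnbr v) \<le> h)"
    if t: "t = 0 \<or> 10 \<le> t" "t \<le> K" for t
  proof -
    consider i where "i < D" "L t = transversal id s0 D N i" | i where "i < M" "L t = V i"
    proof (cases "t \<le> 10")
      case True
      then have "t = 0 \<or> t = 10" using t by auto
      then show ?thesis using that(1)[of 0] that(1)[of 1] L0 L10 P_eq R_eq D0 by auto
    next
      case False
      then show ?thesis using that(2)[of "t - 11"] t unfolding L_def K_def by auto
    qed
    then show ?thesis
    proof cases
      case 1
      then show ?thesis
        using eq_tid[OF 1(1)] card_transversal[OF smid D0(1)] few[of D] s0 D(1) by simp
    next
      case 2
      have "card (L t) = N" unfolding 2(2) V_def by (rule card_transversal[OF e(1) M0])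
      moreover have "\<forall>v<n. card (L t \<inter> nonnbr v) \<le> h"
        using few[of M] s1 2(1) D(1) unfolding 2(2) V_def by simp
      ultimately show ?thesis using eqV[OF 2(1)] 2(2) by simp
    qed
  qed
  have L_disj: "L t \<inter> L t' = {}" if "t \<le> K" "t' \<le> K" "t \<noteq> t'" for t t'
  proof -
    have *: "L t \<inter> L t' = {}" if tt: "t < t'" "t' \<le> K" for t t'
    proof (cases "t' \<le> 10")
      case True
      show ?thesis
      proof (rule equals0I)
        fix v assume "v \<in> L t \<inter> L t'"
        then obtain j j' where "j < N" "j' < N" "q j t = q j' t'" using True tt unfolding L_def by auto
        then show False using q_eqD[of j j' t t'] True tt by simp
      qed
    next
      case False
      then have V': "L t' = V (t' - 11)" "t' - 11 < M" using tt unfolding L_def K_def by auto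
      show ?thesis
      proof (cases "t \<le> 10")
        case True
        then have "L t \<subseteq> I" unfolding L_def I_def by auto
        then show ?thesis using VU[OF V'(2)] unfolding V'(1) U_def by blast
      next
        case t: False
        then have "L t = V (t - 11)" "t - 11 < M" "t - 11 \<noteq> t' - 11" using tt unfolding L_def K_def by auto
        then show ?thesis using transversal_disjoint[OF e(1) _ V'(2)] unfolding V'(1) V_def by simp
      qed
    qed
    show ?thesis using *[of t t'] *[of t' t] that by (metis Int_commute linorder_neqE_nat)
  qed
  have L_E: "L t \<inter> E = {}" if "t \<le> K" for t
  proof (cases "t \<le> 10")
    case True
    then have "L t \<subseteq> I" unfolding L_def I_def by auto
    then show ?thesis using EU unfolding U_def by blast
  next
    case False
    then have "L t = V (t - 11)" "t - 11 < M" using that unfolding L_def K_def by auto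
    then show ?thesis using U_split(2) by auto
  qed
  have L_UN: "(\<Union>t\<le>K. L t) \<union> E = {..<n}"
  proof -
    have "(\<Union>t\<le>K. L t) = I \<union> (\<Union>i<M. V i)"
    proof (intro equalityI subsetI)
      fix v assume "v \<in> (\<Union>t\<le>K. L t)"
      then obtain t where t: "t \<le> K" "v \<in> L t" by blast
      show "v \<in> I \<union> (\<Union>i<M. V i)"
      proof (cases "t \<le> 10")
        case True
        then show ?thesis using t(2) unfolding L_def I_def by auto
      next
        case False
        then have "t - 11 < M" "v \<in> V (t - 11)" using t unfolding L_def K_def by auto
        then show ?thesis by blast
      qed
    next
      fix v assume "v \<in> I \<union> (\<Union>i<M. V i)"
      then consider j t where "j < N" "t < 11" "v = q j t" | i where "i < M" "v \<in> V i" unfolding I_def by auto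
      then show "v \<in> (\<Union>t\<le>K. L t)"
      proof cases
        case 1
        then have "v \<in> L t" "t \<le> K" unfolding L_def K_def by auto
        then show ?thesis by blast
      next
        case 2
        then have "v \<in> L (11 + i)" "11 + i \<le> K" unfolding LV K_def by auto
        then show ?thesis by blast
      qed
    qed
    then have "(\<Union>t\<le>K. L t) \<union> E = I \<union> U" using U_split(1) by blast
    then show ?thesis using In unfolding U_def by blast
  qed
  have L_n: "L t \<subseteq> {..<n}" if "t \<le> K" for t using L_UN that by blast

  have nn: "{u \<in> A. near n k v u \<and> \<not> adj u v} \<subseteq> A \<inter> nonnbr v" if "A \<subseteq> {..<n}" for A v
    using that adj_sym unfolding nonnbr_def by auto
  have "\<forall>t. \<exists>f. t < K \<longrightarrow> bij_betw f (L t) (L (Suc t)) \<and> (\<forall>u\<in>L t. adj u (f u))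
      \<and> (t < 10 \<longrightarrow> (\<forall>j<N. f (q j t) = q j (Suc t)))"
  proof
    fix t
    show "\<exists>f. t < K \<longrightarrow> bij_betw f (L t) (L (Suc t)) \<and> (\<forall>u\<in>L t. adj u (f u))
      \<and> (t < 10 \<longrightarrow> (\<forall>j<N. f (q j t) = q j (Suc t)))"
    proof (cases "t < 10")
      case True
      have inj: "inj_on (\<lambda>j. q j t) {..<N}" "inj_on (\<lambda>j. q j (Suc t)) {..<N}"
        using inj_t True by simp_all
      define f where "f v = q (the_inv_into {..<N} (\<lambda>j. q j t) v) (Suc t)" for v
      have f: "f (q j t) = q j (Suc t)" if "j < N" for j
        unfolding f_def using the_inv_into_f_f[OF inj(1)] that by simp
      have Lt: "L t = (\<lambda>j. q j t) ` {..<N}" "L (Suc t) = (\<lambda>j. q j (Suc t)) ` {..<N}"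
        using True unfolding L_def by auto
      have "bij_betw f (L t) (L (Suc t))"
      proof (rule bij_betw_imageI)
        show "inj_on f (L t)" unfolding Lt using f inj by (auto simp: inj_on_def)
        show "f ` L t = L (Suc t)" unfolding Lt using f by (auto simp: image_image)
      qed
      moreover have "\<forall>u\<in>L t. adj u (f u)" unfolding Lt using f q(3) True by auto
      ultimately show ?thesis using f by blast
    next
      case False
      show ?thesis
      proof (cases "t < K")
        case True
        have t: "equidistributed D e0 (L t)" "card (L t) = N" "\<And>v. v < n \<Longrightarrow> card (L t \<inter> nonnbr v) \<le> h"
          "equidistributed D e0 (L (Suc t))" "card (L (Suc t)) = N" "\<And>v. v < n \<Longrightarrow> card (L (Suc t) \<inter> nonnbr v) \<le> h"
          using L_eq[of t] L_eq[of "Suc t"] True False by auto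
        have sub: "L t \<subseteq> {..<n}" "L (Suc t) \<subseteq> {..<n}" using L_n True by auto
        have fin: "finite (L t)" "finite (L (Suc t))" using sub finite_subset by blast+
        have "\<exists>f. bij_betw f (L t) (L (Suc t)) \<and> (\<forall>u\<in>L t. adj u (f u))"
        proof (rule equidistributed_matching[OF t(1,4) _ _ bal0])
          fix v assume "v \<in> L (Suc t)"
          then show "card {u \<in> L t. near n k v u \<and> \<not> adj u v} \<le> h"
            using card_mono[OF _ nn[OF sub(1), of v]] t(3)[of v] sub(2) fin(1) by fastforce
        next
          fix u assume "u \<in> L t"
          moreover have "{v \<in> L (Suc t). near n k u v \<and> \<not> adj u v} \<subseteq> L (Suc t) \<inter> nonnbr u"
            using sub(2) unfolding nonnbr_def by auto
          then have "card {v \<in> L (Suc t). near n k u v \<and> \<not> adj u v} \<le> card (L (Suc t) \<inter> nonnbr u)"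
            using fin(2) by (intro card_mono) auto
          ultimately show "card {v \<in> L (Suc t). near n k u v \<and> \<not> adj u v} \<le> h"
            using t(6)[of u] sub(1) by fastforce
        qed (use t D0 in auto)
        then show ?thesis using False by blast
      qed simp
    qed
  qed
  from choice[OF this] obtain f where f: "\<forall>t. t < K \<longrightarrow> bij_betw (f t) (L t) (L (Suc t)) \<and> (\<forall>u\<in>L t. adj u (f t u))
      \<and> (t < 10 \<longrightarrow> (\<forall>j<N. f t (q j t) = q j (Suc t)))" ..

  \<comment> \<open>Adding \<open>E\<close> to both sides excludes at most \<open>D\<close> further
    partners of each vertex, even with all pairs inside \<open>E\<close> forbidden; hence
    \<open>h + D\<close>.\<close>
  have "\<exists>g. bij_betw g (L K \<union> E) (E \<union> L 0) \<and> (\<forall>u\<in>L K \<union> E. adj u (g u) \<and> \<not> (u \<in> E \<and> g u \<in> E))"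
  proof -
    have K: "equidistributed D e0 (L K)" "card (L K) = N" "\<And>v. v < n \<Longrightarrow> card (L K \<inter> nonnbr v) \<le> h"
      using L_eq[of K] unfolding K_def by auto
    have Z: "equidistributed D e0 (L 0)" "card (L 0) = N" "\<And>v. v < n \<Longrightarrow> card (L 0 \<inter> nonnbr v) \<le> h"
      using L_eq[of 0] by auto
    have sub: "L K \<subseteq> {..<n}" "L 0 \<subseteq> {..<n}" "E \<subseteq> {..<n}" using L_n EU U by auto
    have fin: "finite (L K)" "finite (L 0)" using sub finite_subset by blast+
    have KE: "L K \<inter> E = {}" "L 0 \<inter> E = {}" using L_E by auto
    have bound: "card ((A \<inter> nonnbr v) \<union> E) \<le> h + D" if "card (A \<inter> nonnbr v) \<le> h" for A v
      using card_Un_le[of "A \<inter> nonnbr v" E] that cardE \<rho> by linarith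
    show ?thesis
    proof (rule equidistributed_matching[where D = "real D" and e = e1 and h = "h + D"
          and R = "\<lambda>u v. adj u v \<and> \<not> (u \<in> E \<and> v \<in> E)"])
      show "equidistributed D e1 (L K \<union> E)" by (rule eq_Un_E[OF K(1) KE(1)])
      show "equidistributed D e1 (E \<union> L 0)" using eq_Un_E[OF Z(1) KE(2)] by (simp add: Un_commute)
      show "card (L K \<union> E) = card (E \<union> L 0)"
        using KE fin finE K(2) Z(2) by (simp add: card_Un_disjoint Int_commute)
      show "real D * (real (h + D) + 1) + 3 * e1 \<le> real k + 1" by (rule bal1)
      fix v assume "v \<in> E \<union> L 0"
      then have "v < n" using sub by auto
      have "{u \<in> L K \<union> E. near n k v u \<and> \<not> (adj u v \<and> \<not> (u \<in> E \<and> v \<in> E))} \<subseteq> (L K \<inter> nonnbr v) \<union> E"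
        using nn[OF sub(1), of v] KE(1) by blast
      then have "card {u \<in> L K \<union> E. near n k v u \<and> \<not> (adj u v \<and> \<not> (u \<in> E \<and> v \<in> E))} \<le> card ((L K \<inter> nonnbr v) \<union> E)"
        using fin finE by (intro card_mono) auto
      then show "card {u \<in> L K \<union> E. near n k v u \<and> \<not> (adj u v \<and> \<not> (u \<in> E \<and> v \<in> E))} \<le> h + D"
        using bound[OF K(3)[OF \<open>v < n\<close>]] by linarith
    next
      fix u assume "u \<in> L K \<union> E"
      then have "u < n" using sub by auto
      have "{v \<in> E \<union> L 0. near n k u v \<and> \<not> (adj u v \<and> \<not> (u \<in> E \<and> v \<in> E))} \<subseteq> (L 0 \<inter> nonnbr u) \<union> E"
        using nn[OF sub(2), of u] KE(2) adj_sym by blast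
      then have "card {v \<in> E \<union> L 0. near n k u v \<and> \<not> (adj u v \<and> \<not> (u \<in> E \<and> v \<in> E))} \<le> card ((L 0 \<inter> nonnbr u) \<union> E)"
        using fin finE by (intro card_mono) auto
      then show "card {v \<in> E \<union> L 0. near n k u v \<and> \<not> (adj u v \<and> \<not> (u \<in> E \<and> v \<in> E))} \<le> h + D"
        using bound[OF Z(3)[OF \<open>u < n\<close>]] by linarith
    qed (use D0 in simp)
  qed
  then obtain g where g: "bij_betw g (L K \<union> E) (E \<union> L 0)"
    "\<forall>u\<in>L K \<union> E. adj u (g u) \<and> \<not> (u \<in> E \<and> g u \<in> E)" by blast
  have "\<exists>p. p permutes (\<Union>t\<le>K. L t) \<union> E \<and> (\<forall>t<K. \<forall>u\<in>L t. p u = f t u) \<and> (\<forall>u\<in>L K \<union> E. p u = g u)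
    \<and> (\<forall>v\<in>(\<Union>t\<le>K. L t) \<union> E. \<exists>w\<in>L 0. w \<in> orbit p v)"
    using f g L_disj L_E by (intro layered_permutation) auto
  then obtain p where p: "p permutes {..<n}" "\<forall>t<K. \<forall>u\<in>L t. p u = f t u" "\<forall>u\<in>L K \<union> E. p u = g u"
    "\<forall>v<n. \<exists>w\<in>L 0. w \<in> orbit p v" unfolding L_UN by auto
  have p_adj: "adj u (p u)" if "u \<in> {..<n}" for u
  proof -
    have "u \<in> (\<Union>t\<le>K. L t) \<union> E" using that L_UN by simp
    then consider t where "t < K" "u \<in> L t" | "u \<in> L K \<union> E" by (auto simp: le_less)
    then show ?thesis using p(2,3) f g(2) by cases auto
  qed
  have p_q: "p (q j t) = q j (Suc t)" if "j < N" "t < 10" for j t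
  proof -
    have "q j t \<in> L t" "t < K" using that unfolding L_def K_def by auto
    then show ?thesis using p(2) f that by auto
  qed
  have q_orbit: "q j t \<in> orbit p (q j 0)" if "j < N" "0 < t" "t \<le> 10" for j t
    using that(2,3)
  proof (induction t)
    case (Suc t)
    have pq: "p (q j t) = q j (Suc t)" using p_q[OF that(1)] Suc.prems by simp
    show ?case
    proof (cases "t = 0")
      case True
      then show ?thesis using pq orbit.base[of p "q j 0"] by simp
    next
      case False
      then have "q j t \<in> orbit p (q j 0)" using Suc by simp
      then show ?thesis using pq orbit.step[of "q j t" p "q j 0"] by simp
    qed
  qed simp
  \<comment> \<open>The images of \<open>x j\<close> and \<open>y j\<close> are \<open>q j 7\<close>
    and \<open>q (Suc j) 3\<close>, the two interchangeable vertices of gadget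
    \<open>j\<close>.\<close>
  define x where "x j = q j 6" for j
  define y where "y j = q (Suc j) 2" for j
  have "\<exists>g. g permutes {..<n} \<and> (\<forall>u\<in>{..<n}. adj u (g u)) \<and> (\<forall>u. orbit p u \<subseteq> orbit g u)
    \<and> (\<forall>i<N - 1. y i \<in> orbit g (x i))"
  proof (rule join_orbits_by_swaps)
    show "p permutes {..<n}" by (rule p(1))
    show "adj u (p u)" if "u \<in> {..<n}" for u by (rule p_adj[OF that])
  next
    fix i assume "i < N - 1"
    then have i: "Suc i < N" "i < N" by auto
    have "p (y i) = q (Suc i) 3" "p (x i) = q i 7"
      using p_q[OF i(1), of 2] p_q[OF i(2), of 6] unfolding x_def y_def by (simp_all add: eval_nat_numeral)
    then show "x i \<in> {..<n} \<and> y i \<in> {..<n} \<and> adj (x i) (p (y i)) \<and> adj (y i) (p (x i))"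
      using q(2,5) i unfolding x_def y_def by simp
  next
    show "inj_on x {..<N - 1}" unfolding x_def by (rule inj_on_subset[OF inj_t]) auto
    show "inj_on y {..<N - 1}"
    proof (rule inj_onI)
      fix i j assume "i \<in> {..<N - 1}" "j \<in> {..<N - 1}" "y i = y j"
      then show "i = j" using q_eqD[of "Suc i" "Suc j" 2 2] unfolding y_def by auto
    qed
    fix i j assume "i < N - 1" "j < N - 1"
    then have "i < N" "Suc j < N" by linarith+
    then show "x i \<noteq> y j" using q_eqD[of i "Suc j" 6 2] unfolding x_def y_def by auto
  qed simp
  then obtain \<pi> where \<pi>: "\<pi> permutes {..<n}" "\<forall>u\<in>{..<n}. adj u (\<pi> u)" "\<And>u. orbit p u \<subseteq> orbit \<pi> u"
    "\<forall>i<N - 1. y i \<in> orbit \<pi> (x i)" by blast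
  have perm: "permutation \<pi>" using \<pi>(1) by (auto simp: permutation_permutes)
  have sym: "v \<in> orbit \<pi> u" if "u \<in> orbit \<pi> v" for u v
    using orbit_swap[OF permutation_self_in_orbit[OF perm] that] .
  \<comment> \<open>From the start of path \<open>j\<close> to \<open>x j\<close>, across to
    \<open>y j\<close>, and back to the start of path \<open>j + 1\<close>; the way back exists
    because orbits of a permutation are symmetric.\<close>
  have chain: "q j 0 \<in> orbit \<pi> (q 0 0)" if "j < N" for j
    using that
  proof (induction j)
    case 0
    show ?case by (rule permutation_self_in_orbit[OF perm])
  next
    case (Suc j)
    have "q j 6 \<in> orbit \<pi> (q j 0)" "q (Suc j) 2 \<in> orbit \<pi> (q (Suc j) 0)"
      using q_orbit[of j 6] q_orbit[of "Suc j" 2] \<pi>(3) Suc.prems by auto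
    moreover have "q (Suc j) 2 \<in> orbit \<pi> (q j 6)" using \<pi>(4) Suc.prems unfolding x_def y_def by auto
    moreover have "q j 0 \<in> orbit \<pi> (q 0 0)" using Suc by simp
    ultimately show ?case using orbit_trans sym by metis
  qed
  have "\<forall>v<n. v \<in> orbit \<pi> (q 0 0)"
  proof (intro allI impI)
    fix v assume "v < n"
    then obtain w where "w \<in> L 0" "w \<in> orbit \<pi> v" using p(4) \<pi>(3) by blast
    then obtain j where "j < N" "q j 0 \<in> orbit \<pi> v" unfolding L_def by auto
    then show "v \<in> orbit \<pi> (q 0 0)" using chain sym orbit_trans by metis
  qed
  moreover have "q 0 0 < n" using q(2) N0 by simp
  moreover have "\<forall>u<n. adj u (\<pi> u)" using \<pi>(2) by simp
  ultimately show ?thesis using \<pi>(1) by blast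
qed


text \<open>The slack is measured in units of \<open>a = \<epsilon> k\<close>. Taking
  \<open>M\<close> of order \<open>1 / \<epsilon>\<close> makes \<open>k / M\<close> a small
  multiple of \<open>a\<close>; 300000 leaves room in \<open>conf\<close>, where
  \<open>33 * 4 * 1024 = 135168\<close> times \<open>k / D\<close> has to stay below
  \<open>a\<close>. The exponent 6 comes from the logarithmic term
  \<open>24 L D / \<epsilon>\<close>: bounding the logarithm by a multiple of \<open>sqrt k\<close>,
  it is below \<open>a / 10\<close> once \<open>sqrt k\<close> is at least
  \<open>10 ^ 9 / \<epsilon> ^ 3\<close>.\<close>

theorem ex_single_cycle_permutation:
  assumes k: "real k \<ge> 10 ^ 18 / \<epsilon> ^ 6"
  shows "\<exists>p z. p permutes {..<n} \<and> (\<forall>u<n. adj u (p u)) \<and> z < n \<and> (\<forall>v<n. v \<in> orbit p z)"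
proof -
  define M where "M = nat \<lceil>300000 / \<epsilon>\<rceil>"
  define D where "D = M + 11"
  define a where "a = \<epsilon> * k"
  define L where "L = ln (real (k * D * (2 * k + 1) * D))"
  have M_lo: "300000 / \<epsilon> \<le> M" and M_hi: "real M \<le> 300000 / \<epsilon> + 1"
    unfolding M_def using eps by (simp_all add: of_nat_ceiling)
  have D_eq: "real D = M + 11" unfolding D_def by simp
  have D1: "real D \<ge> 1" unfolding D_eq by simp
  have inv: "1 \<le> 1 / \<epsilon>" using eps by simp
  have "300000 * 1 \<le> 300000 * (1 / \<epsilon>)" using inv by (rule mult_left_mono) simp
  then have M1: "300000 \<le> real M" using M_lo by simp
  have "real D \<le> 300000 * (1 / \<epsilon>) + 12" using M_hi D_eq by simp
  also have "\<dots> \<le> 400000 * (1 / \<epsilon>)" using inv by linarith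
  finally have D_hi: "real D \<le> 400000 / \<epsilon>" by simp
  have a_pow: "10 ^ 18 \<le> a * \<epsilon> ^ 5"
    using k eps unfolding a_def by (simp add: field_simps power_numeral_reduce)
  have D2: "(real D)\<^sup>2 \<le> a / 1000000"
  proof -
    have "(real D)\<^sup>2 \<le> (400000 / \<epsilon>)\<^sup>2" using D_hi by (intro power_mono) auto
    also have "\<dots> = 16 * 10 ^ 10 / \<epsilon> ^ 2" by (simp add: power_divide)
    also have "\<dots> \<le> 10 ^ 12 / \<epsilon> ^ 5"
    proof (rule frac_le)
      show "\<epsilon> ^ 5 \<le> \<epsilon>\<^sup>2" using eps by (intro power_decreasing) auto
    qed (use eps in auto)
    also have "\<dots> \<le> a / 1000000" using a_pow eps by (simp add: field_simps)
    finally show ?thesis .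
  qed
  have D_a: "real D \<le> a / 1000000"
  proof -
    have "real D \<le> (real D)\<^sup>2" using D1 by (simp add: power2_eq_square)
    then show ?thesis using D2 by linarith
  qed
  have a1: "1000000 \<le> a" using D1 D_a by simp
  have ak: "a \<le> k" unfolding a_def using eps by (simp add: mult_left_le_one_le)
  have k1: "1 \<le> real k" using a1 ak by linarith
  have Dk: "D \<le> k" using D_a ak a1 by linarith
  have kM: "real k / M \<le> a / 300000"
  proof -
    have "300000 \<le> \<epsilon> * M" using M_lo eps by (simp add: field_simps)
    then have "real k * 300000 \<le> real k * (\<epsilon> * M)" by (intro mult_left_mono) auto
    then show ?thesis unfolding a_def using M1 by (simp add: field_simps)
  qed
  have DM: "real D / M \<le> 2" using M1 D_eq by (simp add: field_simps)
  have D2M: "(real D)\<^sup>2 / M \<le> 2 * D"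
  proof -
    have "(real D)\<^sup>2 / M = real D * (real D / M)" by (simp add: power2_eq_square)
    also have "\<dots> \<le> real D * 2" using DM by (intro mult_left_mono) auto
    finally show ?thesis by simp
  qed
  have L: "24 * L * D / \<epsilon> \<le> a / 10"
  proof -
    have "k * D * (2 * k + 1) * D \<le> k * k * (3 * k) * k"
      using Dk k1 by (intro mult_le_mono) auto
    also have "\<dots> \<le> k * k * (k * k) * k"
      using a1 ak by (intro mult_le_mono order_refl) auto
    finally have "k * D * (2 * k + 1) * D \<le> k ^ 5" by (simp add: power_numeral_reduce mult.assoc)
    then have "real (k * D * (2 * k + 1) * D) \<le> real (k ^ 5)" by (simp only: of_nat_le_iff)
    moreover have "0 < k * D * (2 * k + 1) * D" using k1 D_def by simp
    then have "0 < real (k * D * (2 * k + 1) * D)" by (simp only: of_nat_0_less_iff)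
    moreover have "1 \<le> k * D * (2 * k + 1) * D"
      using \<open>0 < k * D * (2 * k + 1) * D\<close> by (simp only: Suc_le_eq One_nat_def)
    then have "real 1 \<le> real (k * D * (2 * k + 1) * D)" by (simp only: of_nat_le_iff)
    then have L0: "0 \<le> L" unfolding L_def of_nat_1 by (rule ln_ge_zero)
    ultimately have "L \<le> ln (real (k ^ 5))" unfolding L_def by (intro ln_mono) auto
    also have "\<dots> = 5 * ln (real k)" using k1 by (simp add: ln_realpow)
    also have "ln (real k) = 2 * ln (sqrt k)" using k1 by (simp add: ln_sqrt)
    also have "ln (sqrt k) \<le> sqrt k" using k1 ln_le_minus_one[of "sqrt k"] by simp
    finally have L_le: "L \<le> 10 * sqrt k" by simp
    have s: "10 ^ 9 \<le> sqrt k * \<epsilon> ^ 3"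
    proof (rule power2_le_imp_le)
      have "(sqrt k * \<epsilon> ^ 3)\<^sup>2 = k * \<epsilon> ^ 6" by (simp add: power_mult_distrib flip: power_mult)
      then show "(10 ^ 9)\<^sup>2 \<le> (sqrt k * \<epsilon> ^ 3)\<^sup>2" using k eps by (simp add: field_simps)
    qed (use eps in simp)
    have "24 * L * D / \<epsilon> \<le> 24 * (10 * sqrt k) * (400000 / \<epsilon>) / \<epsilon>"
      using L_le L0 D_hi eps D1 by (intro divide_right_mono mult_mono) auto
    also have "\<dots> = 96 * 10 ^ 6 * sqrt k * 1 / \<epsilon>\<^sup>2" by (simp add: power2_eq_square)
    also have "\<dots> \<le> 96 * 10 ^ 6 * sqrt k * (sqrt k * \<epsilon> ^ 3 / 10 ^ 9) / \<epsilon>\<^sup>2"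
      using s eps by (intro divide_right_mono mult_left_mono) auto
    also have "\<dots> = 96 / 1000 * ((sqrt k * sqrt k) * (\<epsilon> ^ 3 / \<epsilon>\<^sup>2))" by simp
    also have "\<dots> = 96 / 1000 * a" unfolding a_def using eps by (simp add: power3_eq_cube power2_eq_square)
    also have "\<dots> \<le> a / 10" using a1 by simp
    finally show ?thesis .
  qed
  \<comment> \<open>Of the slack \<open>a\<close>, the errors in the number of nonneighbours take
    \<open>a / 4\<close>, the factor \<open>1 - \<delta>\<close> with
    \<open>\<delta> = \<epsilon> / 4\<close> takes another \<open>a / 4\<close>, and
    \<open>a / 2\<close> remains for the discrepancies in \<open>bal\<close>.\<close>
  define H where "H = (1 - \<epsilon> / 2) * k / D"
  show ?thesis
  proof (rule single_cycle_permutation[of M D "\<epsilon> / 4" H])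
    show "3 \<le> M" using M1 by linarith
    show "D = M + 11" by (rule D_def)
    have "6 + 6 * real D \<le> k" using D_a a1 ak by linarith
    then show "6 + 6 * D \<le> k" by linarith
    show "3 * real D + 1 \<le> \<epsilon> * real k" using D_a a1 unfolding a_def by linarith
    have "real (4 * k + 4 * D) / D = 4 * (real k / D) + 4" using D1 by (simp add: field_simps)
    moreover have "real k / D \<le> a / 300000"
    proof -
      have "real k / D \<le> real k / M" using M1 D_eq by (intro divide_left_mono) auto
      then show ?thesis using kM by linarith
    qed
    ultimately show "33 * (real (4 * k + 4 * D) / real D + 1) < \<epsilon> * real k / 1024"
      using a1 unfolding a_def[symmetric] by simp
    show "0 < \<epsilon> / 4" "\<epsilon> / 4 < 1" using eps by simp_all
    show "0 \<le> H" unfolding H_def using eps by simp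
    show "((1 - \<epsilon>) * real k + 1) / real M + 6 * (ln (real (k * D * (2 * k + 1) * D)) / (\<epsilon> / 4)) \<le> (1 - \<epsilon> / 4) * H"
    proof -
      have "D * (((1 - \<epsilon>) * real k + 1) / real M + 6 * (L / (\<epsilon> / 4)))
          = (real D / M) * ((1 - \<epsilon>) * k) + real D / M + 24 * L * D / \<epsilon>"
        using M1 eps by (simp add: field_simps)
      also have "(real D / M) * ((1 - \<epsilon>) * k) \<le> (1 - \<epsilon>) * k + a / 20000"
      proof -
        have "(real D / M) * ((1 - \<epsilon>) * k) = (1 - \<epsilon>) * k + 11 * (1 - \<epsilon>) * (real k / M)"
          unfolding D_eq using M1 by (simp add: field_simps)
        also have "11 * (1 - \<epsilon>) * (real k / M) \<le> 11 * 1 * (a / 300000)"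
          using kM eps by (intro mult_mono) auto
        finally show ?thesis using a1 by simp
      qed
      also have "(1 - \<epsilon>) * k + a / 20000 + real D / M + 24 * L * D / \<epsilon> \<le> real k - 3 / 4 * a"
      proof -
        have "(1 - \<epsilon>) * real k = real k - a" unfolding a_def by (simp add: algebra_simps)
        then show ?thesis using DM L a1 by linarith
      qed
      also have "\<dots> \<le> (1 - \<epsilon> / 4) * ((1 - \<epsilon> / 2) * k)"
      proof -
        have "0 \<le> \<epsilon> * \<epsilon> * k" using eps by simp
        then show ?thesis unfolding a_def by (simp add: algebra_simps)
      qed
      also have "\<dots> = D * ((1 - \<epsilon> / 4) * H)" unfolding H_def using D1 by simp
      finally have "real D * (((1 - \<epsilon>) * real k + 1) / real M + 6 * (L / (\<epsilon> / 4))) \<le> D * ((1 - \<epsilon> / 4) * H)" by simp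
      then show ?thesis using D1 unfolding L_def[symmetric] by simp
    qed
    show "real D * (H + real D + 1) + 3 * (real D + (real D)\<^sup>2 + (real D)\<^sup>2 / real M + 22 * (real k + real (4 * D)) / real M) \<le> real (k + 1)"
    proof -
      have "real D * (H + real D + 1) = (1 - \<epsilon> / 2) * k + (real D)\<^sup>2 + D"
        unfolding H_def using D1 by (simp add: field_simps power2_eq_square)
      also have "(1 - \<epsilon> / 2) * k = k - a / 2" unfolding a_def by (simp add: algebra_simps)
      finally have "real D * (H + real D + 1) = k - a / 2 + (real D)\<^sup>2 + D" .
      moreover have "22 * (real k + real (4 * D)) / real M = 22 * (real k / M) + 88 * (real D / M)"
        using M1 by (simp add: field_simps)
      ultimately show ?thesis using D2M D2 D_a kM DM a1 by simp
    qed
  qed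
qed

end

section \<open>Powers of cycles\<close>

lemma awalk_cycle_graph_near:
  assumes "pre_digraph.awalk (with_proj (cycle_graph n)) u p v"
  shows "near n (length p) u v"
  using assms
proof (induction p arbitrary: u)
  case Nil
  then show ?case by (simp add: pre_digraph.awalk_def pre_digraph.cas.simps)
next
  case (Cons e p)
  interpret pair_graph "cycle_graph n" by (rule pair_graph_cycle_graph)
  obtain w where e: "e = (u, w)" "(u, w) \<in> parcs (cycle_graph n)" "awalk w p v"
    using Cons.prems by (cases e) (auto simp: awalk_Cons_iff)
  have "near n 1 x ((x + 1) mod n)" for x
    unfolding near_mod_right by (rule near_of_abs_diff) simp
  then have "near n 1 u w" using e(2) near_sym unfolding cycle_graph_def by auto
  then have "near n (1 + length p) u v" using Cons.IH[OF e(3)] by (rule near_trans)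
  then show ?case by simp
qed

lemma awalk_cycle_graph_forward:
  assumes n: "n \<ge> 2" and u: "u < n"
  shows "\<exists>p. pre_digraph.awalk (with_proj (cycle_graph n)) u p ((u + d) mod n) \<and> length p = d"
    and "\<exists>p. pre_digraph.awalk (with_proj (cycle_graph n)) ((u + d) mod n) p u \<and> length p = d"
proof -
  interpret pair_graph "cycle_graph n" by (rule pair_graph_cycle_graph)
  have arc: "(x, Suc x mod n) \<in> parcs (cycle_graph n)" "(Suc x mod n, x) \<in> parcs (cycle_graph n)" if "x < n" for x
  proof -
    have "x \<noteq> Suc x mod n" using that n by (cases "Suc x = n") auto
    then show "(x, Suc x mod n) \<in> parcs (cycle_graph n)" "(Suc x mod n, x) \<in> parcs (cycle_graph n)"
      using that n unfolding cycle_graph_def by auto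
  qed
  have verts: "x \<in> pverts (cycle_graph n)" if "x < n" for x using that unfolding cycle_graph_def by simp
  show "\<exists>p. awalk u p ((u + d) mod n) \<and> length p = d"
    using u
  proof (induction d arbitrary: u)
    case 0
    then show ?case using verts by (intro exI[of _ "[]"]) (simp add: awalk_Nil_iff)
  next
    case (Suc d)
    have "Suc u mod n < n" using n by simp
    from Suc.IH[OF this] obtain p where p: "awalk (Suc u mod n) p ((Suc u mod n + d) mod n)" "length p = d" by blast
    have "(Suc u mod n + d) mod n = (u + Suc d) mod n" by (simp add: mod_simps)
    then have "awalk u ((u, Suc u mod n) # p) ((u + Suc d) mod n)"
      using p(1) arc(1)[OF Suc.prems] by (simp add: awalk_Cons_iff)
    then show ?case using p(2) by (intro exI[of _ "(u, Suc u mod n) # p"]) simp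
  qed
  show "\<exists>p. awalk ((u + d) mod n) p u \<and> length p = d"
  proof (induction d)
    case 0
    then show ?case using verts u by (intro exI[of _ "[]"]) (simp add: awalk_Nil_iff)
  next
    case (Suc d)
    then obtain p where p: "awalk ((u + d) mod n) p u" "length p = d" by blast
    let ?x = "(u + d) mod n"
    have "Suc ?x mod n = (u + Suc d) mod n" by (simp add: mod_simps)
    then have "awalk ((u + Suc d) mod n) (((u + Suc d) mod n, ?x) # p) u"
      using p(1) arc(2)[of ?x] n by (simp add: awalk_Cons_iff)
    then show ?case using p(2) by (intro exI[of _ "((u + Suc d) mod n, ?x) # p"]) simp
  qed
qed

text \<open>A walk adds up displacements 1 and -1, and a displacement \<open>z\<close> is realised
  by \<open>|z|\<close> steps in one direction. The bound \<open>n \<ge> 2\<close> keeps consecutive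
  vertices distinct.\<close>

lemma parcs_power_cycle_graph_iff:
  assumes n: "n \<ge> 2"
  shows "(u, v) \<in> parcs (graph_power (cycle_graph n) k) \<longleftrightarrow> u < n \<and> v < n \<and> u \<noteq> v \<and> near n k u v"
proof -
  have "graph_dist (cycle_graph n) u v \<le> ereal (real k) \<longleftrightarrow> near n k u v" if uv: "u < n" "v < n"
  proof
    assume le: "graph_dist (cycle_graph n) u v \<le> ereal (real k)"
    have "\<exists>p. pre_digraph.awalk (with_proj (cycle_graph n)) u p v \<and> length p \<le> k"
    proof (rule ccontr)
      assume neg: "\<not> ?thesis"
      \<comment> \<open>Lengths are integers, so if every walk is longer than \<open>k\<close> the
        infimum is at least \<open>k + 1\<close>; this includes the case of no walk at all.\<close>
      have "ereal (real (Suc k)) \<le> graph_dist (cycle_graph n) u v"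
        unfolding graph_dist_cycle_graph
      proof (rule INF_greatest)
        fix p assume "p \<in> {p. pre_digraph.awalk (with_proj (cycle_graph n)) u p v}"
        then have "Suc k \<le> length p" using neg by (simp add: not_le Suc_le_eq)
        then show "ereal (real (Suc k)) \<le> ereal (real (length p))" by (simp only: ereal_less_eq of_nat_le_iff)
      qed
      then have "ereal (real (Suc k)) \<le> ereal (real k)" using le by (rule order_trans)
      then show False by simp
    qed
    then show "near n k u v" using awalk_cycle_graph_near near_mono by blast
  next
    assume "near n k u v"
    then obtain z where z: "\<bar>z\<bar> \<le> int k" "int n dvd int v - int u - z" unfolding near_def by blast
    define d where "d = nat \<bar>z\<bar>"
    have "\<exists>p. pre_digraph.awalk (with_proj (cycle_graph n)) u p v \<and> length p = d"
    proof (cases "z \<ge> 0")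
      case True
      then have "int n dvd int v - int (u + d)" using z(2) unfolding d_def by (simp add: algebra_simps)
      then have "int v mod int n = int (u + d) mod int n" by (simp only: mod_eq_dvd_iff)
      then have "v = (u + d) mod n" using uv(2) by (metis mod_less of_nat_eq_iff zmod_int)
      then show ?thesis using awalk_cycle_graph_forward(1)[OF n uv(1), of d] by simp
    next
      case False
      then have "int v - int u - z = int (v + d) - int u" unfolding d_def by simp
      then have "int (v + d) mod int n = int u mod int n" using z(2) by (simp only: mod_eq_dvd_iff)
      then have "u = (v + d) mod n" using uv(1) by (metis mod_less of_nat_eq_iff zmod_int)
      then show ?thesis using awalk_cycle_graph_forward(2)[OF n uv(2), of d] by simp
    qed
    then obtain p where p: "pre_digraph.awalk (with_proj (cycle_graph n)) u p v" "length p = d" by blast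
    have "graph_dist (cycle_graph n) u v \<le> ereal (real (length p))"
      unfolding graph_dist_cycle_graph using p(1) by (intro INF_lower) simp
    also have "\<dots> \<le> ereal (real k)" using z(1) p(2) unfolding d_def by simp
    finally show "graph_dist (cycle_graph n) u v \<le> ereal (real k)" .
  qed
  moreover have "pverts (cycle_graph n) = {0..<n}" unfolding cycle_graph_def by simp
  ultimately show ?thesis unfolding graph_power_def by auto
qed

lemma out_degree_with_proj: "out_degree (with_proj G) v = card {u. (v, u) \<in> parcs G}"
proof -
  have "out_arcs (with_proj G) v = Pair v ` {u. (v, u) \<in> parcs G}" unfolding out_arcs_def by auto
  then show ?thesis unfolding out_degree_def by (simp add: card_image inj_on_def)
qed

lemma card_near_ge:
  assumes "2 * k + 1 \<le> n" "v < n"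
  shows "2 * k + 1 \<le> card {u. u < n \<and> near n k v u}"
proof -
  \<comment> \<open>The shift by \<open>n\<close> keeps the subtraction of natural numbers from
    truncating.\<close>
  let ?I = "{v + n - k..<v + n - k + (2 * k + 1)}"
  have "inj_on (\<lambda>y. y mod n) ?I"
    using assms(1) by (intro inj_on_subset[OF inj_on_mod_interval[of n "v + n - k"]]) auto
  then have "card ((\<lambda>y. y mod n) ` ?I) = 2 * k + 1" by (simp add: card_image)
  moreover have "(\<lambda>y. y mod n) ` ?I \<subseteq> {u. u < n \<and> near n k v u}"
  proof (rule image_subsetI)
    fix y assume y: "y \<in> ?I"
    have "near n k (v + n) y" using y assms by (intro near_of_abs_diff) auto
    then have "near n k ((v + n) mod n) (y mod n)" by (simp only: near_mod_left near_mod_right)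
    moreover have "(v + n) mod n = v" using assms(2) by simp
    ultimately show "y mod n \<in> {u. u < n \<and> near n k v u}" using assms by (metis (mono_tags) mem_Collect_eq mod_less_divisor not_gr_zero not_less_zero)
  qed
  ultimately show ?thesis using card_mono[of "{u. u < n \<and> near n k v u}" "(\<lambda>y. y mod n) ` ?I"] by simp
qed

text \<open>An orbit covering all vertices has \<open>n\<close> elements, so the first return to
  \<open>z\<close> happens after \<open>n\<close> steps and the iterates of \<open>z\<close> trace
  the Hamilton cycle.\<close>

lemma hamiltonian_if_single_cycle:
  fixes G :: "nat pair_pre_digraph"
  assumes G: "pair_graph G" and V: "pverts G = {..<n}" and n: "n \<ge> 3"
    and p: "p permutes {..<n}" and adj: "\<And>u. u < n \<Longrightarrow> (u, p u) \<in> parcs G"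
    and z: "z < n" and orbit: "\<And>v. v < n \<Longrightarrow> v \<in> orbit p z"
  shows "hamiltonian G"
proof -
  interpret pair_graph G by (rule G)
  define f where "f i = (p ^^ i) z" for i
  have f_lt: "f i < n" for i
  proof (induction i)
    case (Suc i)
    then show ?case using permutes_in_image[OF p] unfolding f_def by auto
  qed (use z in \<open>simp add: f_def\<close>)
  have zz: "z \<in> orbit p z" by (rule orbit[OF z])
  define m where "m = funpow_dist1 p z z"
  have orb: "orbit p z = f ` {0..<m}" unfolding m_def f_def by (rule orbit_conv_funpow_dist1[OF zz])
  have inj: "inj_on f {0..<m}" unfolding m_def f_def by (rule inj_on_funpow_dist1[OF zz])
  have "f ` {0..<m} = {..<n}" using orb orbit f_lt by auto
  then have mn: "m = n" using card_image[OF inj] by simp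
  have fn: "f n = z" unfolding mn[symmetric] m_def f_def by (rule funpow_dist1_prop[OF zz])
  define es where "es l = map (\<lambda>i. (f i, f (Suc i))) [0..<l]" for l
  have walk: "awalk z (es l) (f l)" for l
  proof (induction l)
    case 0
    show ?case unfolding es_def f_def using z V by (simp add: awalk_Nil_iff)
  next
    case (Suc l)
    have "(f l, f (Suc l)) \<in> parcs G" using adj[OF f_lt[of l]] unfolding f_def by simp
    then have "awalk (f l) [(f l, f (Suc l))] (f (Suc l))"
      using f_lt V by (simp add: awalk_Cons_iff awalk_Nil_iff)
    then show ?case using Suc unfolding es_def by (simp add: awalk_append_iff)
  qed
  have ne: "es n \<noteq> []" using n unfolding es_def by simp
  have "awalk_verts z (es n) = map f [0..<n] @ [f n]"
  proof -
    have "awalk_verts z (es n) = map fst (es n) @ [snd (last (es n))]"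
      using walk[of n] ne by (simp add: awalk_verts_conv)
    also have "map fst (es n) = map f [0..<n]" unfolding es_def by simp
    also have "snd (last (es n)) = f n" unfolding es_def using n by (simp add: last_map)
    finally show ?thesis .
  qed
  then have "awalk_verts z (es n) = map f [0..<Suc n]" by simp
  \<comment> \<open>The full vertex list repeats \<open>z\<close>. Without its head it is the image
    under the injective \<open>p\<close> of the distinct iterates, hence distinct.\<close>
  then have "tl (awalk_verts z (es n)) = map f (map Suc [0..<n])"
    by (simp add: map_tl[symmetric] map_Suc_upt del: upt_Suc)
  also have "\<dots> = map p (map f [0..<n])" unfolding f_def by simp
  finally have "distinct (tl (awalk_verts z (es n)))"
    using comp_inj_on[OF inj inj_on_subset[OF permutes_inj[OF p] subset_UNIV]]
    unfolding mn by (simp add: distinct_map comp_def)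
  moreover have "fst ` set (es n) = {..<n}" using \<open>f ` {0..<m} = {..<n}\<close> mn unfolding es_def by (simp add: image_image)
  ultimately have "hamilton_cycle G (es n)"
    unfolding hamilton_cycle_def cycle_def using walk[of n] fn ne n V unfolding es_def by auto
  then show ?thesis unfolding hamiltonian_def by blast
qed

section \<open>Reduction to windows that do not overlap themselves\<close>

theorem theorem1p2:
  shows "\<exists>k\<^sub>0::real. \<forall>\<epsilon>::real. \<epsilon> > 0 \<longrightarrow>
    (\<forall>n k::nat. n \<ge> k \<and> real k \<ge> max (\<epsilon> powi (-121)) k\<^sub>0 \<longrightarrow>
      (\<forall>H. beta_subgraph (1/2 + \<epsilon>) H (graph_power (cycle_graph n) k) \<longrightarrow> hamiltonian H))"
proof (intro exI[of _ "10 ^ 133"] allI impI)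
  fix \<epsilon> :: real and n k :: nat and H
  assume eps: "\<epsilon> > 0" and nk: "n \<ge> k \<and> real k \<ge> max (\<epsilon> powi (-121)) (10 ^ 133)"
    and H: "beta_subgraph (1/2 + \<epsilon>) H (graph_power (cycle_graph n) k)"
  define \<epsilon>\<^sub>1 where "\<epsilon>\<^sub>1 = min \<epsilon> 1"
  define k' where "k' = min k ((n - 1) div 2)"
    \<comment> \<open>The windows of radius \<open>k'\<close> do not overlap themselves; passing from \<open>k\<close> to \<open>k'\<close> costs a vertex at most
      one neighbour, its antipode when \<open>n\<close> is even.\<close>
  have eps1: "0 < \<epsilon>\<^sub>1" "\<epsilon>\<^sub>1 \<le> 1" "\<epsilon>\<^sub>1 \<le> \<epsilon>" unfolding \<epsilon>\<^sub>1_def using eps by auto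
  have "(10::real) ^ 1 \<le> 10 ^ 133" by (rule power_increasing) simp_all
  then have k10: "k \<ge> 10" using nk by simp
  have n3: "n \<ge> 3" "n \<ge> 2" using nk k10 by auto
  have k'n: "2 * k' + 1 \<le> n" unfolding k'_def using n3 by linarith
  \<comment> \<open>The factor 4 makes up for \<open>k \<le> 4 * k'\<close>. For \<epsilon> up to
    \<open>1 / 10 ^ 19\<close> the power 121 exceeds 6 by 115 factors, whose product is at most
    \<open>1 / 10 ^ 19\<close> and so covers the constant. For larger \<epsilon> the left side is at
    most \<open>4 * 10 ^ 18 * 10 ^ 114\<close>, which is below \<open>10 ^ 133\<close>.\<close>
  have "4 * 10 ^ 18 / \<epsilon>\<^sub>1 ^ 6 \<le> k"
  proof (cases "\<epsilon>\<^sub>1 \<le> 1 / 10 ^ 19")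
    case True
    have "(1::real) / 10 ^ 19 < 1" by (simp add: power_numeral_reduce)
    then have e: "\<epsilon>\<^sub>1 = \<epsilon>" using True unfolding \<epsilon>\<^sub>1_def by auto
    have "\<epsilon>\<^sub>1 ^ 115 \<le> \<epsilon>\<^sub>1 ^ 1" using eps1 by (intro power_decreasing) auto
    then have "\<epsilon>\<^sub>1 ^ 115 \<le> 1 / 10 ^ 19" using True by simp
    then have "\<epsilon>\<^sub>1 ^ 6 * \<epsilon>\<^sub>1 ^ 115 \<le> \<epsilon>\<^sub>1 ^ 6 * (1 / 10 ^ 19)" using eps1 by (intro mult_left_mono) auto
    then have "\<epsilon>\<^sub>1 ^ 121 \<le> \<epsilon>\<^sub>1 ^ 6 / 10 ^ 19" by (simp add: power_add[symmetric])
    then have "1 / (\<epsilon>\<^sub>1 ^ 6 / 10 ^ 19) \<le> 1 / \<epsilon>\<^sub>1 ^ 121" using eps1 by (intro divide_left_mono) auto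
    also have "1 / \<epsilon>\<^sub>1 ^ 121 = \<epsilon> powi (-121)" unfolding e by (simp add: power_int_minus divide_inverse)
    also have "\<dots> \<le> k" using nk by simp
    finally have "10 ^ 19 / \<epsilon>\<^sub>1 ^ 6 \<le> k" by simp
    moreover have "4 * 10 ^ 18 / \<epsilon>\<^sub>1 ^ 6 \<le> 10 ^ 19 / \<epsilon>\<^sub>1 ^ 6"
      using eps1 by (intro divide_right_mono) (auto simp: power_numeral_reduce)
    ultimately show ?thesis by linarith
  next
    case False
    then have "(1 / 10 ^ 19) ^ 6 \<le> \<epsilon>\<^sub>1 ^ 6" by (intro power_mono) auto
    then have "4 * 10 ^ 18 / \<epsilon>\<^sub>1 ^ 6 \<le> 4 * 10 ^ 18 / (1 / 10 ^ 19) ^ 6"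
      using eps1 by (intro divide_left_mono) auto
    also have "\<dots> = 4 * (10 ^ 18 * 10 ^ 114)" by (simp add: power_divide flip: power_mult)
    also have "\<dots> = 4 * 10 ^ 132" by (simp only: power_add[symmetric]) simp
    also have "\<dots> \<le> (10::real) * 10 ^ 132" by (intro mult_right_mono) auto
    also have "\<dots> = 10 ^ 133" by (simp only: power_Suc[symmetric]) simp
    finally show ?thesis using nk by simp
  qed
  moreover have "real k \<le> 4 * k'" using nk k10 unfolding k'_def by linarith
  ultimately have k': "10 ^ 18 / \<epsilon>\<^sub>1 ^ 6 \<le> real k'" by (simp add: field_simps)
  \<comment> \<open>Pays for the neighbour that may be lost with \<open>k'\<close>: \<open>(1 + 2 *
    \<epsilon>\<^sub>1) * k' - 1 \<ge> (1 + \<epsilon>\<^sub>1) * k'\<close>.\<close>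
  have k'1: "1 \<le> \<epsilon>\<^sub>1 * k'"
  proof -
    have "\<epsilon>\<^sub>1 ^ 6 \<le> \<epsilon>\<^sub>1 ^ 1" using eps1 by (intro power_decreasing) auto
    then have "\<epsilon>\<^sub>1 ^ 6 * k' \<le> \<epsilon>\<^sub>1 * k'" by (intro mult_right_mono) auto
    moreover have "10 ^ 18 \<le> \<epsilon>\<^sub>1 ^ 6 * k'" using k' eps1 by (simp add: field_simps)
    moreover have "(1::real) \<le> 10 ^ 18" by simp
    ultimately show ?thesis by linarith
  qed
  let ?G = "graph_power (cycle_graph n) k"
  have VG: "pverts ?G = {..<n}" unfolding graph_power_def cycle_graph_def by auto
  have H_graph: "pair_graph H" and H_sub: "parcs H \<subseteq> parcs ?G" and VH: "pverts H = {..<n}"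
    and H_deg: "\<And>v. v < n \<Longrightarrow> (1/2 + \<epsilon>) * card {u. (v, u) \<in> parcs ?G} \<le> card {u. (v, u) \<in> parcs H}"
    using H VG unfolding beta_subgraph_def spanning_def subgraph_def out_degree_with_proj by auto
  have H_arc: "u < n \<and> v < n \<and> u \<noteq> v \<and> near n k u v" if "(u, v) \<in> parcs H" for u v
    using that H_sub parcs_power_cycle_graph_iff[OF n3(2)] by blast
  define adj where "adj u v \<longleftrightarrow> (u, v) \<in> parcs H \<and> near n k' u v" for u v
  interpret dense_window_graph n k' adj \<epsilon>\<^sub>1
  proof
    show "2 * k' + 1 \<le> n" by (rule k'n)
    show "adj v u" if "adj u v" for u v
    proof -
      interpret H: pair_graph H by (rule H_graph)
      have "(v, u) \<in> parcs H" using that H.graph_symmetric unfolding adj_def by auto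
      then show ?thesis using that near_sym unfolding adj_def by blast
    qed
    show "\<not> adj u u" for u using H_arc unfolding adj_def by blast
    show "u < n \<and> v < n \<and> near n k' u v" if "adj u v" for u v using that H_arc unfolding adj_def by blast
    show "0 < \<epsilon>\<^sub>1" "\<epsilon>\<^sub>1 \<le> 1" by (rule eps1)+
    fix v assume v: "v < n"
    let ?W = "{u. u < n \<and> near n k' v u}"
    have W: "2 * k' + 1 \<le> card ?W" by (rule card_near_ge[OF k'n v])
    have "?W - {v} \<subseteq> {u. (v, u) \<in> parcs ?G}"
    proof
      fix u assume "u \<in> ?W - {v}"
      moreover from this have "near n k v u" unfolding k'_def by (auto intro: near_mono)
      ultimately show "u \<in> {u. (v, u) \<in> parcs ?G}" using parcs_power_cycle_graph_iff[OF n3(2)] v by auto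
    qed
    moreover have "finite {u. (v, u) \<in> parcs ?G}"
      by (rule finite_subset[of _ "{..<n}"]) (auto simp: parcs_power_cycle_graph_iff[OF n3(2)])
    ultimately have "card (?W - {v}) \<le> card {u. (v, u) \<in> parcs ?G}" by (intro card_mono)
    then have G_deg: "2 * k' \<le> card {u. (v, u) \<in> parcs ?G}" using W by (auto simp: card_Diff_singleton_if split: if_splits)
    have "(1/2 + \<epsilon>\<^sub>1) * (2 * k') \<le> (1/2 + \<epsilon>) * card {u. (v, u) \<in> parcs ?G}"
      using G_deg eps eps1 by (intro mult_mono) auto
    also have "\<dots> \<le> card {u. (v, u) \<in> parcs H}" by (rule H_deg[OF v])
    also have "\<dots> \<le> card {u. adj v u} + 1"
    proof -
      have fin: "finite {u. adj v u}"
        by (rule finite_subset[of _ "{..<n}"]) (use H_arc in \<open>auto simp: adj_def\<close>)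
      show ?thesis
      proof (cases "2 * k + 1 \<le> n")
        case True
        then have "k' = k" unfolding k'_def by linarith
        then have "{u. (v, u) \<in> parcs H} = {u. adj v u}" using H_arc unfolding adj_def by blast
        then show ?thesis by simp
      next
        case False
        then have "n \<le> 2 * k' + 2" unfolding k'_def by linarith
        moreover have "card ({..<n} - ?W) = n - card ?W" by (subst card_Diff_subset) auto
        ultimately have "card ({..<n} - ?W) \<le> 1" using W by linarith
        moreover have "{u. (v, u) \<in> parcs H} \<subseteq> {u. adj v u} \<union> ({..<n} - ?W)"
          using H_arc unfolding adj_def by blast
        then have "card {u. (v, u) \<in> parcs H} \<le> card ({u. adj v u} \<union> ({..<n} - ?W))"
          using fin by (intro card_mono) auto
        then have "card {u. (v, u) \<in> parcs H} \<le> card {u. adj v u} + card ({..<n} - ?W)"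
          using card_Un_le order_trans by blast
        ultimately show ?thesis by linarith
      qed
    qed
    finally show "(1 + \<epsilon>\<^sub>1) * k' \<le> card {u. adj v u}" using k'1 by (simp add: algebra_simps)
  qed
  obtain p z where p: "p permutes {..<n}" "\<forall>u<n. adj u (p u)" "z < n" "\<forall>v<n. v \<in> orbit p z"
    using ex_single_cycle_permutation[OF k'] by blast
  show "hamiltonian H"
    using p by (intro hamiltonian_if_single_cycle[OF H_graph VH n3(1) p(1) _ p(3)]) (auto simp: adj_def)
qed

end
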